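(* Let $(\Omega,\mathcal{F},P)$ be a probability space, $\mathbb{K}\in\{\mathbb{R},\mathbb{C}\}$, and let $(E,\|\cdot\|)$ be a complete random uniformly convex $RN$ module over $\mathbb{K}$ with base $(\Omega,\mathcal{F},P)$ having full support, with random conjugate space $E^{*}$. Let $G$ be a (nonempty) a.s. bounded closed $L^{0}$-convex subset of $E$ and let $f:G\to G$ be a random asymptotically nonexpansive mapping. Then $I-f$ is random demiclosed at $\theta$, that is: for each sequence $\{x_{n}, n\in\mathbb{N}\}$ in $G$ and each $x\in E$, if $\{x_{n}, n\in\mathbb{N}\}$ converges in the random weak topology $\sigma(E,E^{*})$ to $x$ and $\{(I-f)x_{n}, n\in\mathbb{N}\}$ converges to $\theta$ (in the $(\varepsilon,\lambda)$-topology), then $(I-f)x=\theta$ (that is, $x\in G$ and $f(x)=x$). Here $I$ denotes the identity operator on $E$ and $\theta$ the null element of $E$.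
   Context: Notation. $L^{0}(\mathcal{F},\mathbb{K})$ is the algebra of equivalence classes (modulo a.s. equality) of $\mathbb{K}$-valued $\mathcal{F}$-measurable random variables on $(\Omega,\mathcal{F},P)$; $L^{0}(\mathcal{F})=L^{0}(\mathcal{F},\mathbb{R})$; $\bar L^{0}(\mathcal{F})$ is the set of equivalence classes of extended-real-valued $\mathcal{F}$-measurable random variables, ordered by $\xi\le\eta$ iff $\xi^{0}(\omega)\le\eta^{0}(\omega)$ for almost all $\omega$ (for representatives $\xi^0,\eta^0$); it is a complete lattice, and $\bigvee,\bigwedge$ denote supremum and infimum in it (i.e. essential supremum/infimum). $L^{0}_{+}(\mathcal{F})=\{\xi\in L^{0}(\mathcal{F}):\xi\ge 0\}$, $L^{0}_{++}(\mathcal{F})=\{\xi\in L^{0}(\mathcal{F}):\xi>0 \text{ a.s.}\}$. For $A\in\mathcal{F}$, a relation between random variables holds "on $A$" if it holds for almost all $\omega\in A$. $RN$ module. An $RN$ module over $\mathbb{K}$ with base $(\Omega,\mathcal{F},P)$ is a pair $(E,\|\cdot\|)$ where $E$ is a left module over the algebra $L^{0}(\mathcal{F},\mathbb{K})$ and $\|\cdot\|:E\to L^{0}_{+}(\mathcal{F})$ satisfies: $\|x\|=0$ implies $x=\theta$; $\|\xi x\|=|\xi|\,\|x\|$ for all $\xi\in L^{0}(\mathcal{F},\mathbb{K})$, $x\in E$; $\|x+y\|\le\|x\|+\|y\|$ for all $x,y\in E$. $E$ has full support if $P(\{\omega\in\Omega:\xi^{0}(\omega)=+\infty\})=1$, where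 $\xi^{0}$ is a representative of $\xi=\bigvee\{\|x\|:x\in E\}$. Topology. $E$ is endowed with the $(\varepsilon,\lambda)$-topology: the metrizable linear topology with local base at $\theta$ given by the sets $\{x\in E: P\{\|x\|<\varepsilon\}>1-\lambda\}$, $\varepsilon>0$, $0<\lambda<1$. Thus $x_n\to x$ iff $\|x_n-x\|\to0$ in probability. "Complete", "closed" and (unqualified) "converges" refer to this topology. Random conjugate space and random weak topology. $E^{*}$ is the $L^{0}(\mathcal{F},\mathbb{K})$-module of continuous module homomorphisms from $E$ to $L^{0}(\mathcal{F},\mathbb{K})$ ($L^{0}(\mathcal{F},\mathbb{K})$ having the topology of convergence in probability); equivalently, of linear maps $g:E\to L^{0}(\mathcal{F},\mathbb{K})$ for which there is $\xi\in L^{0}_{+}(\mathcal{F})$ with $|g(x)|\le\xi\|x\|$ for all $x\in E$. The random weak topology $\sigma(E,E^{*})$ is the linear topology on $E$ with local base at $\theta$ given by finite intersections of sets $\{x\in E:P\{|g(x)|<\varepsilon\}>1-\lambda\}$, $g\in E^{*}$, $\varepsilon>0$, $0<\lambda<1$. A sequence $x_n$ converges to $x$ in $\sigma(E,E^{*})$ iff $g(x_n)\to g(x)$ in probability for every $g\in E^{*}$. Sets. A nonempty $G\subseteq E$ is $L^{0}$-convex if $\xi x+\eta y\in G$ for all $x,y\in G$ and $\xi,\eta\in L^{0}_{+}(\mathcal{F})$ with $\xi+\eta=1$; it is a.s. bounded if $\bigvee\{\|x\|:x\in G\}\in L^{0}_{+}(\mathcal{F})$ (equivalently, there is $\xi\in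 L^0_+(\mathcal{F})$ with $\|x\|\le\xi$ for all $x\in G$). Random uniform convexity. For $x\in E$ let $A_x=\{\omega:\|x\|(\omega)\ne0\}$ (defined up to null sets), and for $x,y\in E$ let $B_{x,y}=A_x\cap A_y\cap A_{x-y}$. Let $\varepsilon_{\mathcal{F}}[0,2]=\{\varepsilon\in L^{0}_{++}(\mathcal{F}): \text{there is a real }\lambda>0\text{ with }\lambda\le\varepsilon\le2\}$ and $\delta_{\mathcal{F}}[0,1]=\{\delta\in L^{0}_{++}(\mathcal{F}): \text{there is a real }\eta>0\text{ with }\eta\le\delta\le1\}$. A complete $RN$ module $E$ is random uniformly convex if for each $\varepsilon\in\varepsilon_{\mathcal{F}}[0,2]$ there is $\delta\in\delta_{\mathcal{F}}[0,1]$ such that for all $x,y\in E$ with $\|x\|\le1$, $\|y\|\le1$ and all $D\in\mathcal{F}$ with $D\subseteq B_{x,y}$ (up to null sets) and $P(D)>0$: if $\|x-y\|\ge\varepsilon$ on $D$, then $\|x+y\|\le2(1-\delta)$ on $D$. Random asymptotically nonexpansive mapping. For nonempty $G\subseteq E$, $f:G\to G$ is random asymptotically nonexpansive if there is a sequence $\{\eta_m,m\in\mathbb{N}\}$ in $L^{0}_{+}(\mathcal{F})$ converging a.s. to $1$ such that $\|f^{m}x-f^{m}y\|\le\eta_m\|x-y\|$ for all $x,y\in G$ and $m\in\mathbb{N}$, where $f^m$ is the $m$-th iterate of $f$ and $\mathbb{N}$ is the set of positive integers. *)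

theory Defs
  imports "HOL-Probability.Probability" "HOL-Algebra.Module"
begin

section \<open>Random variables modulo almost sure equality\<close>

text \<open>\<open>K\<close> is the set of admissible values: \<open>\<real>\<close> or \<open>UNIV\<close> inside \<^typ>\<open>complex\<close> for the scalars,
  \<open>UNIV\<close> inside \<^typ>\<open>real\<close> or \<^typ>\<open>ereal\<close> for real and extended real random variables.\<close>

definition rvars :: "'w measure \<Rightarrow> 'k::topological_space set \<Rightarrow> ('w \<Rightarrow> 'k) set" where
  "rvars M K = M \<rightarrow>\<^sub>M restrict_space borel K"

definition ae_rel :: "'w measure \<Rightarrow> 'k::topological_space set \<Rightarrow> (('w \<Rightarrow> 'k) \<times> ('w \<Rightarrow> 'k)) set" where
  "ae_rel M K = {(f, g). f \<in> rvars M K \<and> g \<in> rvars M K \<and> (AE \<omega> in M. f \<omega> = g \<omega>)}"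

definition L0_set :: "'w measure \<Rightarrow> 'k::topological_space set \<Rightarrow> ('w \<Rightarrow> 'k) set set" where
  "L0_set M K = rvars M K // ae_rel M K"

definition L0_cls :: "'w measure \<Rightarrow> 'k::topological_space set \<Rightarrow> ('w \<Rightarrow> 'k) \<Rightarrow> ('w \<Rightarrow> 'k) set" where
  "L0_cls M K f = ae_rel M K `` {f}"

text \<open>An arbitrary representative, written \<open>\<xi>\<^sup>0\<close> on paper.\<close>

definition rep :: "('w \<Rightarrow> 'k) set \<Rightarrow> 'w \<Rightarrow> 'k" where
  "rep \<xi> = (SOME f. f \<in> \<xi>)"

definition L0 :: "'w measure \<Rightarrow> 'k::real_normed_field set \<Rightarrow> ('w \<Rightarrow> 'k) set ring" where
  "L0 M K = \<lparr> carrier = L0_set M K,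
     mult = (\<lambda>\<xi> \<eta>. L0_cls M K (\<lambda>\<omega>. rep \<xi> \<omega> * rep \<eta> \<omega>)),
     one = L0_cls M K (\<lambda>_. 1),
     zero = L0_cls M K (\<lambda>_. 0),
     add = (\<lambda>\<xi> \<eta>. L0_cls M K (\<lambda>\<omega>. rep \<xi> \<omega> + rep \<eta> \<omega>)) \<rparr>"

abbreviation L0_real :: "'w measure \<Rightarrow> ('w \<Rightarrow> real) set ring" where
  "L0_real M \<equiv> L0 M UNIV"

definition L0_le :: "'w measure \<Rightarrow> ('w \<Rightarrow> 'b::ord) set \<Rightarrow> ('w \<Rightarrow> 'b) set \<Rightarrow> bool" where
  "L0_le M \<xi> \<eta> \<longleftrightarrow> (AE \<omega> in M. rep \<xi> \<omega> \<le> rep \<eta> \<omega>)"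

definition L0_plus :: "'w measure \<Rightarrow> ('w \<Rightarrow> real) set set" where
  "L0_plus M = {\<xi> \<in> carrier (L0_real M). AE \<omega> in M. 0 \<le> rep \<xi> \<omega>}"

definition L0_pplus :: "'w measure \<Rightarrow> ('w \<Rightarrow> real) set set" where
  "L0_pplus M = {\<xi> \<in> carrier (L0_real M). AE \<omega> in M. 0 < rep \<xi> \<omega>}"

definition L0_abs :: "'w measure \<Rightarrow> ('w \<Rightarrow> 'k::real_normed_field) set \<Rightarrow> ('w \<Rightarrow> real) set" where
  "L0_abs M \<xi> = L0_cls M UNIV (\<lambda>\<omega>. norm (rep \<xi> \<omega>))"

text \<open>A real random variable regarded as an element of the scalar ring.\<close>

definition L0_scal :: "'w measure \<Rightarrow> complex set \<Rightarrow> ('w \<Rightarrow> real) set \<Rightarrow> ('w \<Rightarrow> complex) set" where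
  "L0_scal M K \<xi> = L0_cls M K (\<lambda>\<omega>. complex_of_real (rep \<xi> \<omega>))"

definition L0_bar :: "'w measure \<Rightarrow> ('w \<Rightarrow> ereal) set gorder" where
  "L0_bar M = \<lparr> carrier = L0_set M UNIV, eq = (=), le = L0_le M \<rparr>"

definition L0_ext :: "'w measure \<Rightarrow> ('w \<Rightarrow> real) set \<Rightarrow> ('w \<Rightarrow> ereal) set" where
  "L0_ext M \<xi> = L0_cls M UNIV (\<lambda>\<omega>. ereal (rep \<xi> \<omega>))"


section \<open>Random normed modules\<close>

locale RN_module = Module.module "L0 M K" E
  for M :: "'w measure" and K :: "complex set"
    and E :: "(('w \<Rightarrow> complex) set, 'e) module" +
  fixes N :: "'e \<Rightarrow> ('w \<Rightarrow> real) set"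
  assumes norm_closed: "x \<in> carrier E \<Longrightarrow> N x \<in> L0_plus M"
    and norm_zero: "x \<in> carrier E \<Longrightarrow> N x = \<zero>\<^bsub>L0_real M\<^esub> \<Longrightarrow> x = \<zero>\<^bsub>E\<^esub>"
    and norm_smult: "\<xi> \<in> carrier (L0 M K) \<Longrightarrow> x \<in> carrier E \<Longrightarrow>
      N (\<xi> \<odot>\<^bsub>E\<^esub> x) = L0_abs M \<xi> \<otimes>\<^bsub>L0_real M\<^esub> N x"
    and norm_triangle: "x \<in> carrier E \<Longrightarrow> y \<in> carrier E \<Longrightarrow>
      L0_le M (N (x \<oplus>\<^bsub>E\<^esub> y)) (N x \<oplus>\<^bsub>L0_real M\<^esub> N y)"

definition full_support ::
  "'w measure \<Rightarrow> ('a, 'e) module \<Rightarrow> ('e \<Rightarrow> ('w \<Rightarrow> real) set) \<Rightarrow> bool" where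
  "full_support M E N \<longleftrightarrow>
     (\<exists>\<xi>. is_lub (L0_bar M) \<xi> {L0_ext M (N x) |x. x \<in> carrier E} \<and>
          \<P>(\<omega> in M. rep \<xi> \<omega> = \<infinity>) = 1)"


section \<open>Topologies\<close>

text \<open>The translation invariant topology on an abelian group with local base \<open>\<B>\<close> at zero.\<close>

definition base_open :: "('e, 'm) ring_scheme \<Rightarrow> 'e set set \<Rightarrow> 'e set \<Rightarrow> bool" where
  "base_open R \<B> U \<longleftrightarrow> U \<subseteq> carrier R \<and>
     (\<forall>x\<in>U. \<exists>V\<in>\<B>. {x \<oplus>\<^bsub>R\<^esub> v |v. v \<in> V} \<subseteq> U)"

definition base_topology :: "('e, 'm) ring_scheme \<Rightarrow> 'e set set \<Rightarrow> 'e topology" where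
  "base_topology R \<B> = topology (base_open R \<B>)"

definition el_base ::
  "'w measure \<Rightarrow> ('e, 'm) ring_scheme \<Rightarrow> ('e \<Rightarrow> ('w \<Rightarrow> real) set) \<Rightarrow> 'e set set" where
  "el_base M R N =
     {{x \<in> carrier R. \<P>(\<omega> in M. rep (N x) \<omega> < \<epsilon>) > 1 - l} |\<epsilon> l. 0 < \<epsilon> \<and> 0 < l \<and> l < 1}"

definition el_topology ::
  "'w measure \<Rightarrow> ('e, 'm) ring_scheme \<Rightarrow> ('e \<Rightarrow> ('w \<Rightarrow> real) set) \<Rightarrow> 'e topology" where
  "el_topology M R N = base_topology R (el_base M R N)"

text \<open>The topology is metrizable, so completeness is a statement about Cauchy sequences.\<close>

definition RN_complete ::
  "'w measure \<Rightarrow> ('a, 'e) module \<Rightarrow> ('e \<Rightarrow> ('w \<Rightarrow> real) set) \<Rightarrow> bool" where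
  "RN_complete M E N \<longleftrightarrow>
     (\<forall>x :: nat \<Rightarrow> 'e. range x \<subseteq> carrier E \<longrightarrow>
        (\<forall>V \<in> el_base M E N. \<exists>n0. \<forall>m\<ge>n0. \<forall>n\<ge>n0. x m \<ominus>\<^bsub>E\<^esub> x n \<in> V) \<longrightarrow>
        (\<exists>l. limitin (el_topology M E N) x l sequentially))"

definition rconj :: "'w measure \<Rightarrow> complex set \<Rightarrow> (('w \<Rightarrow> complex) set, 'e) module \<Rightarrow>
    ('e \<Rightarrow> ('w \<Rightarrow> real) set) \<Rightarrow> ('e \<Rightarrow> ('w \<Rightarrow> complex) set) set" where
  "rconj M K E N = {g \<in> carrier E \<rightarrow> carrier (L0 M K).
     (\<forall>x\<in>carrier E. \<forall>y\<in>carrier E. g (x \<oplus>\<^bsub>E\<^esub> y) = g x \<oplus>\<^bsub>L0 M K\<^esub> g y) \<and>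
     (\<forall>\<xi>\<in>carrier (L0 M K). \<forall>x\<in>carrier E. g (\<xi> \<odot>\<^bsub>E\<^esub> x) = \<xi> \<otimes>\<^bsub>L0 M K\<^esub> g x) \<and>
     continuous_map (el_topology M E N) (el_topology M (L0 M K) (L0_abs M)) g}"

definition weak_subbase :: "'w measure \<Rightarrow> complex set \<Rightarrow> (('w \<Rightarrow> complex) set, 'e) module \<Rightarrow>
    ('e \<Rightarrow> ('w \<Rightarrow> real) set) \<Rightarrow> 'e set set" where
  "weak_subbase M K E N =
     {{x \<in> carrier E. \<P>(\<omega> in M. rep (L0_abs M (g x)) \<omega> < \<epsilon>) > 1 - l} |g \<epsilon> l.
        g \<in> rconj M K E N \<and> 0 < \<epsilon> \<and> 0 < l \<and> l < 1}"

definition random_weak_topology :: "'w measure \<Rightarrow> complex set \<Rightarrow>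
    (('w \<Rightarrow> complex) set, 'e) module \<Rightarrow> ('e \<Rightarrow> ('w \<Rightarrow> real) set) \<Rightarrow> 'e topology" where
  "random_weak_topology M K E N = base_topology E
     {carrier E \<inter> \<Inter>\<U> |\<U>. finite \<U> \<and> \<U> \<subseteq> weak_subbase M K E N}"


section \<open>Sets, convexity, mappings\<close>

definition L0_convex :: "'w measure \<Rightarrow> complex set \<Rightarrow> (('w \<Rightarrow> complex) set, 'e) module \<Rightarrow>
    'e set \<Rightarrow> bool" where
  "L0_convex M K E G \<longleftrightarrow> G \<noteq> {} \<and> G \<subseteq> carrier E \<and>
     (\<forall>x\<in>G. \<forall>y\<in>G. \<forall>\<xi>\<in>L0_plus M. \<forall>\<eta>\<in>L0_plus M.
        \<xi> \<oplus>\<^bsub>L0_real M\<^esub> \<eta> = \<one>\<^bsub>L0_real M\<^esub> \<longrightarrow>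
        (L0_scal M K \<xi> \<odot>\<^bsub>E\<^esub> x) \<oplus>\<^bsub>E\<^esub> (L0_scal M K \<eta> \<odot>\<^bsub>E\<^esub> y) \<in> G)"

definition as_bounded ::
  "'w measure \<Rightarrow> ('e \<Rightarrow> ('w \<Rightarrow> real) set) \<Rightarrow> 'e set \<Rightarrow> bool" where
  "as_bounded M N G \<longleftrightarrow>
     (\<exists>\<xi>\<in>L0_plus M. is_lub (L0_bar M) (L0_ext M \<xi>) {L0_ext M (N x) |x. x \<in> G})"

definition supp_set ::
  "'w measure \<Rightarrow> ('e \<Rightarrow> ('w \<Rightarrow> real) set) \<Rightarrow> 'e \<Rightarrow> 'w set" where
  "supp_set M N x = {\<omega> \<in> space M. rep (N x) \<omega> \<noteq> 0}"

definition supp_set2 :: "'w measure \<Rightarrow> ('a, 'e) module \<Rightarrow> ('e \<Rightarrow> ('w \<Rightarrow> real) set) \<Rightarrow>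
    'e \<Rightarrow> 'e \<Rightarrow> 'w set" where
  "supp_set2 M E N x y = supp_set M N x \<inter> supp_set M N y \<inter> supp_set M N (x \<ominus>\<^bsub>E\<^esub> y)"

definition eps_F :: "'w measure \<Rightarrow> ('w \<Rightarrow> real) set set" where
  "eps_F M = {\<epsilon> \<in> L0_pplus M. \<exists>l>0. AE \<omega> in M. l \<le> rep \<epsilon> \<omega> \<and> rep \<epsilon> \<omega> \<le> 2}"

definition delta_F :: "'w measure \<Rightarrow> ('w \<Rightarrow> real) set set" where
  "delta_F M = {\<delta> \<in> L0_pplus M. \<exists>l>0. AE \<omega> in M. l \<le> rep \<delta> \<omega> \<and> rep \<delta> \<omega> \<le> 1}"

definition random_uniformly_convex ::
  "'w measure \<Rightarrow> ('a, 'e) module \<Rightarrow> ('e \<Rightarrow> ('w \<Rightarrow> real) set) \<Rightarrow> bool" where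
  "random_uniformly_convex M E N \<longleftrightarrow> RN_complete M E N \<and>
     (\<forall>\<epsilon>\<in>eps_F M. \<exists>\<delta>\<in>delta_F M. \<forall>x\<in>carrier E. \<forall>y\<in>carrier E. \<forall>D\<in>sets M.
        L0_le M (N x) \<one>\<^bsub>L0_real M\<^esub> \<longrightarrow> L0_le M (N y) \<one>\<^bsub>L0_real M\<^esub> \<longrightarrow>
        (AE \<omega> in M. \<omega> \<in> D \<longrightarrow> \<omega> \<in> supp_set2 M E N x y) \<longrightarrow>
        measure M D > 0 \<longrightarrow>
        (AE \<omega> in M. \<omega> \<in> D \<longrightarrow> rep (N (x \<ominus>\<^bsub>E\<^esub> y)) \<omega> \<ge> rep \<epsilon> \<omega>) \<longrightarrow>
        (AE \<omega> in M. \<omega> \<in> D \<longrightarrow> rep (N (x \<oplus>\<^bsub>E\<^esub> y)) \<omega> \<le> 2 * (1 - rep \<delta> \<omega>)))"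

definition random_asymp_nonexpansive :: "'w measure \<Rightarrow> ('a, 'e) module \<Rightarrow>
    ('e \<Rightarrow> ('w \<Rightarrow> real) set) \<Rightarrow> 'e set \<Rightarrow> ('e \<Rightarrow> 'e) \<Rightarrow> bool" where
  "random_asymp_nonexpansive M E N G f \<longleftrightarrow> f \<in> G \<rightarrow> G \<and>
     (\<exists>\<eta> :: nat \<Rightarrow> ('w \<Rightarrow> real) set.
        (\<forall>m\<ge>1. \<eta> m \<in> L0_plus M) \<and>
        (AE \<omega> in M. (\<lambda>m. rep (\<eta> m) \<omega>) \<longlonglongrightarrow> 1) \<and>
        (\<forall>m\<ge>1. \<forall>x\<in>G. \<forall>y\<in>G.
           L0_le M (N ((f ^^ m) x \<ominus>\<^bsub>E\<^esub> (f ^^ m) y)) (\<eta> m \<otimes>\<^bsub>L0_real M\<^esub> N (x \<ominus>\<^bsub>E\<^esub> y))))"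

text \<open>\<open>T\<close> is a mapping from \<open>G\<close> to \<open>E\<close>; its values outside \<open>G\<close> are junk, hence the conclusion
  \<open>x \<in> G\<close>, which is implicit on paper in writing \<open>T x\<close>.\<close>

definition random_demiclosed_at :: "'w measure \<Rightarrow> complex set \<Rightarrow>
    (('w \<Rightarrow> complex) set, 'e) module \<Rightarrow> ('e \<Rightarrow> ('w \<Rightarrow> real) set) \<Rightarrow>
    'e set \<Rightarrow> ('e \<Rightarrow> 'e) \<Rightarrow> 'e \<Rightarrow> bool" where
  "random_demiclosed_at M K E N G T y \<longleftrightarrow>
     (\<forall>(u :: nat \<Rightarrow> 'e) x. range u \<subseteq> G \<longrightarrow> x \<in> carrier E \<longrightarrow>
        limitin (random_weak_topology M K E N) u x sequentially \<longrightarrow>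
        limitin (el_topology M E N) (\<lambda>n. T (u n)) y sequentially \<longrightarrow>
        x \<in> G \<and> T x = y)"


section \<open>Well-formedness\<close>

lemma equiv_ae_rel: "equiv (rvars M K) (ae_rel M K)"
  by (rule equivI) (auto simp: ae_rel_def refl_on_def sym_def trans_def)

lemma L0_cls_in [intro]: "f \<in> rvars M K \<Longrightarrow> L0_cls M K f \<in> L0_set M K"
  by (simp add: L0_cls_def L0_set_def quotientI)

lemma rep_in:
  assumes "\<xi> \<in> L0_set M K"
  shows "rep \<xi> \<in> \<xi>" and "rep \<xi> \<in> rvars M K"
proof -
  have "\<xi> \<noteq> {}"
    using assms unfolding L0_set_def by (rule in_quotient_imp_non_empty[OF equiv_ae_rel])
  then show *: "rep \<xi> \<in> \<xi>" unfolding rep_def by (simp add: some_in_eq)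
  have "\<xi> \<subseteq> rvars M K"
    using assms unfolding L0_set_def by (rule in_quotient_imp_subset[OF equiv_ae_rel])
  with * show "rep \<xi> \<in> rvars M K" ..
qed

lemma L0_cls_eqI:
  "f \<in> rvars M K \<Longrightarrow> g \<in> rvars M K \<Longrightarrow> AE \<omega> in M. f \<omega> = g \<omega> \<Longrightarrow> L0_cls M K f = L0_cls M K g"
  unfolding L0_cls_def by (rule equiv_class_eq[OF equiv_ae_rel]) (auto simp: ae_rel_def)

lemma L0_cls_rep:
  assumes "\<xi> \<in> L0_set M K"
  shows "L0_cls M K (rep \<xi>) = \<xi>"
proof -
  obtain f where f: "\<xi> = ae_rel M K `` {f}" "f \<in> rvars M K"
    using assms unfolding L0_set_def by (rule quotientE)
  have "(f, rep \<xi>) \<in> ae_rel M K"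
    using rep_in(1)[OF assms] unfolding f(1) by simp
  then show ?thesis
    unfolding L0_cls_def using equiv_class_eq[OF equiv_ae_rel] f(1) by metis
qed

lemma rep_L0_cls:
  assumes "f \<in> rvars M K"
  shows "AE \<omega> in M. rep (L0_cls M K f) \<omega> = f \<omega>"
proof -
  have "rep (L0_cls M K f) \<in> L0_cls M K f"
    by (rule rep_in) (rule L0_cls_in[OF assms])
  then show ?thesis by (auto simp: L0_cls_def ae_rel_def)
qed

lemma cring_L0:
  fixes K :: "'k::{real_normed_field, second_countable_topology} set"
  assumes K0: "0 \<in> K" and K1: "1 \<in> K"
    and Kadd: "\<And>a b. a \<in> K \<Longrightarrow> b \<in> K \<Longrightarrow> a + b \<in> K"
    and Kmul: "\<And>a b. a \<in> K \<Longrightarrow> b \<in> K \<Longrightarrow> a * b \<in> K"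
    and Kneg: "\<And>a. a \<in> K \<Longrightarrow> - a \<in> K"
  shows "cring (L0 M K)"
proof -
  have rv: "f \<in> rvars M K \<longleftrightarrow> f \<in> borel_measurable M \<and> (\<forall>\<omega>\<in>space M. f \<omega> \<in> K)" for f :: "'a \<Rightarrow> 'k"
    by (auto simp: rvars_def measurable_restrict_space2_iff)
  have add: "(\<lambda>\<omega>. f \<omega> + g \<omega>) \<in> rvars M K" if "f \<in> rvars M K" "g \<in> rvars M K" for f g
    using that Kadd by (auto simp: rv)
  have mul: "(\<lambda>\<omega>. f \<omega> * g \<omega>) \<in> rvars M K" if "f \<in> rvars M K" "g \<in> rvars M K" for f g
    using that Kmul by (auto simp: rv)
  have neg: "(\<lambda>\<omega>. - f \<omega>) \<in> rvars M K" if "f \<in> rvars M K" for f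
    using that Kneg by (auto simp: rv)
  have cst: "(\<lambda>_. 0) \<in> rvars M K" "(\<lambda>_. 1) \<in> rvars M K"
    using K0 K1 by (auto simp: rv)
  note cl = add mul neg cst rep_in(2) L0_cls_in
  have radd: "AE \<omega> in M. rep (L0_cls M K (\<lambda>\<omega>. rep \<xi> \<omega> + rep \<eta> \<omega>)) \<omega> = rep \<xi> \<omega> + rep \<eta> \<omega>"
    if "\<xi> \<in> L0_set M K" "\<eta> \<in> L0_set M K" for \<xi> \<eta>
    by (rule rep_L0_cls) (intro cl that)
  have rmul: "AE \<omega> in M. rep (L0_cls M K (\<lambda>\<omega>. rep \<xi> \<omega> * rep \<eta> \<omega>)) \<omega> = rep \<xi> \<omega> * rep \<eta> \<omega>"
    if "\<xi> \<in> L0_set M K" "\<eta> \<in> L0_set M K" for \<xi> \<eta>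
    by (rule rep_L0_cls) (intro cl that)
  have rcst: "AE \<omega> in M. rep (L0_cls M K (\<lambda>_. 0)) \<omega> = 0"
    "AE \<omega> in M. rep (L0_cls M K (\<lambda>_. 1)) \<omega> = 1"
    using rep_L0_cls[OF cst(1)] rep_L0_cls[OF cst(2)] by auto
  have c_add: "L0_cls M K (\<lambda>\<omega>. rep \<xi> \<omega> + rep \<eta> \<omega>) \<in> L0_set M K"
    and c_mul: "L0_cls M K (\<lambda>\<omega>. rep \<xi> \<omega> * rep \<eta> \<omega>) \<in> L0_set M K"
    if "\<xi> \<in> L0_set M K" "\<eta> \<in> L0_set M K" for \<xi> \<eta>
    by (intro cl that)+
  have c_cst: "L0_cls M K (\<lambda>_. 0) \<in> L0_set M K" "L0_cls M K (\<lambda>_. 1) \<in> L0_set M K"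
    by (intro cl)+
  show ?thesis
  proof (rule cringI)
    show "abelian_group (L0 M K)"
    proof (rule abelian_groupI, unfold L0_def ring.simps partial_object.simps monoid.simps)
      fix \<xi> \<eta> \<zeta> assume \<xi>: "\<xi> \<in> L0_set M K" and \<eta>: "\<eta> \<in> L0_set M K" and \<zeta>: "\<zeta> \<in> L0_set M K"
      show "L0_cls M K (\<lambda>\<omega>. rep (L0_cls M K (\<lambda>\<omega>. rep \<xi> \<omega> + rep \<eta> \<omega>)) \<omega> + rep \<zeta> \<omega>)
        = L0_cls M K (\<lambda>\<omega>. rep \<xi> \<omega> + rep (L0_cls M K (\<lambda>\<omega>. rep \<eta> \<omega> + rep \<zeta> \<omega>)) \<omega>)"
        using radd[OF \<xi> \<eta>] radd[OF \<eta> \<zeta>] by (intro L0_cls_eqI cl \<xi> \<eta> \<zeta>) (auto simp: add.assoc)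
    next
      fix \<xi> assume \<xi>: "\<xi> \<in> L0_set M K"
      show "L0_cls M K (\<lambda>\<omega>. rep (L0_cls M K (\<lambda>_. 0)) \<omega> + rep \<xi> \<omega>) = \<xi>"
      proof -
        have "L0_cls M K (\<lambda>\<omega>. rep (L0_cls M K (\<lambda>_. 0)) \<omega> + rep \<xi> \<omega>) = L0_cls M K (rep \<xi>)"
          using rcst by (intro L0_cls_eqI cl \<xi>) auto
        then show ?thesis by (simp add: L0_cls_rep \<xi>)
      qed
      have "L0_cls M K (\<lambda>\<omega>. rep (L0_cls M K (\<lambda>\<omega>. - rep \<xi> \<omega>)) \<omega> + rep \<xi> \<omega>) = L0_cls M K (\<lambda>_. 0)"
        using rep_L0_cls[OF neg[OF rep_in(2)[OF \<xi>]]] by (intro L0_cls_eqI cl \<xi>) auto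
      then show "\<exists>\<eta>\<in>L0_set M K. L0_cls M K (\<lambda>\<omega>. rep \<eta> \<omega> + rep \<xi> \<omega>) = L0_cls M K (\<lambda>_. 0)"
        by (rule bexI) (intro cl \<xi>)
    qed (auto intro: c_add c_cst simp: add.commute)
  next
    show "comm_monoid (L0 M K)"
    proof (rule comm_monoidI, unfold L0_def ring.simps partial_object.simps monoid.simps)
      fix \<xi> \<eta> \<zeta> assume \<xi>: "\<xi> \<in> L0_set M K" and \<eta>: "\<eta> \<in> L0_set M K" and \<zeta>: "\<zeta> \<in> L0_set M K"
      show "L0_cls M K (\<lambda>\<omega>. rep (L0_cls M K (\<lambda>\<omega>. rep \<xi> \<omega> * rep \<eta> \<omega>)) \<omega> * rep \<zeta> \<omega>)
        = L0_cls M K (\<lambda>\<omega>. rep \<xi> \<omega> * rep (L0_cls M K (\<lambda>\<omega>. rep \<eta> \<omega> * rep \<zeta> \<omega>)) \<omega>)"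
        using rmul[OF \<xi> \<eta>] rmul[OF \<eta> \<zeta>] by (intro L0_cls_eqI cl \<xi> \<eta> \<zeta>) (auto simp: mult.assoc)
    next
      fix \<xi> assume \<xi>: "\<xi> \<in> L0_set M K"
      have "L0_cls M K (\<lambda>\<omega>. rep (L0_cls M K (\<lambda>_. 1)) \<omega> * rep \<xi> \<omega>) = L0_cls M K (rep \<xi>)"
        using rcst by (intro L0_cls_eqI cl \<xi>) auto
      then show "L0_cls M K (\<lambda>\<omega>. rep (L0_cls M K (\<lambda>_. 1)) \<omega> * rep \<xi> \<omega>) = \<xi>"
        by (simp add: L0_cls_rep \<xi>)
    qed (auto intro: c_mul c_cst simp: mult.commute)
  next
    fix \<xi> \<eta> \<zeta>
    assume "\<xi> \<in> carrier (L0 M K)" "\<eta> \<in> carrier (L0 M K)" "\<zeta> \<in> carrier (L0 M K)"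
    then have \<xi>: "\<xi> \<in> L0_set M K" and \<eta>: "\<eta> \<in> L0_set M K" and \<zeta>: "\<zeta> \<in> L0_set M K"
      by (auto simp: L0_def)
    show "(\<xi> \<oplus>\<^bsub>L0 M K\<^esub> \<eta>) \<otimes>\<^bsub>L0 M K\<^esub> \<zeta> = \<xi> \<otimes>\<^bsub>L0 M K\<^esub> \<zeta> \<oplus>\<^bsub>L0 M K\<^esub> \<eta> \<otimes>\<^bsub>L0 M K\<^esub> \<zeta>"
      unfolding L0_def ring.simps partial_object.simps monoid.simps
      using radd[OF \<xi> \<eta>] rmul[OF \<xi> \<zeta>] rmul[OF \<eta> \<zeta>]
      by (intro L0_cls_eqI cl \<xi> \<eta> \<zeta>) (auto simp: distrib_right)
  qed
qed

lemma cring_L0_scalars: "K = \<real> \<or> K = UNIV \<Longrightarrow> cring (L0 M (K :: complex set))"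
  by (elim disjE; hypsubst; rule cring_L0) simp_all

lemma base_openD:
  "base_open R \<B> U \<Longrightarrow> x \<in> U \<Longrightarrow> \<exists>V\<in>\<B>. {x \<oplus>\<^bsub>R\<^esub> v |v. v \<in> V} \<subseteq> U"
  by (simp add: base_open_def)

lemma istopology_base_open:
  assumes "\<And>V W. V \<in> \<B> \<Longrightarrow> W \<in> \<B> \<Longrightarrow> \<exists>Z\<in>\<B>. Z \<subseteq> V \<inter> W"
  shows "istopology (base_open R \<B>)"
  unfolding istopology_def
proof (intro conjI allI impI)
  fix S T assume S: "base_open R \<B> S" and T: "base_open R \<B> T"
  show "base_open R \<B> (S \<inter> T)"
    unfolding base_open_def
  proof (rule conjI, goal_cases)
    case 1
    show ?case using S by (simp add: base_open_def le_infI1)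
  next
    case 2
    show ?case
    proof
      fix x assume x: "x \<in> S \<inter> T"
      obtain V where V: "V \<in> \<B>" "{x \<oplus>\<^bsub>R\<^esub> v |v. v \<in> V} \<subseteq> S"
        using base_openD[OF S IntD1[OF x]] ..
      obtain W where W: "W \<in> \<B>" "{x \<oplus>\<^bsub>R\<^esub> v |v. v \<in> W} \<subseteq> T"
        using base_openD[OF T IntD2[OF x]] ..
      obtain Z where Z: "Z \<in> \<B>" "Z \<subseteq> V \<inter> W" using assms[OF V(1) W(1)] ..
      have "{x \<oplus>\<^bsub>R\<^esub> v |v. v \<in> Z} \<subseteq> S \<inter> T"
        using V(2) W(2) Z(2) by fast
      with Z(1) show "\<exists>V\<in>\<B>. {x \<oplus>\<^bsub>R\<^esub> v |v. v \<in> V} \<subseteq> S \<inter> T" ..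
    qed
  qed
next
  fix \<U> assume U: "\<forall>S\<in>\<U>. base_open R \<B> S"
  show "base_open R \<B> (\<Union>\<U>)"
    unfolding base_open_def
  proof (rule conjI, goal_cases)
    case 1
    show ?case using U by (simp add: base_open_def Sup_le_iff)
  next
    case 2
    show ?case
    proof
      fix x assume "x \<in> \<Union>\<U>"
      then obtain S where S: "S \<in> \<U>" "x \<in> S" ..
      obtain V where V: "V \<in> \<B>" "{x \<oplus>\<^bsub>R\<^esub> v |v. v \<in> V} \<subseteq> S"
        using base_openD[OF bspec[OF U S(1)] S(2)] ..
      have "{x \<oplus>\<^bsub>R\<^esub> v |v. v \<in> V} \<subseteq> \<Union>\<U>"
        using V(2) S(1) by (meson Sup_upper order_trans)
      with V(1) show "\<exists>V\<in>\<B>. {x \<oplus>\<^bsub>R\<^esub> v |v. v \<in> V} \<subseteq> \<Union>\<U>" ..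
    qed
  qed
qed

lemma openin_el_topology:
  assumes "prob_space M" and "\<And>x. x \<in> carrier R \<Longrightarrow> N x \<in> carrier (L0_real M)"
  shows "openin (el_topology M R N) = base_open R (el_base M R N)"
proof -
  interpret prob_space M by fact
  have meas: "{\<omega> \<in> space M. rep (N x) \<omega> < \<epsilon>} \<in> sets M" if "x \<in> carrier R" for x and \<epsilon> :: real
  proof -
    have "rep (N x) \<in> rvars M UNIV" using assms(2)[OF that] by (simp add: L0_def rep_in)
    then have [measurable]: "rep (N x) \<in> borel_measurable M"
      by (simp add: rvars_def measurable_restrict_space2_iff)
    show ?thesis by measurable
  qed
  have "istopology (base_open R (el_base M R N))"
  proof (rule istopology_base_open)
    fix V W assume "V \<in> el_base M R N" "W \<in> el_base M R N"
    then obtain e l e' l' where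
      V: "V = {x \<in> carrier R. \<P>(\<omega> in M. rep (N x) \<omega> < e) > 1 - l}" "0 < e" "0 < l" "l < 1" and
      W: "W = {x \<in> carrier R. \<P>(\<omega> in M. rep (N x) \<omega> < e') > 1 - l'}" "0 < e'" "0 < l'" "l' < 1"
      unfolding el_base_def by blast
    let ?Z = "{x \<in> carrier R. \<P>(\<omega> in M. rep (N x) \<omega> < min e e') > 1 - min l l'}"
    have "?Z \<in> el_base M R N"
      unfolding el_base_def using V W
      by (intro CollectI exI[of _ "min e e'"] exI[of _ "min l l'"]) auto
    moreover have "?Z \<subseteq> V \<inter> W"
    proof
      fix x assume x: "x \<in> ?Z"
      then have "\<P>(\<omega> in M. rep (N x) \<omega> < min e e') \<le> \<P>(\<omega> in M. rep (N x) \<omega> < e)"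
        "\<P>(\<omega> in M. rep (N x) \<omega> < min e e') \<le> \<P>(\<omega> in M. rep (N x) \<omega> < e')"
        by (auto intro!: finite_measure_mono meas)
      with x show "x \<in> V \<inter> W" unfolding V W by auto
    qed
    ultimately show "\<exists>Z\<in>el_base M R N. Z \<subseteq> V \<inter> W" by blast
  qed
  then show ?thesis
    by (simp add: el_topology_def base_topology_def topology_inverse')
qed

lemma openin_random_weak_topology:
  "openin (random_weak_topology M K E N) =
     base_open E {carrier E \<inter> \<Inter>\<U> |\<U>. finite \<U> \<and> \<U> \<subseteq> weak_subbase M K E N}"
proof -
  let ?B = "{carrier E \<inter> \<Inter>\<U> |\<U>. finite \<U> \<and> \<U> \<subseteq> weak_subbase M K E N}"
  have "istopology (base_open E ?B)"
  proof (rule istopology_base_open)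
    fix V W assume "V \<in> ?B" "W \<in> ?B"
    then obtain \<U> \<U>' where "V = carrier E \<inter> \<Inter>\<U>" "finite \<U>" "\<U> \<subseteq> weak_subbase M K E N"
      "W = carrier E \<inter> \<Inter>\<U>'" "finite \<U>'" "\<U>' \<subseteq> weak_subbase M K E N" by blast
    then show "\<exists>Z\<in>?B. Z \<subseteq> V \<inter> W"
      by (intro bexI[of _ "carrier E \<inter> \<Inter>(\<U> \<union> \<U>')"] CollectI exI[of _ "\<U> \<union> \<U>'"]) auto
  qed
  then show ?thesis
    by (simp add: random_weak_topology_def base_topology_def topology_inverse')
qed

end

(* Along u the iterates of f move points little: |f^m u_n - u_n| -> 0 in probability as first n and then
   m tends to infinity. By random uniform convexity this property passes to sequences of midpoints
   of two such sequences, because f^m of a midpoint is almost as close to both end points as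
   the midpoint itself.

   On the other hand, Kakutani's proof of the Banach-Saks property produces midpoints closer to the weak
   limit x. If |u_n - x| <= S asymptotically, take a module homomorphism norming u_n - x; since it
   nearly vanishes at u_j - x for large j, either u_n is much closer to x than S or u_n and u_j are far
   apart, and then |(u_n + u_j)/2 - x| <= theta S up to a small error, with a constant theta < 1.
   The norming homomorphism comes from a Hahn-Banach theorem in which a minimal L^0-sublinear map is
   shown to be linear, essential infima playing the role of real infima.

   After k rounds the distance to x is at most theta^k S. As G is closed, x belongs to G, and
   |f^m x - x| <= |f^m x - f^m y_n| + |f^m y_n - y_n| + |y_n - x| shows that f^m x -> x, so f x = x. *)

theory Submission
  imports Defs
begin

section \<open>Essential infima\<close>

text \<open>The map \<open>f\<close> itself need not be nonexpansive: \<open>lip m\<close> is near 1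
  only for large \<open>m\<close>. So for a fixed \<open>m\<close>, midpoints of points almost fixed
  by \<open>f ^^ m\<close> need not be almost fixed, and only the limit with \<open>n\<close> before
  \<open>m\<close> survives midpoints. All radii and distances are random and may vanish on part of
  the space. The estimates therefore stay pointwise, with error terms that tend to zero in
  probability. Uniform convexity is first put into a homogeneous form with a measurable radius; it
  is invoked only at constant separations, where the gap \<delta> has a positive real lower bound,
  and so the contraction factor \<theta> is a constant. Passing to midpoints keeps the points inside
  \<open>G\<close>, so norm-closedness alone yields \<open>x \<in> G\<close>; this takes the place
  of Mazur's theorem. The last step from \<open>(f ^^ m) x\<close> tending to \<open>x\<close> to
  \<open>f x = x\<close> rests on the Lipschitz bound for the first power: |f x - x| is at most lip
  1 * |f^m x - x| + |f^(m+1) x - x|.\<close>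

definition is_ess_inf :: "'w measure \<Rightarrow> ('w \<Rightarrow> real) set \<Rightarrow> ('w \<Rightarrow> real) \<Rightarrow> bool" where
  "is_ess_inf M \<Phi> g \<longleftrightarrow> g \<in> borel_measurable M \<and> (\<forall>f\<in>\<Phi>. AE \<omega> in M. g \<omega> \<le> f \<omega>) \<and>
     (\<forall>h\<in>borel_measurable M. (\<forall>f\<in>\<Phi>. AE \<omega> in M. h \<omega> \<le> f \<omega>) \<longrightarrow> (AE \<omega> in M. h \<omega> \<le> g \<omega>))"

text \<open>For an uncountable family the pointwise infimum may be non-measurable or too small. The
  greatest lower bound in the almost sure order is fixed only up to null sets, hence the
  choice.\<close>

definition ess_inf :: "'w measure \<Rightarrow> ('w \<Rightarrow> real) set \<Rightarrow> 'w \<Rightarrow> real" where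
  "ess_inf M \<Phi> = (SOME g. is_ess_inf M \<Phi> g)"

text \<open>Exhaustion by countable subfamilies: the integral of the arctan of their infima is
  minimised. Since arctan is bounded, all integrals exist; since it is strictly increasing, equal
  integrals of ordered functions force almost sure equality. A minimising subfamily thus cannot be
  improved by adding a further member.\<close>

lemma (in prob_space) is_ess_inf_exists:
  fixes \<Phi> :: "('a \<Rightarrow> real) set"
  assumes ne: "\<Phi> \<noteq> {}" and meas: "\<Phi> \<subseteq> borel_measurable M"
    and b: "b \<in> borel_measurable M" and lower: "\<And>f. f \<in> \<Phi> \<Longrightarrow> AE \<omega> in M. b \<omega> \<le> f \<omega>"
  shows "\<exists>g. is_ess_inf M \<Phi> g"
proof -
  \<comment> \<open>Truncation at \<open>b\<close> changes nothing almost surely, but bounds the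
    infimum below at every sample point.\<close>
  define J where "J s = (\<lambda>\<omega>. INF i. max (s i \<omega>) (b \<omega>))" for s :: "nat \<Rightarrow> 'a \<Rightarrow> real"
  define v where "v s = (\<integral>\<omega>. arctan (J s \<omega>) \<partial>M)" for s
  define S where "S = {s :: nat \<Rightarrow> 'a \<Rightarrow> real. range s \<subseteq> \<Phi>}"
  have bdd: "bdd_below (range (\<lambda>i. max (s i \<omega>) (b \<omega>)))" for s \<omega>
    by (rule bdd_belowI[of _ "b \<omega>"]) auto
  have J_meas: "J s \<in> borel_measurable M" if "s \<in> S" for s
  proof -
    have [measurable]: "s i \<in> borel_measurable M" for i using that meas by (auto simp: S_def)
    show ?thesis unfolding J_def using b bdd by measurable
  qed
  have int: "integrable M (\<lambda>\<omega>. arctan (J s \<omega>))" if "s \<in> S" for s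
  proof (rule integrable_const_bound[of _ "pi/2"])
    have "\<bar>arctan x\<bar> \<le> pi / 2" for x using arctan_bounded[of x] by linarith
    then show "AE \<omega> in M. norm (arctan (J s \<omega>)) \<le> pi / 2" by simp
    show "(\<lambda>\<omega>. arctan (J s \<omega>)) \<in> borel_measurable M"
      using J_meas[OF that] by (rule measurable_compose) simp
  qed
  have v_bdd: "bdd_below (v ` S)"
  proof (rule bdd_belowI2)
    fix s assume "s \<in> S"
    have "(\<integral>\<omega>. -pi/2 \<partial>M) \<le> v s" unfolding v_def
      using arctan_lbound by (intro integral_mono int \<open>s \<in> S\<close>) (auto simp: less_imp_le)
    then show "-pi/2 \<le> v s" by (simp add: prob_space)
  qed
  obtain f0 where f0: "f0 \<in> \<Phi>" using ne by auto
  then have S_ne: "S \<noteq> {}" by (auto simp: S_def intro!: exI[of _ "\<lambda>_. f0"])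
  define V where "V = Inf (v ` S)"
  have "\<exists>s\<in>S. v s < V + 1 / Suc k" for k :: nat
    using cInf_lessD[of "v ` S" "V + 1 / Suc k"] S_ne by (auto simp: V_def)
  then obtain s where s: "\<And>k. s k \<in> S" "\<And>k. v (s k) < V + 1 / Suc k" by metis
  \<comment> \<open>Lists the members of all near-optimal families at once, so that \<open>t\<close>
    does at least as well as each \<open>s k\<close>.\<close>
  define t where "t = (\<lambda>n. case prod_decode n of (k, i) \<Rightarrow> s k i)"
  have tS: "t \<in> S" using s(1) by (auto simp: S_def t_def range_subsetD split: prod.split)
  have J_le: "J s' \<omega> \<le> J s'' \<omega>" if "range s'' \<subseteq> range s'" for s' s'' \<omega>
    unfolding J_def
  proof (rule cINF_mono)
    fix i show "\<exists>n\<in>UNIV. max (s' n \<omega>) (b \<omega>) \<le> max (s'' i \<omega>) (b \<omega>)" using that by (metis UNIV_I order_refl rangeE range_subsetD)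
  qed (use bdd in auto)
  have t_range: "range (s k) \<subseteq> range t" for k
  proof
    fix f assume "f \<in> range (s k)"
    then obtain i where "f = s k i" by auto
    then have "f = t (prod_encode (k, i))" by (simp add: t_def)
    then show "f \<in> range t" by auto
  qed
  have v_mono: "v s' \<le> v s''" if "range s'' \<subseteq> range s'" "s' \<in> S" "s'' \<in> S" for s' s''
    unfolding v_def by (intro integral_mono int that) (simp add: arctan_le_iff J_le that)
  have V_le: "V \<le> v s'" if "s' \<in> S" for s'
    unfolding V_def using v_bdd that by (rule cINF_lower)
  have "v t \<le> V + 1 / Suc k" for k
    using v_mono[OF t_range tS s(1), of k] s(2)[of k] by linarith
  then have "v t \<le> V"
    using LIMSEQ_inverse_real_of_nat_add[of V]
    by (intro LIMSEQ_le_const[of "\<lambda>k. V + inverse (real (Suc k))"]) (auto simp: field_simps)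
  then have vt: "v t = V" using V_le[OF tS] by simp
  have "is_ess_inf M \<Phi> (J t)"
    unfolding is_ess_inf_def
  proof (intro conjI ballI impI)
    show "J t \<in> borel_measurable M" using tS by (rule J_meas)
    fix f assume f: "f \<in> \<Phi>"
    \<comment> \<open>Prepending \<open>f\<close> cannot push the integral below its minimum, so
      \<open>J t'\<close> and \<open>J t\<close> agree almost surely, while \<open>J t'\<close> lies
      below \<open>f\<close> by construction.\<close>
    define t' where "t' = case_nat f t"
    have t'S: "t' \<in> S" using f tS by (auto simp: S_def t'_def range_subsetD split: nat.splits)
    have "range t \<subseteq> range t'"
    proof
      fix g assume "g \<in> range t"
      then obtain i where "g = t i" by auto
      then have "g = t' (Suc i)" by (simp add: t'_def)
      then show "g \<in> range t'" by auto
    qed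
    note tt' = J_le[OF this] v_mono[OF this t'S tS]
    have "v t' = v t" using tt'(2) V_le[OF t'S] vt by simp
    then have "(\<integral>\<omega>. arctan (J t \<omega>) - arctan (J t' \<omega>) \<partial>M) = 0"
      unfolding v_def using int[OF tS] int[OF t'S] by simp
    then have "AE \<omega> in M. arctan (J t \<omega>) - arctan (J t' \<omega>) = 0"
      using tt'(1) int[OF tS] int[OF t'S]
      by (subst (asm) integral_nonneg_eq_0_iff_AE) (auto simp: arctan_le_iff)
    then show "AE \<omega> in M. J t \<omega> \<le> f \<omega>"
      using lower[OF f]
    proof eventually_elim
      case (elim \<omega>)
      have "J t' \<omega> \<le> max (t' 0 \<omega>) (b \<omega>)" unfolding J_def using bdd by (intro cINF_lower) auto
      with elim show ?case by (auto simp: t'_def arctan_eq_iff)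
    qed
  next
    fix h assume h: "h \<in> borel_measurable M" "\<forall>f\<in>\<Phi>. AE \<omega> in M. h \<omega> \<le> f \<omega>"
    have "AE \<omega> in M. \<forall>i. h \<omega> \<le> t i \<omega>"
      unfolding AE_all_countable
    proof
      fix i
      have "t i \<in> \<Phi>" using tS by (auto simp: S_def)
      with h(2) show "AE \<omega> in M. h \<omega> \<le> t i \<omega>" by blast
    qed
    then show "AE \<omega> in M. h \<omega> \<le> J t \<omega>"
      unfolding J_def by eventually_elim (rule cINF_greatest, auto simp: le_max_iff_disj)
  qed
  then show ?thesis by blast
qed

context prob_space
begin

context
  fixes \<Phi> :: "('a \<Rightarrow> real) set" and b :: "'a \<Rightarrow> real"
  assumes ne: "\<Phi> \<noteq> {}" and meas: "\<Phi> \<subseteq> borel_measurable M"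
    and b: "b \<in> borel_measurable M" and lower: "\<And>f. f \<in> \<Phi> \<Longrightarrow> AE \<omega> in M. b \<omega> \<le> f \<omega>"
begin

lemma is_ess_inf_ess_inf: "is_ess_inf M \<Phi> (ess_inf M \<Phi>)"
  unfolding ess_inf_def
  by (rule someI_ex[of "is_ess_inf M \<Phi>"], rule is_ess_inf_exists[OF ne meas b lower])

lemma ess_inf_measurable: "ess_inf M \<Phi> \<in> borel_measurable M"
  using is_ess_inf_ess_inf by (simp add: is_ess_inf_def)

lemma ess_inf_lower: "f \<in> \<Phi> \<Longrightarrow> AE \<omega> in M. ess_inf M \<Phi> \<omega> \<le> f \<omega>"
  using is_ess_inf_ess_inf by (simp add: is_ess_inf_def)

lemma ess_inf_greatest:
  "h \<in> borel_measurable M \<Longrightarrow> (\<And>f. f \<in> \<Phi> \<Longrightarrow> AE \<omega> in M. h \<omega> \<le> f \<omega>) \<Longrightarrow> AE \<omega> in M. h \<omega> \<le> ess_inf M \<Phi> \<omega>"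
  using is_ess_inf_ess_inf by (simp add: is_ess_inf_def)

lemma ess_inf_mult_greatest:
  assumes [measurable]: "h \<in> borel_measurable M" "a \<in> borel_measurable M"
    and a: "\<And>\<omega>. 0 \<le> a \<omega>" and le: "\<And>f. f \<in> \<Phi> \<Longrightarrow> AE \<omega> in M. h \<omega> \<le> a \<omega> * f \<omega>"
  shows "AE \<omega> in M. h \<omega> \<le> a \<omega> * ess_inf M \<Phi> \<omega>"
proof -
  note [measurable] = b
  \<comment> \<open>Division by \<open>a\<close> is impossible where \<open>a\<close> vanishes;
    there any lower bound of the family serves, and \<open>b\<close> is one.\<close>
  define h' where "h' \<omega> = (if a \<omega> = 0 then b \<omega> else h \<omega> / a \<omega>)" for \<omega>
  have "AE \<omega> in M. h' \<omega> \<le> ess_inf M \<Phi> \<omega>"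
  proof (rule ess_inf_greatest)
    show "h' \<in> borel_measurable M" unfolding h'_def by measurable
    fix f assume f: "f \<in> \<Phi>"
    show "AE \<omega> in M. h' \<omega> \<le> f \<omega>"
      using le[OF f] lower[OF f]
    proof eventually_elim
      case (elim \<omega>)
      then show ?case using a[of \<omega>] by (auto simp: h'_def divide_simps mult.commute)
    qed
  qed
  \<comment> \<open>Where \<open>a\<close> vanishes the claim reads
    \<open>h \<omega> \<le> 0\<close>, and a single member of the family gives it.\<close>
  moreover obtain f where "f \<in> \<Phi>" using ne by auto
  from le[OF this] have "AE \<omega> in M. a \<omega> = 0 \<longrightarrow> h \<omega> \<le> 0" by eventually_elim auto
  ultimately show ?thesis
  proof eventually_elim
    case (elim \<omega>)
    then show ?case using a[of \<omega>] by (auto simp: h'_def divide_simps mult.commute split: if_splits)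
  qed
qed

end

text \<open>The two infima are formed one after the other, each time with the member of the other
  family held fixed. This is why \<open>le\<close> must cover all pairs and not only matching
  ones.\<close>

lemma ess_inf_add_greatest:
  fixes \<Phi> \<Psi> :: "('a \<Rightarrow> real) set"
  assumes \<Phi>: "\<Phi> \<noteq> {}" "\<Phi> \<subseteq> borel_measurable M" "b \<in> borel_measurable M" "\<And>f. f \<in> \<Phi> \<Longrightarrow> AE \<omega> in M. b \<omega> \<le> f \<omega>"
    and \<Psi>: "\<Psi> \<noteq> {}" "\<Psi> \<subseteq> borel_measurable M" "c \<in> borel_measurable M" "\<And>f. f \<in> \<Psi> \<Longrightarrow> AE \<omega> in M. c \<omega> \<le> f \<omega>"
    and h[measurable]: "h \<in> borel_measurable M"
    and le: "\<And>f g. f \<in> \<Phi> \<Longrightarrow> g \<in> \<Psi> \<Longrightarrow> AE \<omega> in M. h \<omega> \<le> f \<omega> + g \<omega>"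
  shows "AE \<omega> in M. h \<omega> \<le> ess_inf M \<Phi> \<omega> + ess_inf M \<Psi> \<omega>"
proof -
  have "AE \<omega> in M. h \<omega> - ess_inf M \<Psi> \<omega> \<le> ess_inf M \<Phi> \<omega>"
  proof (rule ess_inf_greatest[OF \<Phi>])
    show "(\<lambda>\<omega>. h \<omega> - ess_inf M \<Psi> \<omega>) \<in> borel_measurable M"
      using ess_inf_measurable[OF \<Psi>] by measurable
    fix f assume f: "f \<in> \<Phi>"
    have "AE \<omega> in M. h \<omega> - f \<omega> \<le> ess_inf M \<Psi> \<omega>"
    proof (rule ess_inf_greatest[OF \<Psi>])
      have [measurable]: "f \<in> borel_measurable M" using f \<Phi> by auto
      show "(\<lambda>\<omega>. h \<omega> - f \<omega>) \<in> borel_measurable M" by measurable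
      fix g assume "g \<in> \<Psi>"
      from le[OF f this] show "AE \<omega> in M. h \<omega> - f \<omega> \<le> g \<omega>" by eventually_elim auto
    qed
    then show "AE \<omega> in M. h \<omega> - ess_inf M \<Psi> \<omega> \<le> f \<omega>" by eventually_elim auto
  qed
  then show ?thesis by eventually_elim auto
qed

end

section \<open>Convergence to zero in probability along a filter\<close>

text \<open>Ky Fan form of convergence in probability: one number bounds both the deviation and its
  probability. A general filter serves sequences and iterated limits alike.\<close>

definition vanishing :: "'w measure \<Rightarrow> 'i filter \<Rightarrow> ('i \<Rightarrow> 'w \<Rightarrow> real) \<Rightarrow> bool" where
  "vanishing M F X \<longleftrightarrow> (\<forall>i. X i \<in> borel_measurable M) \<and>
     (\<forall>e>0. \<forall>\<^sub>F i in F. measure M {\<omega> \<in> space M. e \<le> \<bar>X i \<omega>\<bar>} < e)"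

lemma vanishingD: "vanishing M F X \<Longrightarrow> 0 < e \<Longrightarrow> \<forall>\<^sub>F i in F. measure M {\<omega> \<in> space M. e \<le> \<bar>X i \<omega>\<bar>} < e"
  by (simp add: vanishing_def)

lemma vanishing_compose:
  "vanishing M F X \<Longrightarrow> filterlim h F G \<Longrightarrow> vanishing M G (\<lambda>i. X (h i))"
  unfolding vanishing_def filterlim_iff by auto

context prob_space
begin

text \<open>Testing at \<open>min c p\<close> recovers the usual form with independent bounds for
  deviation and probability.\<close>

lemma vanishing_prob_less:
  assumes "vanishing M F X" "0 < c" "0 < p"
  shows "\<forall>\<^sub>F i in F. prob {\<omega> \<in> space M. c \<le> \<bar>X i \<omega>\<bar>} < p"
proof -
  have [measurable]: "X i \<in> borel_measurable M" for i using assms(1) by (simp add: vanishing_def)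
  from vanishingD[OF assms(1), of "min c p"] assms(2,3)
  have "\<forall>\<^sub>F i in F. prob {\<omega> \<in> space M. min c p \<le> \<bar>X i \<omega>\<bar>} < min c p" by simp
  then show ?thesis
  proof eventually_elim
    case (elim i)
    have "prob {\<omega> \<in> space M. c \<le> \<bar>X i \<omega>\<bar>} \<le> prob {\<omega> \<in> space M. min c p \<le> \<bar>X i \<omega>\<bar>}"
      by (rule finite_measure_mono) auto
    with elim show ?case by simp
  qed
qed

text \<open>The comparison \<open>Y\<close>, the threshold and the exceptional set may depend on the
  tolerance, but not on the index. This absorbs unbounded random factors, which are bounded off an
  event of small probability.\<close>

lemma vanishingI_approx:
  assumes X: "\<And>i. X i \<in> borel_measurable M"
    and approx: "\<And>e. 0 < e \<Longrightarrow> \<exists>Y c B. vanishing M F Y \<and> 0 < c \<and> B \<in> sets M \<and> prob B < e \<and>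
      (\<forall>i. AE \<omega> in M. \<omega> \<notin> B \<longrightarrow> \<bar>Y i \<omega>\<bar> < c \<longrightarrow> \<bar>X i \<omega>\<bar> < e)"
  shows "vanishing M F X"
  unfolding vanishing_def
proof (intro conjI allI impI X)
  fix e :: real assume e: "0 < e"
  obtain Y c B where Y: "vanishing M F Y" and c: "0 < c" and B[measurable]: "B \<in> sets M" "prob B < e/2"
    and dom: "\<And>i. AE \<omega> in M. \<omega> \<notin> B \<longrightarrow> \<bar>Y i \<omega>\<bar> < c \<longrightarrow> \<bar>X i \<omega>\<bar> < e/2"
    using approx[of "e/2"] e by auto
  note [measurable] = X
  have [measurable]: "Y i \<in> borel_measurable M" for i using Y by (simp add: vanishing_def)
  show "\<forall>\<^sub>F i in F. prob {\<omega> \<in> space M. e \<le> \<bar>X i \<omega>\<bar>} < e"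
    using vanishing_prob_less[OF Y c half_gt_zero[OF e]]
  proof (rule eventually_mono)
    fix i assume i: "prob {\<omega> \<in> space M. c \<le> \<bar>Y i \<omega>\<bar>} < e/2"
    have "prob {\<omega> \<in> space M. e \<le> \<bar>X i \<omega>\<bar>} \<le> prob (B \<union> {\<omega> \<in> space M. c \<le> \<bar>Y i \<omega>\<bar>})"
    proof (rule finite_measure_mono_AE)
      show "AE \<omega> in M. \<omega> \<in> {\<omega> \<in> space M. e \<le> \<bar>X i \<omega>\<bar>} \<longrightarrow> \<omega> \<in> B \<union> {\<omega> \<in> space M. c \<le> \<bar>Y i \<omega>\<bar>}"
        using dom[of i] by eventually_elim (use e in auto)
    qed measurable
    also have "\<dots> \<le> prob B + prob {\<omega> \<in> space M. c \<le> \<bar>Y i \<omega>\<bar>}"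
      by (rule measure_Un_le) auto
    finally show "prob {\<omega> \<in> space M. e \<le> \<bar>X i \<omega>\<bar>} < e" using i B(2) by linarith
  qed
qed

text \<open>Tightness of a single finite random variable, by continuity from above.\<close>

lemma prob_greater_small:
  fixes R :: "'a \<Rightarrow> real"
  assumes [measurable]: "R \<in> borel_measurable M" and e: "0 < e"
  obtains k where "0 < k" "prob {\<omega> \<in> space M. k < \<bar>R \<omega>\<bar>} < e"
proof -
  let ?A = "\<lambda>n::nat. {\<omega> \<in> space M. real n < \<bar>R \<omega>\<bar>}"
  have "(\<lambda>n. prob (?A n)) \<longlonglongrightarrow> prob (\<Inter>n. ?A n)"
    by (rule finite_Lim_measure_decseq) (auto simp: decseq_def)
  moreover have "(\<Inter>n. ?A n) = {}"
    by auto (meson less_asym' reals_Archimedean2)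
  ultimately have "(\<lambda>n. prob (?A n)) \<longlonglongrightarrow> 0" by simp
  then have "\<forall>\<^sub>F n in sequentially. prob (?A n) < e" using e by (rule order_tendstoD)
  then have "\<forall>\<^sub>F n in sequentially. prob (?A n) < e \<and> 0 < n"
    using eventually_gt_at_top[of 0] by eventually_elim auto
  then obtain n where "prob (?A n) < e" "0 < n" using eventually_happens'[OF sequentially_bot] by blast
  then show ?thesis by (intro that[of "real n"]) auto
qed

text \<open>\<open>R\<close> is at most \<open>k\<close> off a small event, so \<epsilon> = e / (2k)
  leaves at most e/2 there. That \<open>Y\<close> may change with \<epsilon> matters: below, its
  construction involves a convexity gap or a number of rounds chosen for \<epsilon>.\<close>

lemma vanishing_dominated_eps:
  fixes X :: "'i \<Rightarrow> 'a \<Rightarrow> real"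
  assumes X: "\<And>i. X i \<in> borel_measurable M" and R[measurable]: "R \<in> borel_measurable M"
    and le: "\<And>\<epsilon>. 0 < \<epsilon> \<Longrightarrow> \<exists>Y. vanishing M F Y \<and> (\<forall>i. AE \<omega> in M. \<bar>X i \<omega>\<bar> \<le> \<epsilon> * \<bar>R \<omega>\<bar> + \<bar>Y i \<omega>\<bar>)"
  shows "vanishing M F X"
proof (rule vanishingI_approx[OF X])
  fix e :: real assume e: "0 < e"
  obtain k where k: "0 < k" "prob {\<omega> \<in> space M. k < \<bar>R \<omega>\<bar>} < e" using prob_greater_small[OF R e] .
  obtain Y where Y: "vanishing M F Y" and XY: "\<And>i. AE \<omega> in M. \<bar>X i \<omega>\<bar> \<le> e / (2*k) * \<bar>R \<omega>\<bar> + \<bar>Y i \<omega>\<bar>"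
    using le[of "e / (2*k)"] e k by auto
  show "\<exists>Y c B. vanishing M F Y \<and> 0 < c \<and> B \<in> sets M \<and> prob B < e \<and>
      (\<forall>i. AE \<omega> in M. \<omega> \<notin> B \<longrightarrow> \<bar>Y i \<omega>\<bar> < c \<longrightarrow> \<bar>X i \<omega>\<bar> < e)"
  proof (intro exI conjI allI)
    show "vanishing M F Y" "0 < e/2" "{\<omega> \<in> space M. k < \<bar>R \<omega>\<bar>} \<in> sets M"
      "prob {\<omega> \<in> space M. k < \<bar>R \<omega>\<bar>} < e" using Y e k by auto
    fix i
    show "AE \<omega> in M. \<omega> \<notin> {\<omega> \<in> space M. k < \<bar>R \<omega>\<bar>} \<longrightarrow> \<bar>Y i \<omega>\<bar> < e/2 \<longrightarrow> \<bar>X i \<omega>\<bar> < e"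
      using XY[of i] AE_space
    proof eventually_elim
      case (elim \<omega>)
      show ?case
      proof (intro impI)
        assume "\<omega> \<notin> {\<omega> \<in> space M. k < \<bar>R \<omega>\<bar>}" and Y: "\<bar>Y i \<omega>\<bar> < e/2"
        with elim have R: "\<bar>R \<omega>\<bar> \<le> k" by auto
        then have "e / (2*k) * \<bar>R \<omega>\<bar> \<le> e / (2*k) * k" using e k by (intro mult_left_mono) auto
        then have "e / (2*k) * \<bar>R \<omega>\<bar> \<le> e/2" using k by simp
        then show "\<bar>X i \<omega>\<bar> < e" using elim Y by linarith
      qed
    qed
  qed
qed

lemma vanishing_mult:
  assumes Y: "vanishing M F Y" and R[measurable]: "R \<in> borel_measurable M"
  shows "vanishing M F (\<lambda>i \<omega>. R \<omega> * Y i \<omega>)"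
proof (rule vanishingI_approx)
  have [measurable]: "Y i \<in> borel_measurable M" for i using Y by (simp add: vanishing_def)
  show "(\<lambda>\<omega>. R \<omega> * Y i \<omega>) \<in> borel_measurable M" for i by measurable
  fix e :: real assume e: "0 < e"
  obtain k where k: "0 < k" "prob {\<omega> \<in> space M. k < \<bar>R \<omega>\<bar>} < e" using prob_greater_small[OF R e] .
  show "\<exists>Z c B. vanishing M F Z \<and> 0 < c \<and> B \<in> sets M \<and> prob B < e \<and>
      (\<forall>i. AE \<omega> in M. \<omega> \<notin> B \<longrightarrow> \<bar>Z i \<omega>\<bar> < c \<longrightarrow> \<bar>R \<omega> * Y i \<omega>\<bar> < e)"
  proof (intro exI conjI allI)
    show "vanishing M F Y" "0 < e / k" "{\<omega> \<in> space M. k < \<bar>R \<omega>\<bar>} \<in> sets M"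
      "prob {\<omega> \<in> space M. k < \<bar>R \<omega>\<bar>} < e" using Y e k by auto
    fix i
    show "AE \<omega> in M. \<omega> \<notin> {\<omega> \<in> space M. k < \<bar>R \<omega>\<bar>} \<longrightarrow> \<bar>Y i \<omega>\<bar> < e / k \<longrightarrow> \<bar>R \<omega> * Y i \<omega>\<bar> < e"
      using AE_space
    proof eventually_elim
      case (elim \<omega>)
      show ?case
      proof (intro impI)
        assume "\<omega> \<notin> {\<omega> \<in> space M. k < \<bar>R \<omega>\<bar>}" and "\<bar>Y i \<omega>\<bar> < e / k"
        with elim have R: "\<bar>R \<omega>\<bar> \<le> k" and "k * \<bar>Y i \<omega>\<bar> < e" using k by (auto simp: field_simps)
        moreover have "\<bar>R \<omega>\<bar> * \<bar>Y i \<omega>\<bar> \<le> k * \<bar>Y i \<omega>\<bar>" using R by (intro mult_right_mono) auto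
        ultimately show "\<bar>R \<omega> * Y i \<omega>\<bar> < e" by (simp add: abs_mult)
      qed
    qed
  qed
qed

lemma vanishing_dominated:
  fixes X Y :: "'i \<Rightarrow> 'a \<Rightarrow> real"
  assumes X: "\<And>i. X i \<in> borel_measurable M" and Y: "vanishing M F Y"
    and le: "\<And>i. AE \<omega> in M. \<bar>X i \<omega>\<bar> \<le> C * \<bar>Y i \<omega>\<bar>"
  shows "vanishing M F X"
proof (rule vanishing_dominated_eps[OF X, where R = "\<lambda>_. 0"])
  have "vanishing M F (\<lambda>i \<omega>. C * Y i \<omega>)" by (rule vanishing_mult[OF Y]) simp
  moreover have "AE \<omega> in M. \<bar>X i \<omega>\<bar> \<le> \<bar>C * Y i \<omega>\<bar>" for i
    using le[of i]
  proof eventually_elim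
    case (elim \<omega>)
    have "C * \<bar>Y i \<omega>\<bar> \<le> \<bar>C\<bar> * \<bar>Y i \<omega>\<bar>" by (intro mult_right_mono) auto
    with elim show ?case by (simp add: abs_mult)
  qed
  ultimately show "\<exists>Y. vanishing M F Y \<and> (\<forall>i. AE \<omega> in M. \<bar>X i \<omega>\<bar> \<le> \<epsilon> * \<bar>0\<bar> + \<bar>Y i \<omega>\<bar>)" for \<epsilon> :: real
    by auto
qed simp

lemma vanishing_abs: "vanishing M F X \<Longrightarrow> vanishing M F (\<lambda>i \<omega>. \<bar>X i \<omega>\<bar>)"
  unfolding vanishing_def by (auto intro!: borel_measurable_abs)

lemma vanishing_add:
  assumes X: "vanishing M F X" and Y: "vanishing M F Y"
  shows "vanishing M F (\<lambda>i \<omega>. X i \<omega> + Y i \<omega>)"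
proof -
  have [measurable]: "X i \<in> borel_measurable M" "Y i \<in> borel_measurable M" for i
    using X Y by (simp_all add: vanishing_def)
  \<comment> \<open>For the maximum the exceptional events simply unite; the sum is at most twice
    the maximum.\<close>
  have max: "vanishing M F (\<lambda>i \<omega>. max \<bar>X i \<omega>\<bar> \<bar>Y i \<omega>\<bar>)"
    unfolding vanishing_def
  proof (intro conjI allI impI)
    fix e :: real assume e: "0 < e"
    show "\<forall>\<^sub>F i in F. prob {\<omega> \<in> space M. e \<le> \<bar>max \<bar>X i \<omega>\<bar> \<bar>Y i \<omega>\<bar>\<bar>} < e"
      using vanishing_prob_less[OF X e half_gt_zero[OF e]] vanishing_prob_less[OF Y e half_gt_zero[OF e]]
    proof eventually_elim
      case (elim i)
      have "prob {\<omega> \<in> space M. e \<le> \<bar>max \<bar>X i \<omega>\<bar> \<bar>Y i \<omega>\<bar>\<bar>}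
          \<le> prob ({\<omega> \<in> space M. e \<le> \<bar>X i \<omega>\<bar>} \<union> {\<omega> \<in> space M. e \<le> \<bar>Y i \<omega>\<bar>})"
        by (rule finite_measure_mono) (auto simp: max_def split: if_splits)
      also have "\<dots> \<le> prob {\<omega> \<in> space M. e \<le> \<bar>X i \<omega>\<bar>} + prob {\<omega> \<in> space M. e \<le> \<bar>Y i \<omega>\<bar>}"
        by (rule measure_Un_le) auto
      finally show ?case using elim by linarith
    qed
  qed measurable
  show ?thesis
    by (rule vanishing_dominated[OF _ max, where C = 2]) auto
qed

lemma vanishing_const:
  fixes X :: "'a \<Rightarrow> real"
  assumes X: "vanishing M F (\<lambda>i. X)" and F: "F \<noteq> bot"
  shows "AE \<omega> in M. X \<omega> = 0"
proof -
  have [measurable]: "X \<in> borel_measurable M" using X by (simp add: vanishing_def)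
  have zero: "AE \<omega> in M. \<bar>X \<omega>\<bar> < c" if c: "0 < c" for c
  proof -
    have "prob {\<omega> \<in> space M. c \<le> \<bar>X \<omega>\<bar>} < p" if "0 < p" for p
      using vanishing_prob_less[OF X c that] F by (simp add: eventually_const)
    then have "prob {\<omega> \<in> space M. c \<le> \<bar>X \<omega>\<bar>} = 0"
      by (metis less_irrefl measure_nonneg order_le_less)
    then show ?thesis by (subst (asm) prob_eq_0) (auto simp: not_le)
  qed
  have "AE \<omega> in M. \<forall>n::nat. \<bar>X \<omega>\<bar> < 1 / Suc n"
    unfolding AE_all_countable using zero by simp
  then show ?thesis
  proof eventually_elim
    case (elim \<omega>)
    show ?case
    proof (rule ccontr)
      assume "X \<omega> \<noteq> 0"
      then obtain n where "1 / Suc n < \<bar>X \<omega>\<bar>" by (metis nat_approx_posE zero_less_abs_iff)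
      with elim show False by (metis less_asym)
    qed
  qed
qed

lemma vanishing_AE_tendsto:
  fixes X :: "nat \<Rightarrow> 'a \<Rightarrow> real"
  assumes [measurable]: "\<And>n. X n \<in> borel_measurable M" and lim: "AE \<omega> in M. (\<lambda>n. X n \<omega>) \<longlonglongrightarrow> 0"
  shows "vanishing M sequentially X"
  unfolding vanishing_def
proof (intro conjI allI impI)
  fix e :: real assume e: "0 < e"
  have "(\<lambda>n. \<integral>\<omega>. indicator {\<omega> \<in> space M. e \<le> \<bar>X n \<omega>\<bar>} \<omega> \<partial>M) \<longlonglongrightarrow> (\<integral>\<omega>. (0::real) \<partial>M)"
  proof (rule integral_dominated_convergence[where w = "\<lambda>_. 1"])
    show "AE \<omega> in M. (\<lambda>n. indicator {\<omega> \<in> space M. e \<le> \<bar>X n \<omega>\<bar>} \<omega>) \<longlonglongrightarrow> (0::real)"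
      using lim
    proof eventually_elim
      case (elim \<omega>)
      then have "(\<lambda>n. \<bar>X n \<omega>\<bar>) \<longlonglongrightarrow> 0" by (simp add: tendsto_rabs_zero)
      then have "\<forall>\<^sub>F n in sequentially. \<bar>X n \<omega>\<bar> < e" using e by (rule order_tendstoD)
      then have "\<forall>\<^sub>F n in sequentially. indicator {\<omega> \<in> space M. e \<le> \<bar>X n \<omega>\<bar>} \<omega> = (0::real)"
        by eventually_elim auto
      then show ?case by (rule tendsto_eventually)
    qed
  qed auto
  then have "(\<lambda>n. prob {\<omega> \<in> space M. e \<le> \<bar>X n \<omega>\<bar>}) \<longlonglongrightarrow> 0" by simp
  then show "\<forall>\<^sub>F n in sequentially. prob {\<omega> \<in> space M. e \<le> \<bar>X n \<omega>\<bar>} < e"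
    using e by (rule order_tendstoD)
qed simp

lemma vanishing_prob_gt:
  assumes X: "vanishing M F X" and e: "0 < e" and l: "0 < l"
  shows "\<forall>\<^sub>F i in F. prob {\<omega> \<in> space M. X i \<omega> < e} > 1 - l"
proof -
  have [measurable]: "X i \<in> borel_measurable M" for i using X by (simp add: vanishing_def)
  from vanishing_prob_less[OF X e l] show ?thesis
  proof eventually_elim
    case (elim i)
    have "prob {\<omega> \<in> space M. e \<le> \<bar>X i \<omega>\<bar>} = 1 - prob {\<omega> \<in> space M. \<bar>X i \<omega>\<bar> < e}"
      by (subst prob_compl[symmetric]) (auto intro!: arg_cong[where f = prob])
    moreover have "prob {\<omega> \<in> space M. \<bar>X i \<omega>\<bar> < e} \<le> prob {\<omega> \<in> space M. X i \<omega> < e}"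
      by (rule finite_measure_mono) auto
    ultimately show ?case using elim by simp
  qed
qed

end

text \<open>The filter of the iterated limit: first the second index tends to infinity, then the first.\<close>

definition iterated :: "(nat \<times> nat) filter" where
  "iterated = Abs_filter (\<lambda>P. \<forall>\<^sub>F m in sequentially. \<forall>\<^sub>F n in sequentially. P (m, n))"

lemma eventually_iterated:
  "eventually P iterated \<longleftrightarrow> (\<forall>\<^sub>F m in sequentially. \<forall>\<^sub>F n in sequentially. P (m, n))"
  unfolding iterated_def
proof (rule eventually_Abs_filter, rule is_filter.intro)
  fix P Q :: "nat \<times> nat \<Rightarrow> bool"
  assume "\<forall>\<^sub>F m in sequentially. \<forall>\<^sub>F n in sequentially. P (m, n)"
    "\<forall>\<^sub>F m in sequentially. \<forall>\<^sub>F n in sequentially. Q (m, n)"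
  then show "\<forall>\<^sub>F m in sequentially. \<forall>\<^sub>F n in sequentially. P (m, n) \<and> Q (m, n)"
    by eventually_elim (rule eventually_conj)
next
  fix P Q :: "nat \<times> nat \<Rightarrow> bool"
  assume PQ: "\<forall>x. P x \<longrightarrow> Q x" and "\<forall>\<^sub>F m in sequentially. \<forall>\<^sub>F n in sequentially. P (m, n)"
  from this(2) show "\<forall>\<^sub>F m in sequentially. \<forall>\<^sub>F n in sequentially. Q (m, n)"
    by eventually_elim (erule eventually_mono, use PQ in auto)
qed simp

lemma filterlim_snd_iterated: "filterlim snd sequentially iterated"
  unfolding filterlim_iff eventually_iterated by simp

lemma filterlim_fst_iterated: "filterlim fst sequentially iterated"
  unfolding filterlim_iff eventually_iterated by (auto elim: eventually_mono)

text \<open>Only the inner index moves, so for each fixed \<open>m\<close> this is ordinary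
  composition. It lets a sequence be averaged with a reindexed copy of itself.\<close>

lemma filterlim_iterated_reindex:
  assumes "filterlim j sequentially sequentially"
  shows "filterlim (\<lambda>(m, n). (m, j n)) iterated iterated"
  unfolding filterlim_iff eventually_iterated
proof (intro allI impI)
  fix P :: "nat \<times> nat \<Rightarrow> bool"
  assume "\<forall>\<^sub>F m in sequentially. \<forall>\<^sub>F n in sequentially. P (m, n)"
  then show "\<forall>\<^sub>F m in sequentially. \<forall>\<^sub>F n in sequentially. P (case (m, n) of (m, n) \<Rightarrow> (m, j n))"
  proof eventually_elim
    case (elim m)
    then have "\<forall>\<^sub>F n in sequentially. P (m, j n)"
      using assms unfolding filterlim_iff by (auto dest!: spec[of _ "\<lambda>n. P (m, n)"])
    then show ?case by simp
  qed
qed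

lemma iterated_neq_bot: "iterated \<noteq> bot"
  by (simp add: trivial_limit_def eventually_iterated)

lemma (in prob_space) vanishing_iteratedI:
  assumes X: "\<And>m. vanishing M sequentially (\<lambda>n. X (m, n))"
  shows "vanishing M iterated X"
proof -
  have "X p \<in> borel_measurable M" for p
    using X[of "fst p"] unfolding vanishing_def by (metis surjective_pairing)
  then show ?thesis using X by (auto simp: vanishing_def eventually_iterated)
qed

section \<open>Pointwise calculus in a random normed module\<close>

lemma rvars_iff: "f \<in> rvars M K \<longleftrightarrow> f \<in> borel_measurable M \<and> (\<forall>\<omega>\<in>space M. f \<omega> \<in> K)"
  by (auto simp: rvars_def measurable_restrict_space2_iff)

lemma carrier_L0 [simp]: "carrier (L0 M K) = L0_set M K"
  by (simp add: L0_def)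

lemma rep_measurable: "\<xi> \<in> L0_set M K \<Longrightarrow> rep \<xi> \<in> borel_measurable M"
  using rep_in(2)[of \<xi> M K] by (simp add: rvars_iff)

lemma L0_eqI:
  assumes "\<xi> \<in> L0_set M K" "\<eta> \<in> L0_set M K" "AE \<omega> in M. rep \<xi> \<omega> = rep \<eta> \<omega>"
  shows "\<xi> = \<eta>"
  using L0_cls_eqI[OF rep_in(2)[OF assms(1)] rep_in(2)[OF assms(2)] assms(3)] assms(1,2)
  by (simp add: L0_cls_rep)

locale random_normed_module = prob_space M + RN_module M K E N
  for M :: "'w measure" and K :: "complex set"
    and E :: "(('w \<Rightarrow> complex) set, 'e) module" and N :: "'e \<Rightarrow> ('w \<Rightarrow> real) set" +
  assumes scalars: "K = \<real> \<or> K = UNIV"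
begin

abbreviation nm :: "'e \<Rightarrow> 'w \<Rightarrow> real" where "nm x \<equiv> rep (N x)"

text \<open>Takes a real function instead of a class in the scalar ring. Real scalars suffice except
  for the imaginary part of a functional, so both scalar fields are treated together.\<close>

definition smul :: "('w \<Rightarrow> real) \<Rightarrow> 'e \<Rightarrow> 'e" where
  "smul a x = L0_cls M K (\<lambda>\<omega>. complex_of_real (a \<omega>)) \<odot>\<^bsub>E\<^esub> x"

lemma K_closed:
  "0 \<in> K" "1 \<in> K" "complex_of_real r \<in> K" "a \<in> K \<Longrightarrow> b \<in> K \<Longrightarrow> a + b \<in> K"
  "a \<in> K \<Longrightarrow> b \<in> K \<Longrightarrow> a * b \<in> K" "a \<in> K \<Longrightarrow> - a \<in> K"
  using scalars by auto

lemma rvars_of_real: "a \<in> borel_measurable M \<Longrightarrow> (\<lambda>\<omega>. complex_of_real (a \<omega>)) \<in> rvars M K"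
  by (simp add: rvars_iff K_closed)

lemma rep_add_AE:
  assumes "\<xi> \<in> L0_set M K" "\<eta> \<in> L0_set M K"
  shows "AE \<omega> in M. rep (\<xi> \<oplus>\<^bsub>L0 M K\<^esub> \<eta>) \<omega> = rep \<xi> \<omega> + rep \<eta> \<omega>"
  unfolding L0_def ring.simps
  by (rule rep_L0_cls) (use rep_in(2)[OF assms(1)] rep_in(2)[OF assms(2)] K_closed in \<open>auto simp: rvars_iff\<close>)

lemma rep_mult_AE:
  assumes "\<xi> \<in> L0_set M K" "\<eta> \<in> L0_set M K"
  shows "AE \<omega> in M. rep (\<xi> \<otimes>\<^bsub>L0 M K\<^esub> \<eta>) \<omega> = rep \<xi> \<omega> * rep \<eta> \<omega>"
  unfolding L0_def monoid.simps
  by (rule rep_L0_cls) (use rep_in(2)[OF assms(1)] rep_in(2)[OF assms(2)] K_closed in \<open>auto simp: rvars_iff\<close>)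

lemma rep_real_add_AE:
  assumes "\<xi> \<in> L0_set M UNIV" "\<eta> \<in> L0_set M UNIV"
  shows "AE \<omega> in M. rep (\<xi> \<oplus>\<^bsub>L0_real M\<^esub> \<eta>) \<omega> = rep \<xi> \<omega> + rep \<eta> \<omega>"
  unfolding L0_def ring.simps
  by (rule rep_L0_cls) (use rep_in(2)[OF assms(1)] rep_in(2)[OF assms(2)] in \<open>auto simp: rvars_iff\<close>)

lemma rep_real_mult_AE:
  assumes "\<xi> \<in> L0_set M UNIV" "\<eta> \<in> L0_set M UNIV"
  shows "AE \<omega> in M. rep (\<xi> \<otimes>\<^bsub>L0_real M\<^esub> \<eta>) \<omega> = rep \<xi> \<omega> * rep \<eta> \<omega>"
  unfolding L0_def monoid.simps
  by (rule rep_L0_cls) (use rep_in(2)[OF assms(1)] rep_in(2)[OF assms(2)] in \<open>auto simp: rvars_iff\<close>)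

lemma rep_abs_AE:
  fixes \<xi> :: "('w \<Rightarrow> complex) set"
  assumes "\<xi> \<in> L0_set M K"
  shows "L0_abs M \<xi> \<in> L0_set M UNIV" "AE \<omega> in M. rep (L0_abs M \<xi>) \<omega> = norm (rep \<xi> \<omega>)"
proof -
  have "(\<lambda>\<omega>. norm (rep \<xi> \<omega>)) \<in> rvars M UNIV"
    using rep_measurable[OF assms] by (simp add: rvars_iff)
  then show "L0_abs M \<xi> \<in> L0_set M UNIV" "AE \<omega> in M. rep (L0_abs M \<xi>) \<omega> = norm (rep \<xi> \<omega>)"
    unfolding L0_abs_def by (auto intro: rep_L0_cls)
qed

lemma cls_add:
  assumes "a \<in> rvars M K" "b \<in> rvars M K"
  shows "L0_cls M K a \<oplus>\<^bsub>L0 M K\<^esub> L0_cls M K b = L0_cls M K (\<lambda>\<omega>. a \<omega> + b \<omega>)"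
proof (rule L0_eqI)
  have s: "(\<lambda>\<omega>. a \<omega> + b \<omega>) \<in> rvars M K" using assms K_closed by (auto simp: rvars_iff)
  note c = L0_cls_in[OF assms(1)] L0_cls_in[OF assms(2)]
  show "L0_cls M K a \<oplus>\<^bsub>L0 M K\<^esub> L0_cls M K b \<in> L0_set M K" using c R.a_closed by simp
  show "L0_cls M K (\<lambda>\<omega>. a \<omega> + b \<omega>) \<in> L0_set M K" using s by blast
  show "AE \<omega> in M. rep (L0_cls M K a \<oplus>\<^bsub>L0 M K\<^esub> L0_cls M K b) \<omega> = rep (L0_cls M K (\<lambda>\<omega>. a \<omega> + b \<omega>)) \<omega>"
    using rep_add_AE[OF c] rep_L0_cls[OF s] rep_L0_cls[OF assms(1)] rep_L0_cls[OF assms(2)]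
    by eventually_elim simp
qed

lemma cls_mult:
  assumes "a \<in> rvars M K" "b \<in> rvars M K"
  shows "L0_cls M K a \<otimes>\<^bsub>L0 M K\<^esub> L0_cls M K b = L0_cls M K (\<lambda>\<omega>. a \<omega> * b \<omega>)"
proof (rule L0_eqI)
  have s: "(\<lambda>\<omega>. a \<omega> * b \<omega>) \<in> rvars M K" using assms K_closed by (auto simp: rvars_iff)
  note c = L0_cls_in[OF assms(1)] L0_cls_in[OF assms(2)]
  show "L0_cls M K a \<otimes>\<^bsub>L0 M K\<^esub> L0_cls M K b \<in> L0_set M K" using c R.m_closed by simp
  show "L0_cls M K (\<lambda>\<omega>. a \<omega> * b \<omega>) \<in> L0_set M K" using s by blast
  show "AE \<omega> in M. rep (L0_cls M K a \<otimes>\<^bsub>L0 M K\<^esub> L0_cls M K b) \<omega> = rep (L0_cls M K (\<lambda>\<omega>. a \<omega> * b \<omega>)) \<omega>"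
    using rep_mult_AE[OF c] rep_L0_cls[OF s] rep_L0_cls[OF assms(1)] rep_L0_cls[OF assms(2)]
    by eventually_elim simp
qed

lemma cls_one: "L0_cls M K (\<lambda>_. 1) = \<one>\<^bsub>L0 M K\<^esub>"
  by (simp add: L0_def)

lemma N_in: "x \<in> carrier E \<Longrightarrow> N x \<in> L0_set M UNIV"
  using norm_closed[of x] by (simp add: L0_plus_def)

lemma nm_measurable [measurable]: "x \<in> carrier E \<Longrightarrow> nm x \<in> borel_measurable M"
  by (rule rep_measurable) (rule N_in)

lemma nm_nonneg: "x \<in> carrier E \<Longrightarrow> AE \<omega> in M. 0 \<le> nm x \<omega>"
  using norm_closed[of x] by (simp add: L0_plus_def)

lemma nm_add:
  assumes "x \<in> carrier E" "y \<in> carrier E"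
  shows "AE \<omega> in M. nm (x \<oplus>\<^bsub>E\<^esub> y) \<omega> \<le> nm x \<omega> + nm y \<omega>"
  using norm_triangle[OF assms] rep_real_add_AE[OF N_in N_in, OF assms] unfolding L0_le_def
  by eventually_elim simp

lemma nm_cls_smult:
  assumes a: "a \<in> rvars M K" and x: "x \<in> carrier E"
  shows "AE \<omega> in M. nm (L0_cls M K a \<odot>\<^bsub>E\<^esub> x) \<omega> = norm (a \<omega>) * nm x \<omega>"
  using rep_real_mult_AE[OF rep_abs_AE(1)[OF L0_cls_in[OF a]] N_in[OF x]]
    rep_abs_AE(2)[OF L0_cls_in[OF a]] rep_L0_cls[OF a]
  unfolding norm_smult[OF L0_cls_in[OF a, folded carrier_L0] x] by eventually_elim simp

lemma smul_closed [simp, intro]: "a \<in> borel_measurable M \<Longrightarrow> x \<in> carrier E \<Longrightarrow> smul a x \<in> carrier E"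
  unfolding smul_def by (intro smult_closed) (simp_all add: L0_cls_in rvars_of_real)

lemma nm_smul:
  "a \<in> borel_measurable M \<Longrightarrow> x \<in> carrier E \<Longrightarrow> AE \<omega> in M. nm (smul a x) \<omega> = \<bar>a \<omega>\<bar> * nm x \<omega>"
  unfolding smul_def using nm_cls_smult[OF rvars_of_real] by simp

lemma smul_add_left:
  "a \<in> borel_measurable M \<Longrightarrow> b \<in> borel_measurable M \<Longrightarrow> x \<in> carrier E \<Longrightarrow>
    smul (\<lambda>\<omega>. a \<omega> + b \<omega>) x = smul a x \<oplus>\<^bsub>E\<^esub> smul b x"
  unfolding smul_def
  by (simp add: smult_l_distr[symmetric] cls_add[symmetric] rvars_of_real L0_cls_in)

lemma smul_mult:
  "a \<in> borel_measurable M \<Longrightarrow> b \<in> borel_measurable M \<Longrightarrow> x \<in> carrier E \<Longrightarrow>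
    smul (\<lambda>\<omega>. a \<omega> * b \<omega>) x = smul a (smul b x)"
  unfolding smul_def
  by (simp add: smult_assoc1[symmetric] cls_mult[symmetric] rvars_of_real L0_cls_in)

lemma smul_add:
  "a \<in> borel_measurable M \<Longrightarrow> x \<in> carrier E \<Longrightarrow> y \<in> carrier E \<Longrightarrow>
    smul a (x \<oplus>\<^bsub>E\<^esub> y) = smul a x \<oplus>\<^bsub>E\<^esub> smul a y"
  unfolding smul_def by (simp add: smult_r_distr rvars_of_real L0_cls_in)

lemma smul_uminus:
  "a \<in> borel_measurable M \<Longrightarrow> x \<in> carrier E \<Longrightarrow> smul a (\<ominus>\<^bsub>E\<^esub> x) = \<ominus>\<^bsub>E\<^esub> smul a x"
  unfolding smul_def by (simp add: smult_r_minus rvars_of_real L0_cls_in)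

lemma smul_minus:
  "a \<in> borel_measurable M \<Longrightarrow> x \<in> carrier E \<Longrightarrow> y \<in> carrier E \<Longrightarrow>
    smul a (x \<ominus>\<^bsub>E\<^esub> y) = smul a x \<ominus>\<^bsub>E\<^esub> smul a y"
  by (simp add: a_minus_def smul_add smul_uminus)

lemma smul_one: "x \<in> carrier E \<Longrightarrow> smul (\<lambda>_. 1) x = x"
  by (simp add: smul_def cls_one)

lemma smul_zero: "x \<in> carrier E \<Longrightarrow> smul (\<lambda>_. 0) x = \<zero>\<^bsub>E\<^esub>"
  using smul_add_left[of "\<lambda>_. 0" "\<lambda>_. 0" x] by (simp add: M.add.l_cancel_one')

lemma smul_const_minus: "x \<in> carrier E \<Longrightarrow> smul (\<lambda>_. - 1) x = \<ominus>\<^bsub>E\<^esub> x"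
  using smul_add_left[of "\<lambda>_. - 1" "\<lambda>_. 1" x]
  by (simp add: smul_one smul_zero M.minus_equality)

lemma nm_zero: "AE \<omega> in M. nm \<zero>\<^bsub>E\<^esub> \<omega> = 0"
  using nm_smul[of "\<lambda>_. 0" "\<zero>\<^bsub>E\<^esub>"] smul_zero[of "\<zero>\<^bsub>E\<^esub>"] by simp

lemma nm_uminus: "x \<in> carrier E \<Longrightarrow> AE \<omega> in M. nm (\<ominus>\<^bsub>E\<^esub> x) \<omega> = nm x \<omega>"
  using nm_smul[of "\<lambda>_. - 1" x] smul_const_minus[of x] by simp

lemma nm_eq_zero:
  assumes x: "x \<in> carrier E" and z: "AE \<omega> in M. nm x \<omega> = 0"
  shows "x = \<zero>\<^bsub>E\<^esub>"
proof (rule norm_zero[OF x], rule L0_eqI[OF N_in[OF x]])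
  have c: "(\<lambda>_. 0 :: real) \<in> rvars M UNIV" by (simp add: rvars_iff)
  have e: "\<zero>\<^bsub>L0_real M\<^esub> = L0_cls M UNIV (\<lambda>_. 0)" by (simp add: L0_def)
  show "\<zero>\<^bsub>L0_real M\<^esub> \<in> L0_set M UNIV" unfolding e using c by blast
  show "AE \<omega> in M. nm x \<omega> = rep \<zero>\<^bsub>L0_real M\<^esub> \<omega>"
    unfolding e using rep_L0_cls[OF c] z by eventually_elim simp
qed

section \<open>Random distance and midpoints\<close>

definition dst :: "'e \<Rightarrow> 'e \<Rightarrow> 'w \<Rightarrow> real" where "dst x y = nm (x \<ominus>\<^bsub>E\<^esub> y)"

lemma dst_measurable [measurable]: "x \<in> carrier E \<Longrightarrow> y \<in> carrier E \<Longrightarrow> dst x y \<in> borel_measurable M"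
  unfolding dst_def by measurable

lemma dst_nonneg: "x \<in> carrier E \<Longrightarrow> y \<in> carrier E \<Longrightarrow> AE \<omega> in M. 0 \<le> dst x y \<omega>"
  unfolding dst_def by (rule nm_nonneg) simp

lemma dst_self: "x \<in> carrier E \<Longrightarrow> AE \<omega> in M. dst x x \<omega> = 0"
  unfolding dst_def using nm_zero by (simp add: M.r_neg a_minus_def)

lemma minus_swap: "x \<in> carrier E \<Longrightarrow> y \<in> carrier E \<Longrightarrow> \<ominus>\<^bsub>E\<^esub> (x \<ominus>\<^bsub>E\<^esub> y) = y \<ominus>\<^bsub>E\<^esub> x"
  by (simp add: a_minus_def M.minus_add M.a_comm)

lemma minus_split:
  "x \<in> carrier E \<Longrightarrow> y \<in> carrier E \<Longrightarrow> z \<in> carrier E \<Longrightarrow> (x \<ominus>\<^bsub>E\<^esub> y) \<oplus>\<^bsub>E\<^esub> (y \<ominus>\<^bsub>E\<^esub> z) = x \<ominus>\<^bsub>E\<^esub> z"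
  by (simp add: a_minus_def M.a_assoc M.r_neg1 M.r_neg2)

lemma dst_commute: "x \<in> carrier E \<Longrightarrow> y \<in> carrier E \<Longrightarrow> AE \<omega> in M. dst x y \<omega> = dst y x \<omega>"
  unfolding dst_def using nm_uminus[of "x \<ominus>\<^bsub>E\<^esub> y"]
  by (simp add: minus_swap, elim eventually_mono, simp)

lemma dst_triangle:
  "x \<in> carrier E \<Longrightarrow> y \<in> carrier E \<Longrightarrow> z \<in> carrier E \<Longrightarrow> AE \<omega> in M. dst x z \<omega> \<le> dst x y \<omega> + dst y z \<omega>"
  unfolding dst_def using nm_add[of "x \<ominus>\<^bsub>E\<^esub> y" "y \<ominus>\<^bsub>E\<^esub> z"] by (simp add: minus_split)

lemma dst_eq_zero:
  assumes "x \<in> carrier E" "y \<in> carrier E" "AE \<omega> in M. dst x y \<omega> = 0"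
  shows "x = y"
proof -
  have "x \<ominus>\<^bsub>E\<^esub> y = \<zero>\<^bsub>E\<^esub>"
    using assms by (intro nm_eq_zero) (auto simp: dst_def)
  then show ?thesis using assms by (simp add: a_minus_def M.minus_equality M.add.inv_solve_right' M.add.inv_equality)
qed

definition mid :: "'e \<Rightarrow> 'e \<Rightarrow> 'e" where
  "mid x y = smul (\<lambda>_. 1/2) x \<oplus>\<^bsub>E\<^esub> smul (\<lambda>_. 1/2) y"

lemma mid_closed [simp, intro]: "x \<in> carrier E \<Longrightarrow> y \<in> carrier E \<Longrightarrow> mid x y \<in> carrier E"
  by (simp add: mid_def)

lemma smul_halves:
  "x \<in> carrier E \<Longrightarrow> smul (\<lambda>_. 1/2) x \<oplus>\<^bsub>E\<^esub> smul (\<lambda>_. 1/2) x = x"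
  using smul_add_left[of "\<lambda>_. 1/2" "\<lambda>_. 1/2" x] by (simp add: smul_one)

lemma add_minus_add:
  assumes "a \<in> carrier E" "b \<in> carrier E" "c \<in> carrier E" "d \<in> carrier E"
  shows "(a \<oplus>\<^bsub>E\<^esub> b) \<ominus>\<^bsub>E\<^esub> (c \<oplus>\<^bsub>E\<^esub> d) = (a \<ominus>\<^bsub>E\<^esub> c) \<oplus>\<^bsub>E\<^esub> (b \<ominus>\<^bsub>E\<^esub> d)"
  using assms by (simp add: a_minus_def M.minus_add M.a_ac)

lemma mid_minus:
  assumes "x \<in> carrier E" "y \<in> carrier E" "z \<in> carrier E"
  shows "mid x y \<ominus>\<^bsub>E\<^esub> z = smul (\<lambda>_. 1/2) ((x \<ominus>\<^bsub>E\<^esub> z) \<oplus>\<^bsub>E\<^esub> (y \<ominus>\<^bsub>E\<^esub> z))"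
proof -
  have "mid x y \<ominus>\<^bsub>E\<^esub> z = mid x y \<ominus>\<^bsub>E\<^esub> (smul (\<lambda>_. 1/2) z \<oplus>\<^bsub>E\<^esub> smul (\<lambda>_. 1/2) z)"
    using assms by (simp add: smul_halves)
  also have "\<dots> = (smul (\<lambda>_. 1/2) x \<ominus>\<^bsub>E\<^esub> smul (\<lambda>_. 1/2) z) \<oplus>\<^bsub>E\<^esub> (smul (\<lambda>_. 1/2) y \<ominus>\<^bsub>E\<^esub> smul (\<lambda>_. 1/2) z)"
    unfolding mid_def using assms by (intro add_minus_add) auto
  finally show ?thesis using assms by (simp add: smul_minus smul_add)
qed

lemma dst_mid:
  assumes "x \<in> carrier E" "y \<in> carrier E" "z \<in> carrier E"
  shows "AE \<omega> in M. 2 * dst (mid x y) z \<omega> = nm ((x \<ominus>\<^bsub>E\<^esub> z) \<oplus>\<^bsub>E\<^esub> (y \<ominus>\<^bsub>E\<^esub> z)) \<omega>"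
  unfolding dst_def mid_minus[OF assms]
  using nm_smul[of "\<lambda>_. 1/2" "(x \<ominus>\<^bsub>E\<^esub> z) \<oplus>\<^bsub>E\<^esub> (y \<ominus>\<^bsub>E\<^esub> z)"] assms by (simp add: mult.commute)

lemma dst_mid_le:
  assumes "x \<in> carrier E" "y \<in> carrier E" "z \<in> carrier E"
  shows "AE \<omega> in M. dst (mid x y) z \<omega> \<le> (dst x z \<omega> + dst y z \<omega>) / 2"
  using dst_mid[OF assms] nm_add[OF M.minus_closed M.minus_closed, OF assms(1,3,2,3)]
  unfolding dst_def by eventually_elim simp

lemma dst_mid_left:
  assumes "x \<in> carrier E" "y \<in> carrier E"
  shows "AE \<omega> in M. dst (mid x y) x \<omega> = dst x y \<omega> / 2" "AE \<omega> in M. dst (mid x y) y \<omega> = dst x y \<omega> / 2"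
proof -
  have x: "AE \<omega> in M. 2 * dst (mid x y) x \<omega> = dst y x \<omega>"
    using dst_mid[of x y x] assms by (simp add: dst_def a_minus_def M.r_neg)
  show "AE \<omega> in M. dst (mid x y) x \<omega> = dst x y \<omega> / 2"
    using x dst_commute[OF assms] by eventually_elim simp
  have y: "AE \<omega> in M. 2 * dst (mid x y) y \<omega> = dst x y \<omega>"
    using dst_mid[of x y y] assms by (simp add: dst_def a_minus_def M.r_neg)
  show "AE \<omega> in M. dst (mid x y) y \<omega> = dst x y \<omega> / 2"
    using y by eventually_elim simp
qed

lemma L0_convex_mid:
  assumes G: "L0_convex M K E G" and x: "x \<in> G" and y: "y \<in> G"
  shows "mid x y \<in> G"
proof -
  define h where "h = L0_cls M (UNIV :: real set) (\<lambda>_. 1/2)"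
  have c: "(\<lambda>_. 1/2 :: real) \<in> rvars M UNIV" by (simp add: rvars_iff)
  have h: "h \<in> L0_set M UNIV" unfolding h_def using c by blast
  have rep: "AE \<omega> in M. rep h \<omega> = 1/2" unfolding h_def by (rule rep_L0_cls[OF c])
  have plus: "h \<in> L0_plus M" unfolding L0_plus_def using h rep by auto
  have "\<one>\<^bsub>L0_real M\<^esub> = L0_cls M UNIV (\<lambda>_. 1)" by (simp add: L0_def)
  moreover have "h \<oplus>\<^bsub>L0_real M\<^esub> h = L0_cls M UNIV (\<lambda>\<omega>. rep h \<omega> + rep h \<omega>)" by (simp add: L0_def)
  moreover have "L0_cls M UNIV (\<lambda>\<omega>. rep h \<omega> + rep h \<omega>) = L0_cls M UNIV (\<lambda>_. 1)"
    using rep_measurable[OF h] rep by (intro L0_cls_eqI) (auto simp: rvars_iff)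
  ultimately have sum: "h \<oplus>\<^bsub>L0_real M\<^esub> h = \<one>\<^bsub>L0_real M\<^esub>" by simp
  have "AE \<omega> in M. complex_of_real (rep h \<omega>) = complex_of_real (1/2)"
    using rep by eventually_elim (simp only:)
  then have "L0_scal M K h = L0_cls M K (\<lambda>\<omega>. complex_of_real (1/2))"
    unfolding L0_scal_def using rep_measurable[OF h]
    by (intro L0_cls_eqI rvars_of_real) auto
  with G x y plus sum show ?thesis
    unfolding L0_convex_def mid_def smul_def by force
qed

end

section \<open>Random Hahn-Banach theorem\<close>

context random_normed_module
begin

text \<open>Sublinear maps dominated by the norm. Requiring only one inequality in the homogeneity condition
  makes the class stable under the infima below; additivity restores equality.\<close>

definition sublinear :: "('e \<Rightarrow> 'w \<Rightarrow> real) \<Rightarrow> bool" where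
  "sublinear q \<longleftrightarrow> (\<forall>x\<in>carrier E. q x \<in> borel_measurable M) \<and>
     (\<forall>x\<in>carrier E. \<forall>y\<in>carrier E. AE \<omega> in M. q (x \<oplus>\<^bsub>E\<^esub> y) \<omega> \<le> q x \<omega> + q y \<omega>) \<and>
     (\<forall>a\<in>borel_measurable M. (\<forall>\<omega>. 0 \<le> a \<omega>) \<longrightarrow>
        (\<forall>x\<in>carrier E. AE \<omega> in M. q (smul a x) \<omega> \<le> a \<omega> * q x \<omega>)) \<and>
     (\<forall>x\<in>carrier E. AE \<omega> in M. q x \<omega> \<le> nm x \<omega>)"

text \<open>Models the real parts of module homomorphisms dominated by the norm: linear over the
  real random variables only, with all identities almost sure.\<close>

definition dual_real :: "('e \<Rightarrow> 'w \<Rightarrow> real) \<Rightarrow> bool" where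
  "dual_real q \<longleftrightarrow> (\<forall>x\<in>carrier E. q x \<in> borel_measurable M) \<and>
     (\<forall>x\<in>carrier E. \<forall>y\<in>carrier E. AE \<omega> in M. q (x \<oplus>\<^bsub>E\<^esub> y) \<omega> = q x \<omega> + q y \<omega>) \<and>
     (\<forall>a\<in>borel_measurable M. \<forall>x\<in>carrier E. AE \<omega> in M. q (smul a x) \<omega> = a \<omega> * q x \<omega>) \<and>
     (\<forall>x\<in>carrier E. AE \<omega> in M. \<bar>q x \<omega>\<bar> \<le> nm x \<omega>)"

lemma sublinearD:
  assumes "sublinear q"
  shows "x \<in> carrier E \<Longrightarrow> q x \<in> borel_measurable M"
    and "x \<in> carrier E \<Longrightarrow> y \<in> carrier E \<Longrightarrow> AE \<omega> in M. q (x \<oplus>\<^bsub>E\<^esub> y) \<omega> \<le> q x \<omega> + q y \<omega>"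
    and "a \<in> borel_measurable M \<Longrightarrow> (\<And>\<omega>. 0 \<le> a \<omega>) \<Longrightarrow> x \<in> carrier E \<Longrightarrow>
      AE \<omega> in M. q (smul a x) \<omega> \<le> a \<omega> * q x \<omega>"
    and "x \<in> carrier E \<Longrightarrow> AE \<omega> in M. q x \<omega> \<le> nm x \<omega>"
  using assms unfolding sublinear_def by blast+

lemma dual_realD:
  assumes "dual_real q"
  shows "x \<in> carrier E \<Longrightarrow> q x \<in> borel_measurable M"
    and "x \<in> carrier E \<Longrightarrow> y \<in> carrier E \<Longrightarrow> AE \<omega> in M. q (x \<oplus>\<^bsub>E\<^esub> y) \<omega> = q x \<omega> + q y \<omega>"
    and "a \<in> borel_measurable M \<Longrightarrow> x \<in> carrier E \<Longrightarrow> AE \<omega> in M. q (smul a x) \<omega> = a \<omega> * q x \<omega>"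
    and "x \<in> carrier E \<Longrightarrow> AE \<omega> in M. \<bar>q x \<omega>\<bar> \<le> nm x \<omega>"
  using assms unfolding dual_real_def by blast+

lemma sublinear_nm: "sublinear nm"
  unfolding sublinear_def
proof (intro conjI ballI impI)
  fix a x assume a: "a \<in> borel_measurable M" "\<forall>\<omega>. 0 \<le> (a \<omega> :: real)" and x: "x \<in> carrier E"
  show "AE \<omega> in M. nm (smul a x) \<omega> \<le> a \<omega> * nm x \<omega>"
    using nm_smul[OF a(1) x] by eventually_elim (use a(2) in auto)
qed (auto intro: nm_add)

lemma sublinear_zero_nonneg:
  assumes q: "sublinear q"
  shows "AE \<omega> in M. 0 \<le> q \<zero>\<^bsub>E\<^esub> \<omega>"
  using sublinearD(2)[OF q, of "\<zero>\<^bsub>E\<^esub>" "\<zero>\<^bsub>E\<^esub>"] by simp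

text \<open>From 0 \<le> q 0 \<le> q x + q (- x). The bound does not depend on \<open>q\<close>, and
  this is what makes essential infima over families of sublinear maps exist.\<close>

lemma sublinear_lower:
  assumes q: "sublinear q" and x: "x \<in> carrier E"
  shows "AE \<omega> in M. - nm x \<omega> \<le> q x \<omega>"
  using sublinear_zero_nonneg[OF q] sublinearD(2)[OF q x M.a_inv_closed[OF x], unfolded M.r_neg[OF x]]
    sublinearD(4)[OF q M.a_inv_closed[OF x]] nm_uminus[OF x]
  by eventually_elim simp

text \<open>The missing direction of homogeneity. Inverting \<open>a\<close> fails where it
  vanishes, so a + 1 is inverted instead: (a + 1) q x \<le> q (a x + x) \<le> q (a x) + q x.\<close>

lemma sublinear_smul_ge:
  assumes q: "sublinear q" and x: "x \<in> carrier E"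
    and a[measurable]: "a \<in> borel_measurable M" and nonneg: "\<And>\<omega>. 0 \<le> a \<omega>"
  shows "AE \<omega> in M. a \<omega> * q x \<omega> \<le> q (smul a x) \<omega>"
proof -
  define b where "b \<omega> = a \<omega> + 1" for \<omega>
  have b[measurable]: "b \<in> borel_measurable M" unfolding b_def by measurable
  have pos: "0 < b \<omega>" for \<omega> using nonneg[of \<omega>] by (simp add: b_def)
  have "smul (\<lambda>\<omega>. inverse (b \<omega>)) (smul b x) = smul (\<lambda>\<omega>. inverse (b \<omega>) * b \<omega>) x"
    by (rule smul_mult[symmetric]) (use x in measurable)
  also have "\<dots> = x"
    using pos x by (simp add: less_imp_neq[THEN not_sym] smul_one)
  finally have inv: "smul (\<lambda>\<omega>. inverse (b \<omega>)) (smul b x) = x" .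
  have sum: "smul b x = smul a x \<oplus>\<^bsub>E\<^esub> x"
    using smul_add_left[of a "\<lambda>_. 1" x] x by (simp add: b_def[abs_def] smul_one)
  have "AE \<omega> in M. q (smul (\<lambda>\<omega>. inverse (b \<omega>)) (smul b x)) \<omega> \<le> inverse (b \<omega>) * q (smul b x) \<omega>"
    using pos x by (intro sublinearD(3)[OF q]) (auto simp: less_imp_le)
  moreover have "AE \<omega> in M. q (smul b x) \<omega> \<le> q (smul a x) \<omega> + q x \<omega>"
    unfolding sum by (rule sublinearD(2)[OF q]) (use x in auto)
  ultimately show ?thesis
    unfolding inv
  proof eventually_elim
    case (elim \<omega>)
    have "b \<omega> * q x \<omega> \<le> b \<omega> * (inverse (b \<omega>) * q (smul b x) \<omega>)"
      using elim(1) pos[of \<omega>] by (intro mult_left_mono) auto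
    also have "\<dots> = q (smul b x) \<omega>" using pos[of \<omega>] by simp
    finally show ?case using elim(2) by (simp add: b_def algebra_simps)
  qed
qed

text \<open>The largest sublinear map below \<open>q\<close> with value at most \<open>- q y\<close> at \<open>- y\<close>.\<close>

definition lowered_set :: "('e \<Rightarrow> 'w \<Rightarrow> real) \<Rightarrow> 'e \<Rightarrow> 'e \<Rightarrow> ('w \<Rightarrow> real) set" where
  "lowered_set q y x = {(\<lambda>\<omega>. q (x \<oplus>\<^bsub>E\<^esub> smul t y) \<omega> - t \<omega> * q y \<omega>) | t. t \<in> borel_measurable M \<and> (\<forall>\<omega>. 0 \<le> t \<omega>)}"

definition lowered :: "('e \<Rightarrow> 'w \<Rightarrow> real) \<Rightarrow> 'e \<Rightarrow> 'e \<Rightarrow> 'w \<Rightarrow> real" where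
  "lowered q y x = ess_inf M (lowered_set q y x)"

context
  fixes q y assumes q: "sublinear q" and y: "y \<in> carrier E"
begin

text \<open>The lower bound comes from t q y \<le> q (t y) \<le> q (x + t y) + q (- x), whose first
  step is the reverse homogeneity. It is uniform in \<open>t\<close>.\<close>

lemma lowered_set:
  assumes x: "x \<in> carrier E"
  shows "lowered_set q y x \<noteq> {}" "lowered_set q y x \<subseteq> borel_measurable M"
    "(\<lambda>\<omega>. - nm x \<omega>) \<in> borel_measurable M"
    "\<And>f. f \<in> lowered_set q y x \<Longrightarrow> AE \<omega> in M. - nm x \<omega> \<le> f \<omega>"
proof -
  note [measurable] = sublinearD(1)[OF q]
  show "lowered_set q y x \<noteq> {}" unfolding lowered_set_def by (auto intro!: exI[of _ "\<lambda>_. 0"])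
  show "lowered_set q y x \<subseteq> borel_measurable M" unfolding lowered_set_def using x y by auto
  show "(\<lambda>\<omega>. - nm x \<omega>) \<in> borel_measurable M" using x by measurable
  fix f assume "f \<in> lowered_set q y x"
  then obtain t where t[measurable]: "t \<in> borel_measurable M" and nonneg: "\<And>\<omega>. 0 \<le> t \<omega>"
    and f: "f = (\<lambda>\<omega>. q (x \<oplus>\<^bsub>E\<^esub> smul t y) \<omega> - t \<omega> * q y \<omega>)" unfolding lowered_set_def by auto
  have "smul t y = (x \<oplus>\<^bsub>E\<^esub> smul t y) \<oplus>\<^bsub>E\<^esub> \<ominus>\<^bsub>E\<^esub> x"
    using x y t by (simp add: M.a_ac M.r_neg1 M.r_neg2)
  then have "AE \<omega> in M. q (smul t y) \<omega> \<le> q (x \<oplus>\<^bsub>E\<^esub> smul t y) \<omega> + q (\<ominus>\<^bsub>E\<^esub> x) \<omega>"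
    using sublinearD(2)[OF q, of "x \<oplus>\<^bsub>E\<^esub> smul t y" "\<ominus>\<^bsub>E\<^esub> x"] x y t by simp
  moreover have "AE \<omega> in M. q (\<ominus>\<^bsub>E\<^esub> x) \<omega> \<le> nm (\<ominus>\<^bsub>E\<^esub> x) \<omega>" using sublinearD(4)[OF q] x by simp
  ultimately show "AE \<omega> in M. - nm x \<omega> \<le> f \<omega>"
    using nm_uminus[OF x] sublinear_smul_ge[OF q y t nonneg] unfolding f by eventually_elim linarith
qed

lemma lowered_le:
  assumes x: "x \<in> carrier E" and t: "t \<in> borel_measurable M" "\<And>\<omega>. 0 \<le> t \<omega>"
  shows "AE \<omega> in M. lowered q y x \<omega> \<le> q (x \<oplus>\<^bsub>E\<^esub> smul t y) \<omega> - t \<omega> * q y \<omega>"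
  unfolding lowered_def by (rule ess_inf_lower[OF lowered_set[OF x]]) (use t in \<open>auto simp: lowered_set_def\<close>)

lemma lowered_le_self: "x \<in> carrier E \<Longrightarrow> AE \<omega> in M. lowered q y x \<omega> \<le> q x \<omega>"
  using lowered_le[of x "\<lambda>_. 0"] y by (simp add: smul_zero)

lemma lowered_le_one: "x \<in> carrier E \<Longrightarrow> AE \<omega> in M. lowered q y x \<omega> \<le> q (x \<oplus>\<^bsub>E\<^esub> y) \<omega> - q y \<omega>"
  using lowered_le[of x "\<lambda>_. 1"] y by (simp add: smul_one)

text \<open>Multipliers \<open>s\<close> and \<open>t\<close> for two summands combine to s + t, and
  scaling by \<open>a\<close> turns \<open>t\<close> into a t. Since \<open>a\<close> is random, the
  multipliers in \<open>lowered_set\<close> have to be random variables rather than numbers.\<close>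

lemma sublinear_lowered: "sublinear (lowered q y)"
proof -
  note [measurable] = sublinearD(1)[OF q]
  have meas: "lowered q y x \<in> borel_measurable M" if "x \<in> carrier E" for x
    unfolding lowered_def by (rule ess_inf_measurable[OF lowered_set[OF that]])
  show ?thesis
    unfolding sublinear_def
  proof (intro conjI ballI impI meas)
    fix x z assume x: "x \<in> carrier E" and z: "z \<in> carrier E"
    show "AE \<omega> in M. lowered q y (x \<oplus>\<^bsub>E\<^esub> z) \<omega> \<le> lowered q y x \<omega> + lowered q y z \<omega>"
      unfolding lowered_def[of q y x] lowered_def[of q y z]
    proof (rule ess_inf_add_greatest[OF lowered_set[OF x] lowered_set[OF z]])
      show "lowered q y (x \<oplus>\<^bsub>E\<^esub> z) \<in> borel_measurable M" using x z by (simp add: meas)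
      fix f g assume "f \<in> lowered_set q y x" "g \<in> lowered_set q y z"
      then obtain s t where s: "s \<in> borel_measurable M" "\<And>\<omega>. 0 \<le> s \<omega>"
        and f: "f = (\<lambda>\<omega>. q (x \<oplus>\<^bsub>E\<^esub> smul s y) \<omega> - s \<omega> * q y \<omega>)"
        and t: "t \<in> borel_measurable M" "\<And>\<omega>. 0 \<le> t \<omega>"
        and g: "g = (\<lambda>\<omega>. q (z \<oplus>\<^bsub>E\<^esub> smul t y) \<omega> - t \<omega> * q y \<omega>)"
        unfolding lowered_set_def by auto
      have "(x \<oplus>\<^bsub>E\<^esub> z) \<oplus>\<^bsub>E\<^esub> smul (\<lambda>\<omega>. s \<omega> + t \<omega>) y = (x \<oplus>\<^bsub>E\<^esub> smul s y) \<oplus>\<^bsub>E\<^esub> (z \<oplus>\<^bsub>E\<^esub> smul t y)"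
        using x y z s(1) t(1) by (simp add: smul_add_left M.a_ac)
      then have "AE \<omega> in M. lowered q y (x \<oplus>\<^bsub>E\<^esub> z) \<omega> \<le>
          q ((x \<oplus>\<^bsub>E\<^esub> smul s y) \<oplus>\<^bsub>E\<^esub> (z \<oplus>\<^bsub>E\<^esub> smul t y)) \<omega> - (s \<omega> + t \<omega>) * q y \<omega>"
        using lowered_le[of "x \<oplus>\<^bsub>E\<^esub> z" "\<lambda>\<omega>. s \<omega> + t \<omega>"] x z s t by simp
      moreover have "AE \<omega> in M. q ((x \<oplus>\<^bsub>E\<^esub> smul s y) \<oplus>\<^bsub>E\<^esub> (z \<oplus>\<^bsub>E\<^esub> smul t y)) \<omega> \<le>
          q (x \<oplus>\<^bsub>E\<^esub> smul s y) \<omega> + q (z \<oplus>\<^bsub>E\<^esub> smul t y) \<omega>"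
        by (rule sublinearD(2)[OF q]) (use x y z s t in auto)
      ultimately show "AE \<omega> in M. lowered q y (x \<oplus>\<^bsub>E\<^esub> z) \<omega> \<le> f \<omega> + g \<omega>"
        unfolding f g by eventually_elim (simp add: algebra_simps)
    qed
  next
    fix a x assume a[measurable]: "a \<in> borel_measurable M" and nonneg: "\<forall>\<omega>. 0 \<le> (a \<omega> :: real)" and x: "x \<in> carrier E"
    show "AE \<omega> in M. lowered q y (smul a x) \<omega> \<le> a \<omega> * lowered q y x \<omega>"
      unfolding lowered_def[of q y x]
    proof (rule ess_inf_mult_greatest[OF lowered_set[OF x]])
      show "lowered q y (smul a x) \<in> borel_measurable M" using x by (simp add: meas)
      fix f assume "f \<in> lowered_set q y x"
      then obtain t where t: "t \<in> borel_measurable M" "\<And>\<omega>. 0 \<le> t \<omega>"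
        and f: "f = (\<lambda>\<omega>. q (x \<oplus>\<^bsub>E\<^esub> smul t y) \<omega> - t \<omega> * q y \<omega>)" unfolding lowered_set_def by auto
      have "smul a x \<oplus>\<^bsub>E\<^esub> smul (\<lambda>\<omega>. a \<omega> * t \<omega>) y = smul a (x \<oplus>\<^bsub>E\<^esub> smul t y)"
        using x y t by (simp add: smul_mult smul_add)
      then have "AE \<omega> in M. lowered q y (smul a x) \<omega> \<le> q (smul a (x \<oplus>\<^bsub>E\<^esub> smul t y)) \<omega> - a \<omega> * t \<omega> * q y \<omega>"
        using lowered_le[of "smul a x" "\<lambda>\<omega>. a \<omega> * t \<omega>"] x t nonneg by simp
      moreover have "AE \<omega> in M. q (smul a (x \<oplus>\<^bsub>E\<^esub> smul t y)) \<omega> \<le> a \<omega> * q (x \<oplus>\<^bsub>E\<^esub> smul t y) \<omega>"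
        by (rule sublinearD(3)[OF q]) (use x y t nonneg in auto)
      ultimately show "AE \<omega> in M. lowered q y (smul a x) \<omega> \<le> a \<omega> * f \<omega>"
        unfolding f by eventually_elim (simp add: algebra_simps)
    qed (use nonneg in auto)
  next
    fix x assume x: "x \<in> carrier E"
    show "AE \<omega> in M. lowered q y x \<omega> \<le> nm x \<omega>"
      using lowered_le_self[OF x] sublinearD(4)[OF q x] by eventually_elim simp
  qed
qed

end

text \<open>The almost sure order on maps is only a preorder, so Zorn's lemma is applied to epigraphs,
  ordered by inclusion.\<close>

definition epigraph :: "('e \<Rightarrow> 'w \<Rightarrow> real) \<Rightarrow> ('e \<times> ('w \<Rightarrow> real)) set" where
  "epigraph q = {(x, a). x \<in> carrier E \<and> a \<in> borel_measurable M \<and> (AE \<omega> in M. q x \<omega> \<le> a \<omega>)}"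

lemma epigraph_subset_iff:
  assumes q: "\<And>x. x \<in> carrier E \<Longrightarrow> q x \<in> borel_measurable M"
  shows "epigraph q \<subseteq> epigraph q' \<longleftrightarrow> (\<forall>x\<in>carrier E. AE \<omega> in M. q' x \<omega> \<le> q x \<omega>)"
proof
  assume sub: "epigraph q \<subseteq> epigraph q'"
  show "\<forall>x\<in>carrier E. AE \<omega> in M. q' x \<omega> \<le> q x \<omega>"
  proof
    fix x assume "x \<in> carrier E"
    then have "(x, q x) \<in> epigraph q" using q by (simp add: epigraph_def)
    with sub have "(x, q x) \<in> epigraph q'" by blast
    then show "AE \<omega> in M. q' x \<omega> \<le> q x \<omega>" by (simp add: epigraph_def)
  qed
next
  assume le: "\<forall>x\<in>carrier E. AE \<omega> in M. q' x \<omega> \<le> q x \<omega>"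
  show "epigraph q \<subseteq> epigraph q'"
  proof
    fix p assume p: "p \<in> epigraph q"
    obtain x a where xa: "p = (x, a)" by force
    have "AE \<omega> in M. q' x \<omega> \<le> q x \<omega>" "AE \<omega> in M. q x \<omega> \<le> a \<omega>"
      using le p by (auto simp: xa epigraph_def)
    then have "AE \<omega> in M. q' x \<omega> \<le> a \<omega>" by eventually_elim simp
    with p show "p \<in> epigraph q'" by (simp add: xa epigraph_def)
  qed
qed

text \<open>Subadditivity of the infimum has to bound sums q x + q' y with different members. In a
  chain the smaller of the two maps can replace both.\<close>

lemma sublinear_chain_inf:
  assumes ne: "Q \<noteq> {}" and Q: "\<And>q. q \<in> Q \<Longrightarrow> sublinear q"
    and chain: "\<And>q q'. q \<in> Q \<Longrightarrow> q' \<in> Q \<Longrightarrow>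
      (\<forall>x\<in>carrier E. AE \<omega> in M. q x \<omega> \<le> q' x \<omega>) \<or> (\<forall>x\<in>carrier E. AE \<omega> in M. q' x \<omega> \<le> q x \<omega>)"
  obtains p where "sublinear p" "\<And>q x. q \<in> Q \<Longrightarrow> x \<in> carrier E \<Longrightarrow> AE \<omega> in M. p x \<omega> \<le> q x \<omega>"
proof
  define V where "V x = {q x | q. q \<in> Q}" for x
  define p where "p x = ess_inf M (V x)" for x
  have V: "V x \<noteq> {}" "V x \<subseteq> borel_measurable M" "(\<lambda>\<omega>. - nm x \<omega>) \<in> borel_measurable M"
    "\<And>f. f \<in> V x \<Longrightarrow> AE \<omega> in M. - nm x \<omega> \<le> f \<omega>" if x: "x \<in> carrier E" for x
  proof -
    show "V x \<noteq> {}" using ne by (auto simp: V_def)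
    show "V x \<subseteq> borel_measurable M" using sublinearD(1)[OF Q] x by (auto simp: V_def)
    show "(\<lambda>\<omega>. - nm x \<omega>) \<in> borel_measurable M" using x by measurable
    show "AE \<omega> in M. - nm x \<omega> \<le> f \<omega>" if "f \<in> V x" for f
      using that sublinear_lower[OF Q x] by (auto simp: V_def)
  qed
  have le: "AE \<omega> in M. p x \<omega> \<le> q x \<omega>" if "q \<in> Q" "x \<in> carrier E" for q x
    unfolding p_def by (rule ess_inf_lower[OF V]) (use that in \<open>auto simp: V_def\<close>)
  then show "AE \<omega> in M. p x \<omega> \<le> q x \<omega>" if "q \<in> Q" "x \<in> carrier E" for q x
    using that by blast
  have meas: "p x \<in> borel_measurable M" if "x \<in> carrier E" for x
    unfolding p_def by (rule ess_inf_measurable[OF V[OF that]])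
  show "sublinear p"
    unfolding sublinear_def
  proof (intro conjI ballI impI meas)
    fix x y assume x: "x \<in> carrier E" and y: "y \<in> carrier E"
    show "AE \<omega> in M. p (x \<oplus>\<^bsub>E\<^esub> y) \<omega> \<le> p x \<omega> + p y \<omega>"
      unfolding p_def[of x] p_def[of y]
    proof (rule ess_inf_add_greatest[OF V[OF x] V[OF y]])
      show "p (x \<oplus>\<^bsub>E\<^esub> y) \<in> borel_measurable M" using x y by (simp add: meas)
      fix f g assume "f \<in> V x" "g \<in> V y"
      then obtain q q' where q: "q \<in> Q" "f = q x" and q': "q' \<in> Q" "g = q' y" by (auto simp: V_def)
      have "AE \<omega> in M. p (x \<oplus>\<^bsub>E\<^esub> y) \<omega> \<le> r x \<omega> + r y \<omega>" if "r \<in> Q" for r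
        using le[OF that M.a_closed[OF x y]] sublinearD(2)[OF Q[OF that] x y] by eventually_elim simp
      from chain[OF q(1) q'(1)] this[OF q(1)] this[OF q'(1)]
      show "AE \<omega> in M. p (x \<oplus>\<^bsub>E\<^esub> y) \<omega> \<le> f \<omega> + g \<omega>"
      proof (elim disjE)
        assume a: "AE \<omega> in M. p (x \<oplus>\<^bsub>E\<^esub> y) \<omega> \<le> q x \<omega> + q y \<omega>" "\<forall>x\<in>carrier E. AE \<omega> in M. q x \<omega> \<le> q' x \<omega>"
        show ?thesis using a(1) bspec[OF a(2) y] unfolding q q' by eventually_elim simp
      next
        assume a: "AE \<omega> in M. p (x \<oplus>\<^bsub>E\<^esub> y) \<omega> \<le> q' x \<omega> + q' y \<omega>" "\<forall>x\<in>carrier E. AE \<omega> in M. q' x \<omega> \<le> q x \<omega>"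
        show ?thesis using a(1) bspec[OF a(2) x] unfolding q q' by eventually_elim simp
      qed
    qed
  next
    fix a x assume a: "a \<in> borel_measurable M" and nonneg: "\<forall>\<omega>. 0 \<le> (a \<omega> :: real)" and x: "x \<in> carrier E"
    show "AE \<omega> in M. p (smul a x) \<omega> \<le> a \<omega> * p x \<omega>"
      unfolding p_def[of x]
    proof (rule ess_inf_mult_greatest[OF V[OF x]])
      show "p (smul a x) \<in> borel_measurable M" using a x by (simp add: meas)
      fix f assume "f \<in> V x"
      then obtain q where q: "q \<in> Q" "f = q x" by (auto simp: V_def)
      have "AE \<omega> in M. q (smul a x) \<omega> \<le> a \<omega> * q x \<omega>"
        by (rule sublinearD(3)[OF Q[OF q(1)] a _ x]) (use nonneg in auto)
      with le[OF q(1) smul_closed[OF a x]]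
      show "AE \<omega> in M. p (smul a x) \<omega> \<le> a \<omega> * f \<omega>" unfolding q by eventually_elim simp
    qed (use a nonneg in auto)
  next
    fix x assume x: "x \<in> carrier E"
    obtain q where q: "q \<in> Q" using ne by auto
    show "AE \<omega> in M. p x \<omega> \<le> nm x \<omega>"
      using le[OF q x] sublinearD(4)[OF Q[OF q] x] by eventually_elim simp
  qed
qed

text \<open>Smaller maps have larger epigraphs, so a maximal epigraph yields a minimal map. Upper
  bounds of chains are epigraphs of essential infima.\<close>

lemma minimal_sublinear_exists:
  assumes q0: "sublinear q0"
  obtains q where "sublinear q" "\<And>x. x \<in> carrier E \<Longrightarrow> AE \<omega> in M. q x \<omega> \<le> q0 x \<omega>"
    "\<And>p x. sublinear p \<Longrightarrow> (\<And>x. x \<in> carrier E \<Longrightarrow> AE \<omega> in M. p x \<omega> \<le> q x \<omega>) \<Longrightarrow> x \<in> carrier E \<Longrightarrow>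
      AE \<omega> in M. q x \<omega> \<le> p x \<omega>"
proof -
  define S where "S = {q. sublinear q \<and> (\<forall>x\<in>carrier E. AE \<omega> in M. q x \<omega> \<le> q0 x \<omega>)}"
  have sub: "epigraph q \<subseteq> epigraph q' \<longleftrightarrow> (\<forall>x\<in>carrier E. AE \<omega> in M. q' x \<omega> \<le> q x \<omega>)" if "q \<in> S" for q q'
    by (rule epigraph_subset_iff) (use that in \<open>auto simp: S_def intro: sublinearD(1)\<close>)
  have "\<exists>U\<in>epigraph ` S. \<forall>X\<in>epigraph ` S. U \<subseteq> X \<longrightarrow> X = U"
  proof (rule subset_Zorn)
    fix C assume C: "subset.chain (epigraph ` S) C"
    show "\<exists>U\<in>epigraph ` S. \<forall>X\<in>C. X \<subseteq> U"
    proof (cases "C = {}")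
      case True
      have "q0 \<in> S" using q0 by (auto simp: S_def)
      with True show ?thesis by blast
    next
      case False
      define Q where "Q = {q\<in>S. epigraph q \<in> C}"
      have CQ: "\<exists>q\<in>Q. X = epigraph q" if "X \<in> C" for X
        using C that unfolding subset.chain_def Q_def by blast
      obtain p where p: "sublinear p" and le: "\<And>q x. q \<in> Q \<Longrightarrow> x \<in> carrier E \<Longrightarrow> AE \<omega> in M. p x \<omega> \<le> q x \<omega>"
      proof (rule sublinear_chain_inf[of Q])
        show "Q \<noteq> {}" using CQ False by blast
        show "sublinear q" if "q \<in> Q" for q using that by (simp add: Q_def S_def)
        fix q q' assume q: "q \<in> Q" "q' \<in> Q"
        then have "epigraph q \<subseteq> epigraph q' \<or> epigraph q' \<subseteq> epigraph q"
          using C by (auto simp: Q_def subset.chain_def) blast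
        then show "(\<forall>x\<in>carrier E. AE \<omega> in M. q x \<omega> \<le> q' x \<omega>) \<or> (\<forall>x\<in>carrier E. AE \<omega> in M. q' x \<omega> \<le> q x \<omega>)"
          using sub q by (auto simp: Q_def)
      qed blast
      obtain q where q: "q \<in> Q" using CQ False by blast
      have "AE \<omega> in M. p x \<omega> \<le> q0 x \<omega>" if x: "x \<in> carrier E" for x
      proof -
        have "AE \<omega> in M. q x \<omega> \<le> q0 x \<omega>" using q x by (simp add: Q_def S_def)
        with le[OF q x] show ?thesis by eventually_elim simp
      qed
      then have "p \<in> S" using p by (simp add: S_def)
      moreover have "X \<subseteq> epigraph p" if "X \<in> C" for X
        using CQ[OF that] sub le by (auto simp: Q_def)
      ultimately show ?thesis by blast
    qed
  qed
  then obtain q where q: "q \<in> S" and max: "\<And>p. p \<in> S \<Longrightarrow> epigraph q \<subseteq> epigraph p \<Longrightarrow> epigraph p = epigraph q"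
    by auto
  show ?thesis
  proof (rule that[of q])
    show "sublinear q" "\<And>x. x \<in> carrier E \<Longrightarrow> AE \<omega> in M. q x \<omega> \<le> q0 x \<omega>" using q by (simp_all add: S_def)
    fix p x assume p: "sublinear p" and le: "\<And>x. x \<in> carrier E \<Longrightarrow> AE \<omega> in M. p x \<omega> \<le> q x \<omega>"
      and x: "x \<in> carrier E"
    have "AE \<omega> in M. p x \<omega> \<le> q0 x \<omega>" if x: "x \<in> carrier E" for x
    proof -
      have "AE \<omega> in M. q x \<omega> \<le> q0 x \<omega>" using q x by (simp add: S_def)
      with le[OF x] show ?thesis by eventually_elim simp
    qed
    then have pS: "p \<in> S" using p by (simp add: S_def)
    have "epigraph p = epigraph q" using max[OF pS] sub[OF q] le by auto
    then show "AE \<omega> in M. q x \<omega> \<le> p x \<omega>" using sub[OF pS, of q] x by auto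
  qed
qed

text \<open>\<open>lowered q y\<close> is a sublinear map below \<open>q\<close>, so minimality
  gives q x \<le> \<open>lowered q y x\<close> \<le> q (x + y) - q y, the superadditivity that
  \<open>q\<close> lacked. Linearity thus comes without extending functionals from
  submodules.\<close>

lemma minimal_sublinear_dual:
  assumes q: "sublinear q"
    and min: "\<And>p x. sublinear p \<Longrightarrow> (\<And>x. x \<in> carrier E \<Longrightarrow> AE \<omega> in M. p x \<omega> \<le> q x \<omega>) \<Longrightarrow> x \<in> carrier E \<Longrightarrow>
      AE \<omega> in M. q x \<omega> \<le> p x \<omega>"
  shows "dual_real q"
proof -
  note meas[measurable] = sublinearD(1)[OF q]
  have add: "AE \<omega> in M. q (x \<oplus>\<^bsub>E\<^esub> y) \<omega> = q x \<omega> + q y \<omega>" if x: "x \<in> carrier E" and y: "y \<in> carrier E" for x y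
  proof -
    have "AE \<omega> in M. q x \<omega> \<le> lowered q y x \<omega>"
      by (rule min[OF sublinear_lowered[OF q y] lowered_le_self[OF q y] x])
    with lowered_le_one[OF q y x] sublinearD(2)[OF q x y] show ?thesis
      by eventually_elim simp
  qed
  have "AE \<omega> in M. q \<zero>\<^bsub>E\<^esub> \<omega> = 0"
    using add[of "\<zero>\<^bsub>E\<^esub>" "\<zero>\<^bsub>E\<^esub>"] by simp
  then have neg: "AE \<omega> in M. q (\<ominus>\<^bsub>E\<^esub> x) \<omega> = - q x \<omega>" if x: "x \<in> carrier E" for x
    using add[OF x M.a_inv_closed[OF x], unfolded M.r_neg[OF x]] by eventually_elim simp
  have pos: "AE \<omega> in M. q (smul a x) \<omega> = a \<omega> * q x \<omega>"
    if a: "a \<in> borel_measurable M" "\<And>\<omega>. 0 \<le> a \<omega>" and x: "x \<in> carrier E" for a x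
    using sublinearD(3)[OF q a x] sublinear_smul_ge[OF q x a] by eventually_elim simp
  show ?thesis
    unfolding dual_real_def
  proof (intro conjI ballI meas add)
    fix a :: "'w \<Rightarrow> real" and x assume a[measurable]: "a \<in> borel_measurable M" and x: "x \<in> carrier E"
    \<comment> \<open>Homogeneity is available for nonnegative multipliers only. Writing b = a + c
      instead of a = b - c lets additivity be applied directly.\<close>
    define b c :: "'w \<Rightarrow> real" where "b \<omega> = max (a \<omega>) 0" and "c \<omega> = max (- a \<omega>) 0" for \<omega>
    have b: "b \<in> borel_measurable M" "\<And>\<omega>. 0 \<le> b \<omega>" and c: "c \<in> borel_measurable M" "\<And>\<omega>. 0 \<le> c \<omega>"
      unfolding b_def c_def by auto
    have "b = (\<lambda>\<omega>. a \<omega> + c \<omega>)" by (auto simp: b_def c_def fun_eq_iff)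
    then have "smul b x = smul a x \<oplus>\<^bsub>E\<^esub> smul c x"
      using smul_add_left[OF a c(1) x] by simp
    then have "AE \<omega> in M. q (smul b x) \<omega> = q (smul a x) \<omega> + q (smul c x) \<omega>"
      using add[of "smul a x" "smul c x"] a c x by simp
    with pos[OF b x] pos[OF c x] show "AE \<omega> in M. q (smul a x) \<omega> = a \<omega> * q x \<omega>"
    proof eventually_elim
      case (elim \<omega>)
      then have "q (smul a x) \<omega> = (b \<omega> - c \<omega>) * q x \<omega>" by (simp add: algebra_simps)
      also have "b \<omega> - c \<omega> = a \<omega>" by (simp add: b_def c_def)
      finally show ?case .
    qed
  next
    fix x assume x: "x \<in> carrier E"
    show "AE \<omega> in M. \<bar>q x \<omega>\<bar> \<le> nm x \<omega>"
      using sublinearD(4)[OF q x] sublinear_lower[OF q x] by eventually_elim simp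
  qed
qed

text \<open>Starting from \<open>lowered nm w\<close> instead of \<open>nm\<close> builds the
  norming in: its value at - w is at most - nm w, so every linear map below it is at least nm w at
  \<open>w\<close>. This avoids a functional on the submodule generated by \<open>w\<close>, which
  may vanish on part of the space.\<close>

theorem norming_functional_exists:
  assumes w: "w \<in> carrier E"
  obtains q where "dual_real q" "AE \<omega> in M. q w \<omega> = nm w \<omega>"
proof -
  obtain q where q: "sublinear q" and le: "\<And>x. x \<in> carrier E \<Longrightarrow> AE \<omega> in M. q x \<omega> \<le> lowered nm w x \<omega>"
    and min: "\<And>p x. sublinear p \<Longrightarrow> (\<And>x. x \<in> carrier E \<Longrightarrow> AE \<omega> in M. p x \<omega> \<le> q x \<omega>) \<Longrightarrow> x \<in> carrier E \<Longrightarrow>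
      AE \<omega> in M. q x \<omega> \<le> p x \<omega>"
    by (rule minimal_sublinear_exists[OF sublinear_lowered[OF sublinear_nm w]]) blast
  have dual: "dual_real q" by (rule minimal_sublinear_dual[OF q]) (blast intro: min)
  have mw: "\<ominus>\<^bsub>E\<^esub> w \<in> carrier E" using w by simp
  have "AE \<omega> in M. q (\<ominus>\<^bsub>E\<^esub> w) \<omega> = - q w \<omega>"
    using dual_realD(3)[OF dual, of "\<lambda>_. -1" w] w by (simp add: smul_const_minus)
  moreover have "AE \<omega> in M. lowered nm w (\<ominus>\<^bsub>E\<^esub> w) \<omega> \<le> nm \<zero>\<^bsub>E\<^esub> \<omega> - nm w \<omega>"
    using lowered_le_one[OF sublinear_nm w mw] w by (simp add: M.l_neg)
  ultimately have "AE \<omega> in M. q w \<omega> = nm w \<omega>"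
    using le[OF mw] nm_zero sublinearD(4)[OF q w] by eventually_elim linarith
  with dual show ?thesis by (rule that)
qed

end

section \<open>The topologies and the random conjugate space\<close>

context random_normed_module
begin

lemma prob_inter_ge:
  assumes "{\<omega> \<in> space M. P \<omega>} \<in> sets M" "{\<omega> \<in> space M. Q \<omega>} \<in> sets M" "{\<omega> \<in> space M. R \<omega>} \<in> sets M"
    and "AE \<omega> in M. P \<omega> \<longrightarrow> Q \<omega> \<longrightarrow> R \<omega>"
  shows "prob {\<omega> \<in> space M. P \<omega>} + prob {\<omega> \<in> space M. Q \<omega>} - 1 \<le> prob {\<omega> \<in> space M. R \<omega>}"
proof -
  let ?P = "{\<omega> \<in> space M. P \<omega>}" and ?Q = "{\<omega> \<in> space M. Q \<omega>}"
  have "prob (?P \<union> ?Q) = prob ?P + prob ?Q - prob (?P \<inter> ?Q)"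
    using assms(1,2) by (simp add: finite_measure_Union' finite_measure_Diff' Int_commute)
  moreover have "prob (?P \<union> ?Q) \<le> 1" by simp
  moreover have "prob (?P \<inter> ?Q) \<le> prob {\<omega> \<in> space M. R \<omega>}"
    using assms(4) by (intro finite_measure_mono_AE assms(3)) (auto elim: eventually_mono)
  ultimately show ?thesis by linarith
qed

text \<open>Treats the norm topology and the random weak topology at once, with \<phi> a random
  seminorm whose balls belong to the base. Base sets are not open by definition, so an open
  neighbourhood of the limit has to be exhibited.\<close>

lemma limitin_base_vanishing:
  fixes \<phi> :: "'e \<Rightarrow> 'w \<Rightarrow> real"
  assumes op: "openin T = base_open E \<B>"
    and base: "\<And>e l. 0 < e \<Longrightarrow> 0 < l \<Longrightarrow> l < 1 \<Longrightarrow> {v \<in> carrier E. prob {\<omega> \<in> space M. \<phi> v \<omega> < e} > 1 - l} \<in> \<B>"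
    and meas: "\<And>x. x \<in> carrier E \<Longrightarrow> \<phi> x \<in> borel_measurable M"
    and nonneg: "\<And>x. x \<in> carrier E \<Longrightarrow> AE \<omega> in M. 0 \<le> \<phi> x \<omega>"
    and add: "\<And>x y. x \<in> carrier E \<Longrightarrow> y \<in> carrier E \<Longrightarrow> AE \<omega> in M. \<phi> (x \<oplus>\<^bsub>E\<^esub> y) \<omega> \<le> \<phi> x \<omega> + \<phi> y \<omega>"
    and zero: "AE \<omega> in M. \<phi> \<zero>\<^bsub>E\<^esub> \<omega> = 0"
    and lim: "limitin T u x F" and x: "x \<in> carrier E" and u: "\<And>i. u i \<in> carrier E"
  shows "vanishing M F (\<lambda>i. \<phi> (u i \<ominus>\<^bsub>E\<^esub> x))"
  unfolding vanishing_def
proof (intro conjI allI impI)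
  show "\<phi> (u i \<ominus>\<^bsub>E\<^esub> x) \<in> borel_measurable M" for i using u x by (intro meas) simp
  have sets: "{\<omega> \<in> space M. \<phi> v \<omega> < c} \<in> sets M" "{\<omega> \<in> space M. c \<le> \<bar>\<phi> v \<omega>\<bar>} \<in> sets M"
    if "v \<in> carrier E" for v c using meas[OF that] by measurable
  fix e :: real assume e: "0 < e"
  \<comment> \<open>The base requires \<open>l < 1\<close>, and the final estimate requires
    \<open>l \<le> e\<close>.\<close>
  define l where "l = min e (1/2)"
  have l: "0 < l" "l < 1" "l \<le> e" using e by (auto simp: l_def)
  \<comment> \<open>The strict slack \<open>e' < e\<close> makes \<open>U\<close> open: an increment
    \<open>v\<close> may use up half of this slack in size, and the excess over 1 - l in
    probability.\<close>
  define U where "U = {y \<in> carrier E. \<exists>e'<e. prob {\<omega> \<in> space M. \<phi> (y \<ominus>\<^bsub>E\<^esub> x) \<omega> < e'} > 1 - l}"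
  have "base_open E \<B> U"
    unfolding base_open_def
  proof (intro conjI ballI)
    show "U \<subseteq> carrier E" by (auto simp: U_def)
    fix y assume "y \<in> U"
    then obtain e' where y: "y \<in> carrier E" and e': "e' < e" and p: "prob {\<omega> \<in> space M. \<phi> (y \<ominus>\<^bsub>E\<^esub> x) \<omega> < e'} > 1 - l"
      by (auto simp: U_def)
    let ?p = "prob {\<omega> \<in> space M. \<phi> (y \<ominus>\<^bsub>E\<^esub> x) \<omega> < e'}"
    define V where "V = {v \<in> carrier E. prob {\<omega> \<in> space M. \<phi> v \<omega> < (e - e')/2} > 1 - (?p - (1 - l))}"
    have "?p \<le> 1" by simp
    then have "?p - (1 - l) < 1" "0 < ?p - (1 - l)" using p l by linarith+
    then have "V \<in> \<B>" unfolding V_def using e' by (intro base) simp_all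
    moreover have "{y \<oplus>\<^bsub>E\<^esub> v |v. v \<in> V} \<subseteq> U"
    proof clarify
      fix v assume "v \<in> V"
      then have v: "v \<in> carrier E" and pv: "prob {\<omega> \<in> space M. \<phi> v \<omega> < (e - e')/2} > 1 - (?p - (1 - l))"
        by (auto simp: V_def)
      have eq: "(y \<oplus>\<^bsub>E\<^esub> v) \<ominus>\<^bsub>E\<^esub> x = (y \<ominus>\<^bsub>E\<^esub> x) \<oplus>\<^bsub>E\<^esub> v"
        using x y v by (simp add: a_minus_def M.a_ac)
      have "?p + prob {\<omega> \<in> space M. \<phi> v \<omega> < (e - e')/2} - 1
          \<le> prob {\<omega> \<in> space M. \<phi> ((y \<oplus>\<^bsub>E\<^esub> v) \<ominus>\<^bsub>E\<^esub> x) \<omega> < e' + (e - e')/2}"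
      proof (rule prob_inter_ge)
        show "AE \<omega> in M. \<phi> (y \<ominus>\<^bsub>E\<^esub> x) \<omega> < e' \<longrightarrow> \<phi> v \<omega> < (e - e')/2 \<longrightarrow>
            \<phi> ((y \<oplus>\<^bsub>E\<^esub> v) \<ominus>\<^bsub>E\<^esub> x) \<omega> < e' + (e - e')/2"
          unfolding eq using add[OF M.minus_closed[OF y x] v] by eventually_elim linarith
      qed (intro sets, use x y v in simp)+
      with pv have "1 - l < prob {\<omega> \<in> space M. \<phi> ((y \<oplus>\<^bsub>E\<^esub> v) \<ominus>\<^bsub>E\<^esub> x) \<omega> < e' + (e - e')/2}" by linarith
      moreover have "e' + (e - e')/2 < e" using e' by (simp add: field_simps)
      ultimately show "y \<oplus>\<^bsub>E\<^esub> v \<in> U" using y v by (auto simp: U_def)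
    qed
    ultimately show "\<exists>V\<in>\<B>. {y \<oplus>\<^bsub>E\<^esub> v |v. v \<in> V} \<subseteq> U" by blast
  qed
  moreover have "x \<in> U"
  proof -
    have "AE \<omega> in M. \<phi> (x \<ominus>\<^bsub>E\<^esub> x) \<omega> < e/2"
      using zero unfolding a_minus_def M.r_neg[OF x] by eventually_elim (use e in simp)
    then have "prob {\<omega> \<in> space M. \<phi> (x \<ominus>\<^bsub>E\<^esub> x) \<omega> < e/2} = 1"
      by (subst prob_Collect_eq_1[OF sets(1)[OF M.minus_closed[OF x x]]])
    then show ?thesis using x e l by (auto simp: U_def intro!: exI[of _ "e/2"])
  qed
  ultimately have "\<forall>\<^sub>F i in F. u i \<in> U"
    using lim unfolding limitin_def op by blast
  then show "\<forall>\<^sub>F i in F. prob {\<omega> \<in> space M. e \<le> \<bar>\<phi> (u i \<ominus>\<^bsub>E\<^esub> x) \<omega>\<bar>} < e"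
  proof eventually_elim
    case (elim i)
    let ?v = "u i \<ominus>\<^bsub>E\<^esub> x"
    have v: "?v \<in> carrier E" using u x by simp
    obtain e' where e': "e' < e" "prob {\<omega> \<in> space M. \<phi> ?v \<omega> < e'} > 1 - l" using elim by (auto simp: U_def)
    \<comment> \<open>The two events are almost surely incompatible, so their probabilities sum to
      at most 1 and the second is below \<open>l\<close>.\<close>
    have "prob {\<omega> \<in> space M. \<phi> ?v \<omega> < e'} + prob {\<omega> \<in> space M. e \<le> \<bar>\<phi> ?v \<omega>\<bar>} - 1 \<le> prob {\<omega> \<in> space M. False}"
    proof (rule prob_inter_ge)
      show "AE \<omega> in M. \<phi> ?v \<omega> < e' \<longrightarrow> e \<le> \<bar>\<phi> ?v \<omega>\<bar> \<longrightarrow> False"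
        using nonneg[OF v] by eventually_elim (use e' in auto)
    qed (use v in \<open>simp_all add: sets\<close>)
    with e' l show ?case by simp
  qed
qed

lemma openin_el: "openin (el_topology M E N) = base_open E (el_base M E N)"
  by (rule openin_el_topology) (auto simp: N_in prob_space_axioms)

lemma openin_el_L0: "openin (el_topology M (L0 M K) (L0_abs M)) = base_open (L0 M K) (el_base M (L0 M K) (L0_abs M))"
  by (rule openin_el_topology) (auto simp: rep_abs_AE prob_space_axioms)

lemma el_base_ne: "\<exists>V. V \<in> el_base M R N' \<and> V \<subseteq> carrier R"
  unfolding el_base_def by (intro exI conjI CollectI exI[of _ 1] exI[of _ "1/2"]) auto

lemma topspace_el: "topspace (el_topology M E N) = carrier E"
proof
  show "topspace (el_topology M E N) \<subseteq> carrier E"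
    using openin_topspace[of "el_topology M E N"] unfolding openin_el base_open_def by blast
  have "base_open E (el_base M E N) (carrier E)"
    using el_base_ne[of E N] unfolding base_open_def by blast
  then show "carrier E \<subseteq> topspace (el_topology M E N)"
    by (intro openin_subset) (simp add: openin_el)
qed

lemma topspace_el_L0: "topspace (el_topology M (L0 M K) (L0_abs M)) = carrier (L0 M K)"
proof
  show "topspace (el_topology M (L0 M K) (L0_abs M)) \<subseteq> carrier (L0 M K)"
    using openin_topspace[of "el_topology M (L0 M K) (L0_abs M)"] unfolding openin_el_L0 base_open_def by blast
  have "base_open (L0 M K) (el_base M (L0 M K) (L0_abs M)) (carrier (L0 M K))"
    using el_base_ne[of "L0 M K" "L0_abs M"] R.a_closed unfolding base_open_def by blast
  then show "carrier (L0 M K) \<subseteq> topspace (el_topology M (L0 M K) (L0_abs M))"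
    by (intro openin_subset) (simp add: openin_el_L0)
qed

lemma limitin_el_vanishing:
  assumes lim: "limitin (el_topology M E N) u x F" and u: "\<And>i. u i \<in> carrier E"
  shows "vanishing M F (\<lambda>i. dst (u i) x)"
proof -
  have "x \<in> carrier E" using limitin_topspace[OF lim] by (simp add: topspace_el)
  then show ?thesis
    unfolding dst_def
    by (intro limitin_base_vanishing[OF openin_el _ _ _ _ _ lim]) (auto simp: el_base_def u intro: nm_nonneg nm_add nm_zero)
qed

lemma closedin_el_approx:
  assumes G: "closedin (el_topology M E N) G" and x: "x \<in> carrier E"
    and approx: "\<And>e l. 0 < e \<Longrightarrow> 0 < l \<Longrightarrow> \<exists>y\<in>G. prob {\<omega> \<in> space M. dst y x \<omega> < e} > 1 - l"
  shows "x \<in> G"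
proof (rule ccontr)
  assume "x \<notin> G"
  then have "x \<in> carrier E - G" using x by blast
  moreover have "base_open E (el_base M E N) (carrier E - G)" and sub: "G \<subseteq> carrier E"
    using G by (simp_all add: closedin_def openin_el topspace_el)
  ultimately obtain V where "V \<in> el_base M E N" and V: "{x \<oplus>\<^bsub>E\<^esub> v |v. v \<in> V} \<subseteq> carrier E - G"
    using base_openD[of E "el_base M E N" "carrier E - G" x] by blast
  then obtain e l where el: "0 < e" "0 < l" and V_eq: "V = {v \<in> carrier E. prob {\<omega> \<in> space M. nm v \<omega> < e} > 1 - l}"
    by (auto simp: el_base_def)
  obtain y where y: "y \<in> G" and p: "prob {\<omega> \<in> space M. dst y x \<omega> < e} > 1 - l" using approx[OF el] by blast
  have yE: "y \<in> carrier E" using y sub by blast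
  have "y \<ominus>\<^bsub>E\<^esub> x \<in> V" using p yE x by (simp add: V_eq dst_def)
  then have "x \<oplus>\<^bsub>E\<^esub> (y \<ominus>\<^bsub>E\<^esub> x) \<notin> G" using V by blast
  moreover have "x \<oplus>\<^bsub>E\<^esub> (y \<ominus>\<^bsub>E\<^esub> x) = y"
    using x yE M.a_lcomm[OF x yE M.a_inv_closed[OF x]] by (simp add: a_minus_def M.r_neg)
  ultimately show False using y by simp
qed

text \<open>The real part \<open>q\<close> and the imaginary part \<open>q'\<close> of a module homomorphism.\<close>

lemma rconjI:
  fixes q q' :: "'e \<Rightarrow> 'w \<Rightarrow> real"
  defines "g \<equiv> \<lambda>x. L0_cls M K (\<lambda>\<omega>. Complex (q x \<omega>) (q' x \<omega>))"
  assumes inK: "\<And>x. x \<in> carrier E \<Longrightarrow> (\<lambda>\<omega>. Complex (q x \<omega>) (q' x \<omega>)) \<in> rvars M K"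
    and add: "\<And>x y. x \<in> carrier E \<Longrightarrow> y \<in> carrier E \<Longrightarrow>
      AE \<omega> in M. q (x \<oplus>\<^bsub>E\<^esub> y) \<omega> = q x \<omega> + q y \<omega> \<and> q' (x \<oplus>\<^bsub>E\<^esub> y) \<omega> = q' x \<omega> + q' y \<omega>"
    and hom: "\<And>\<xi> x. \<xi> \<in> L0_set M K \<Longrightarrow> x \<in> carrier E \<Longrightarrow> AE \<omega> in M.
      Complex (q (\<xi> \<odot>\<^bsub>E\<^esub> x) \<omega>) (q' (\<xi> \<odot>\<^bsub>E\<^esub> x) \<omega>) = rep \<xi> \<omega> * Complex (q x \<omega>) (q' x \<omega>)"
    and bound: "\<And>x. x \<in> carrier E \<Longrightarrow> AE \<omega> in M. \<bar>q x \<omega>\<bar> \<le> nm x \<omega> \<and> \<bar>q' x \<omega>\<bar> \<le> nm x \<omega>"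
  shows "g \<in> rconj M K E N"
proof -
  have g_in: "g x \<in> L0_set M K" and rep_g: "AE \<omega> in M. rep (g x) \<omega> = Complex (q x \<omega>) (q' x \<omega>)"
    if "x \<in> carrier E" for x
    unfolding g_def using inK[OF that] by (auto intro: rep_L0_cls)
  have g_add: "g (x \<oplus>\<^bsub>E\<^esub> y) = g x \<oplus>\<^bsub>L0 M K\<^esub> g y" if x: "x \<in> carrier E" and y: "y \<in> carrier E" for x y
  proof (rule L0_eqI)
    show "g (x \<oplus>\<^bsub>E\<^esub> y) \<in> L0_set M K" "g x \<oplus>\<^bsub>L0 M K\<^esub> g y \<in> L0_set M K"
      using g_in x y R.a_closed by auto
    show "AE \<omega> in M. rep (g (x \<oplus>\<^bsub>E\<^esub> y)) \<omega> = rep (g x \<oplus>\<^bsub>L0 M K\<^esub> g y) \<omega>"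
      using rep_g[OF M.a_closed[OF x y]] rep_g[OF x] rep_g[OF y] rep_add_AE[OF g_in[OF x] g_in[OF y]] add[OF x y]
      by eventually_elim (simp add: complex_eq_iff)
  qed
  have g_hom: "g (\<xi> \<odot>\<^bsub>E\<^esub> x) = \<xi> \<otimes>\<^bsub>L0 M K\<^esub> g x" if \<xi>: "\<xi> \<in> L0_set M K" and x: "x \<in> carrier E" for \<xi> x
  proof (rule L0_eqI)
    have \<xi>x: "\<xi> \<odot>\<^bsub>E\<^esub> x \<in> carrier E" using \<xi> x by simp
    show "g (\<xi> \<odot>\<^bsub>E\<^esub> x) \<in> L0_set M K" "\<xi> \<otimes>\<^bsub>L0 M K\<^esub> g x \<in> L0_set M K"
      using g_in[OF \<xi>x] g_in[OF x] \<xi> R.m_closed by auto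
    show "AE \<omega> in M. rep (g (\<xi> \<odot>\<^bsub>E\<^esub> x)) \<omega> = rep (\<xi> \<otimes>\<^bsub>L0 M K\<^esub> g x) \<omega>"
      using rep_g[OF \<xi>x] rep_g[OF x] rep_mult_AE[OF \<xi> g_in[OF x]] hom[OF \<xi> x]
      by eventually_elim simp
  qed
  \<comment> \<open>The crude factor 2 comes from |z| \<le> |Re z| + |Im z|. It is enough for
    continuity and explains the radius e/2 below.\<close>
  have g_bound: "AE \<omega> in M. rep (L0_abs M (g x)) \<omega> \<le> 2 * nm x \<omega>" if x: "x \<in> carrier E" for x
    using rep_abs_AE(2)[OF g_in[OF x]] rep_g[OF x] bound[OF x]
  proof eventually_elim
    case (elim \<omega>)
    then show ?case using cmod_le[of "Complex (q x \<omega>) (q' x \<omega>)"] by simp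
  qed
  have "continuous_map (el_topology M E N) (el_topology M (L0 M K) (L0_abs M)) g"
    unfolding continuous_map_def topspace_el topspace_el_L0
  proof (intro conjI allI impI)
    show "g \<in> carrier E \<rightarrow> carrier (L0 M K)" using g_in by simp
    fix U assume "openin (el_topology M (L0 M K) (L0_abs M)) U"
    then have U: "base_open (L0 M K) (el_base M (L0 M K) (L0_abs M)) U" by (simp add: openin_el_L0)
    show "openin (el_topology M E N) {x \<in> carrier E. g x \<in> U}"
      unfolding openin_el base_open_def
    proof (intro conjI ballI)
      fix x assume x': "x \<in> {x \<in> carrier E. g x \<in> U}"
      then have x: "x \<in> carrier E" by simp
      obtain V where "V \<in> el_base M (L0 M K) (L0_abs M)" and V: "{g x \<oplus>\<^bsub>L0 M K\<^esub> v |v. v \<in> V} \<subseteq> U"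
        using base_openD[OF U, of "g x"] x' by blast
      then obtain e l where el: "0 < e" "0 < l" "l < 1"
        and V_eq: "V = {v \<in> L0_set M K. prob {\<omega> \<in> space M. rep (L0_abs M v) \<omega> < e} > 1 - l}"
        by (auto simp: el_base_def)
      define W where "W = {v \<in> carrier E. prob {\<omega> \<in> space M. nm v \<omega> < e/2} > 1 - l}"
      have "W \<in> el_base M E N" unfolding W_def el_base_def using el half_gt_zero[of e] by blast
      moreover have "{x \<oplus>\<^bsub>E\<^esub> v |v. v \<in> W} \<subseteq> {x \<in> carrier E. g x \<in> U}"
      proof clarify
        fix v assume "v \<in> W"
        then have v: "v \<in> carrier E" and p: "prob {\<omega> \<in> space M. nm v \<omega> < e/2} > 1 - l" by (auto simp: W_def)
        note [measurable] = rep_measurable[OF rep_abs_AE(1)[OF g_in[OF v]]] nm_measurable[OF v]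
        have "prob {\<omega> \<in> space M. nm v \<omega> < e/2} \<le> prob {\<omega> \<in> space M. rep (L0_abs M (g v)) \<omega> < e}"
          using g_bound[OF v] by (intro finite_measure_mono_AE) (measurable, auto elim: eventually_mono)
        then have "g v \<in> V" using p g_in[OF v] by (simp add: V_eq)
        then show "x \<oplus>\<^bsub>E\<^esub> v \<in> carrier E \<and> g (x \<oplus>\<^bsub>E\<^esub> v) \<in> U"
          using V x v g_add[OF x v] by auto
      qed
      ultimately show "\<exists>V\<in>el_base M E N. {x \<oplus>\<^bsub>E\<^esub> v |v. v \<in> V} \<subseteq> {x \<in> carrier E. g x \<in> U}" by blast
    qed auto
  qed
  then show ?thesis
    unfolding rconj_def using g_in g_add g_hom by simp
qed

text \<open>Complex scalars: the classical formula g x = q x - i q (i x). Real scalars: the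
  imaginary part is zero.\<close>

lemma imaginary_part_exists:
  assumes q: "dual_real q"
  obtains q' where "\<And>x. x \<in> carrier E \<Longrightarrow> (\<lambda>\<omega>. Complex (q x \<omega>) (q' x \<omega>)) \<in> rvars M K"
    "\<And>x y. x \<in> carrier E \<Longrightarrow> y \<in> carrier E \<Longrightarrow>
      AE \<omega> in M. q (x \<oplus>\<^bsub>E\<^esub> y) \<omega> = q x \<omega> + q y \<omega> \<and> q' (x \<oplus>\<^bsub>E\<^esub> y) \<omega> = q' x \<omega> + q' y \<omega>"
    "\<And>\<xi> x. \<xi> \<in> L0_set M K \<Longrightarrow> x \<in> carrier E \<Longrightarrow> AE \<omega> in M.
      Complex (q (\<xi> \<odot>\<^bsub>E\<^esub> x) \<omega>) (q' (\<xi> \<odot>\<^bsub>E\<^esub> x) \<omega>) = rep \<xi> \<omega> * Complex (q x \<omega>) (q' x \<omega>)"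
    "\<And>x. x \<in> carrier E \<Longrightarrow> AE \<omega> in M. \<bar>q x \<omega>\<bar> \<le> nm x \<omega> \<and> \<bar>q' x \<omega>\<bar> \<le> nm x \<omega>"
proof (cases "K = \<real>")
  assume K: "K = \<real>"
  show ?thesis
  proof (rule that[of "\<lambda>_ _. 0"])
    fix x assume x: "x \<in> carrier E"
    note [measurable] = dual_realD(1)[OF q x]
    show "(\<lambda>\<omega>. Complex (q x \<omega>) 0) \<in> rvars M K"
      using rvars_of_real[of "q x"] by (simp add: complex_of_real_def)
    show "AE \<omega> in M. \<bar>q x \<omega>\<bar> \<le> nm x \<omega> \<and> \<bar>0\<bar> \<le> nm x \<omega>"
      using dual_realD(4)[OF q x] by eventually_elim auto
    show "AE \<omega> in M. q (x \<oplus>\<^bsub>E\<^esub> y) \<omega> = q x \<omega> + q y \<omega> \<and> (0::real) = 0 + 0" if y: "y \<in> carrier E" for y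
      using dual_realD(2)[OF q x y] by simp
    fix \<xi> assume \<xi>: "\<xi> \<in> L0_set M K"
    define a where "a \<omega> = Re (rep \<xi> \<omega>)" for \<omega>
    have a[measurable]: "a \<in> borel_measurable M" unfolding a_def using rep_measurable[OF \<xi>] by measurable
    have re: "complex_of_real (a \<omega>) = rep \<xi> \<omega>" if "\<omega> \<in> space M" for \<omega>
      using rep_in(2)[OF \<xi>] that K by (auto simp: rvars_iff a_def)
    have "L0_cls M K (\<lambda>\<omega>. complex_of_real (a \<omega>)) = L0_cls M K (rep \<xi>)"
      using re by (intro L0_cls_eqI rvars_of_real rep_in(2)[OF \<xi>]) auto
    then have "\<xi> \<odot>\<^bsub>E\<^esub> x = smul a x" by (simp add: smul_def L0_cls_rep[OF \<xi>])
    then show "AE \<omega> in M. Complex (q (\<xi> \<odot>\<^bsub>E\<^esub> x) \<omega>) 0 = rep \<xi> \<omega> * Complex (q x \<omega>) 0"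
      using dual_realD(3)[OF q a x] AE_space
      by (simp, elim eventually_elim2) (auto simp: re[symmetric] complex_eq_iff)
  qed
next
  assume "K \<noteq> \<real>"
  with scalars have K: "K = UNIV" by simp
  define \<iota> where "\<iota> = L0_cls M K (\<lambda>_. \<i>)"
  have ci: "(\<lambda>_. \<i>) \<in> rvars M K" using K by (simp add: rvars_iff)
  have \<iota>: "\<iota> \<in> L0_set M K" unfolding \<iota>_def using ci by blast
  have \<iota>x: "\<iota> \<odot>\<^bsub>E\<^esub> x \<in> carrier E" if "x \<in> carrier E" for x using \<iota> that by simp
  have \<iota>\<iota>: "\<iota> \<odot>\<^bsub>E\<^esub> (\<iota> \<odot>\<^bsub>E\<^esub> x) = smul (\<lambda>_. - 1) x" if x: "x \<in> carrier E" for x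
    using smult_assoc1[of \<iota> \<iota> x] \<iota> x cls_mult[OF ci ci] by (simp add: \<iota>_def smul_def)
  have nm_\<iota>: "AE \<omega> in M. nm (\<iota> \<odot>\<^bsub>E\<^esub> x) \<omega> = nm x \<omega>" if x: "x \<in> carrier E" for x
    using nm_cls_smult[OF ci x] by (simp add: \<iota>_def)
  have \<iota>_smul: "\<iota> \<odot>\<^bsub>E\<^esub> smul a x = smul a (\<iota> \<odot>\<^bsub>E\<^esub> x)" if a: "a \<in> borel_measurable M" and x: "x \<in> carrier E" for a x
    using a x \<iota> unfolding smul_def by (simp add: smult_assoc1[symmetric] rvars_of_real L0_cls_in R.m_comm)
  show ?thesis
  proof (rule that[of "\<lambda>x \<omega>. - q (\<iota> \<odot>\<^bsub>E\<^esub> x) \<omega>"])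
    fix x assume x: "x \<in> carrier E"
    note [measurable] = dual_realD(1)[OF q x] dual_realD(1)[OF q \<iota>x[OF x]]
    show "(\<lambda>\<omega>. Complex (q x \<omega>) (- q (\<iota> \<odot>\<^bsub>E\<^esub> x) \<omega>)) \<in> rvars M K"
      using K unfolding rvars_iff by (simp add: Complex_eq)
    show "AE \<omega> in M. \<bar>q x \<omega>\<bar> \<le> nm x \<omega> \<and> \<bar>- q (\<iota> \<odot>\<^bsub>E\<^esub> x) \<omega>\<bar> \<le> nm x \<omega>"
      using dual_realD(4)[OF q x] dual_realD(4)[OF q \<iota>x[OF x]] nm_\<iota>[OF x] by eventually_elim auto
    show "AE \<omega> in M. q (x \<oplus>\<^bsub>E\<^esub> y) \<omega> = q x \<omega> + q y \<omega> \<and>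
        - q (\<iota> \<odot>\<^bsub>E\<^esub> (x \<oplus>\<^bsub>E\<^esub> y)) \<omega> = - q (\<iota> \<odot>\<^bsub>E\<^esub> x) \<omega> + - q (\<iota> \<odot>\<^bsub>E\<^esub> y) \<omega>" if y: "y \<in> carrier E" for y
      using dual_realD(2)[OF q x y] dual_realD(2)[OF q \<iota>x[OF x] \<iota>x[OF y]]
      unfolding smult_r_distr[OF \<iota>[folded carrier_L0] x y] by eventually_elim simp
    fix \<xi> assume \<xi>: "\<xi> \<in> L0_set M K"
    \<comment> \<open>With \<xi> = a + b i, the real parts \<open>a\<close> and \<open>b\<close> are
      pulled out by the homogeneity of \<open>q\<close> over real random variables; the factor i is
      moved into the argument by \<iota>.\<close>
    define a b where "a \<omega> = Re (rep \<xi> \<omega>)" and "b \<omega> = Im (rep \<xi> \<omega>)" for \<omega>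
    have a: "a \<in> borel_measurable M" and b: "b \<in> borel_measurable M"
      unfolding a_def b_def using rep_measurable[OF \<xi>] by measurable
    let ?a = "L0_cls M K (\<lambda>\<omega>. complex_of_real (a \<omega>))" and ?b = "L0_cls M K (\<lambda>\<omega>. complex_of_real (b \<omega>))"
    have bi: "(\<lambda>\<omega>. complex_of_real (b \<omega>) * \<i>) \<in> rvars M K"
      using b K by (simp add: rvars_iff)
    have "?a \<oplus>\<^bsub>L0 M K\<^esub> (?b \<otimes>\<^bsub>L0 M K\<^esub> \<iota>) = L0_cls M K (\<lambda>\<omega>. complex_of_real (a \<omega>) + complex_of_real (b \<omega>) * \<i>)"
      unfolding \<iota>_def by (simp add: cls_mult[OF rvars_of_real[OF b] ci] cls_add[OF rvars_of_real[OF a] bi])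
    also have "(\<lambda>\<omega>. complex_of_real (a \<omega>) + complex_of_real (b \<omega>) * \<i>) = rep \<xi>"
      by (auto simp: a_def b_def fun_eq_iff complex_eq_iff)
    finally have dec: "\<xi> = ?a \<oplus>\<^bsub>L0 M K\<^esub> (?b \<otimes>\<^bsub>L0 M K\<^esub> \<iota>)" by (simp add: L0_cls_rep[OF \<xi>])
    have ab_in: "?a \<in> carrier (L0 M K)" "?b \<in> carrier (L0 M K)" "\<iota> \<in> carrier (L0 M K)"
      using a b \<iota> by (simp_all add: L0_cls_in rvars_of_real)
    have \<xi>z: "\<xi> \<odot>\<^bsub>E\<^esub> z = smul a z \<oplus>\<^bsub>E\<^esub> smul b (\<iota> \<odot>\<^bsub>E\<^esub> z)" if z: "z \<in> carrier E" for z
      unfolding dec smul_def using ab_in z by (simp only: smult_l_distr smult_assoc1 R.m_closed)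
    have "\<iota> \<odot>\<^bsub>E\<^esub> (\<xi> \<odot>\<^bsub>E\<^esub> x) = smul a (\<iota> \<odot>\<^bsub>E\<^esub> x) \<oplus>\<^bsub>E\<^esub> smul b (smul (\<lambda>_. - 1) x)"
      unfolding \<xi>z[OF x] using \<iota> a b x \<iota>x[OF x] ab_in(3)
      by (simp add: smult_r_distr \<iota>_smul \<iota>\<iota> del: carrier_L0)
    then have 1: "AE \<omega> in M. q (\<iota> \<odot>\<^bsub>E\<^esub> (\<xi> \<odot>\<^bsub>E\<^esub> x)) \<omega> = q (smul a (\<iota> \<odot>\<^bsub>E\<^esub> x)) \<omega> + q (smul b (smul (\<lambda>_. - 1) x)) \<omega>"
      using dual_realD(2)[OF q smul_closed[OF a \<iota>x[OF x]] smul_closed[OF b smul_closed[OF _ x]], of "\<lambda>_. - 1"] by simp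
    have 2: "AE \<omega> in M. q (\<xi> \<odot>\<^bsub>E\<^esub> x) \<omega> = q (smul a x) \<omega> + q (smul b (\<iota> \<odot>\<^bsub>E\<^esub> x)) \<omega>"
      unfolding \<xi>z[OF x] by (rule dual_realD(2)[OF q]) (use a b x \<iota>x in auto)
    have 3: "AE \<omega> in M. q (smul (\<lambda>_. - 1) x) \<omega> = - q x \<omega>"
      using dual_realD(3)[OF q _ x, of "\<lambda>_. - 1"] by simp
    have 4: "AE \<omega> in M. q (smul b (smul (\<lambda>_. - 1) x)) \<omega> = b \<omega> * q (smul (\<lambda>_. - 1) x) \<omega>"
      by (rule dual_realD(3)[OF q b]) (use x in auto)
    show "AE \<omega> in M. Complex (q (\<xi> \<odot>\<^bsub>E\<^esub> x) \<omega>) (- q (\<iota> \<odot>\<^bsub>E\<^esub> (\<xi> \<odot>\<^bsub>E\<^esub> x)) \<omega>) =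
        rep \<xi> \<omega> * Complex (q x \<omega>) (- q (\<iota> \<odot>\<^bsub>E\<^esub> x) \<omega>)"
      using 1 2 3 4 dual_realD(3)[OF q a x] dual_realD(3)[OF q b \<iota>x[OF x]] dual_realD(3)[OF q a \<iota>x[OF x]]
      by eventually_elim (simp add: complex_eq_iff a_def b_def)
  qed
qed

text \<open>The form in which weak convergence enters the sequel: it is tested on real functionals,
  which is all that the norming argument applies, and it passes to midpoints and
  reindexings.\<close>

definition weakly_vanishing :: "(nat \<Rightarrow> 'e) \<Rightarrow> 'e \<Rightarrow> bool" where
  "weakly_vanishing u x \<longleftrightarrow> (\<forall>q. dual_real q \<longrightarrow> vanishing M sequentially (\<lambda>n. q (u n \<ominus>\<^bsub>E\<^esub> x)))"

text \<open>Each \<open>q\<close> is the real part of some \<open>g\<close> in the random conjugate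
  space. The modulus of \<open>g\<close> is a random seminorm whose balls are subbasic, and it
  dominates |q|.\<close>

lemma limitin_random_weak_vanishing:
  assumes lim: "limitin (random_weak_topology M K E N) u x sequentially"
    and u: "\<And>n. u n \<in> carrier E" and x: "x \<in> carrier E"
  shows "weakly_vanishing u x"
  unfolding weakly_vanishing_def
proof (intro allI impI)
  fix q assume q: "dual_real q"
  obtain q' where q': "\<And>x. x \<in> carrier E \<Longrightarrow> (\<lambda>\<omega>. Complex (q x \<omega>) (q' x \<omega>)) \<in> rvars M K"
    "\<And>x y. x \<in> carrier E \<Longrightarrow> y \<in> carrier E \<Longrightarrow>
      AE \<omega> in M. q (x \<oplus>\<^bsub>E\<^esub> y) \<omega> = q x \<omega> + q y \<omega> \<and> q' (x \<oplus>\<^bsub>E\<^esub> y) \<omega> = q' x \<omega> + q' y \<omega>"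
    "\<And>\<xi> x. \<xi> \<in> L0_set M K \<Longrightarrow> x \<in> carrier E \<Longrightarrow> AE \<omega> in M.
      Complex (q (\<xi> \<odot>\<^bsub>E\<^esub> x) \<omega>) (q' (\<xi> \<odot>\<^bsub>E\<^esub> x) \<omega>) = rep \<xi> \<omega> * Complex (q x \<omega>) (q' x \<omega>)"
    "\<And>x. x \<in> carrier E \<Longrightarrow> AE \<omega> in M. \<bar>q x \<omega>\<bar> \<le> nm x \<omega> \<and> \<bar>q' x \<omega>\<bar> \<le> nm x \<omega>"
    by (rule imaginary_part_exists[OF q]) blast
  define g where "g x = L0_cls M K (\<lambda>\<omega>. Complex (q x \<omega>) (q' x \<omega>))" for x
  have g: "g \<in> rconj M K E N"
    unfolding g_def by (rule rconjI[OF q'])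
  then have g_in: "g x \<in> L0_set M K" if "x \<in> carrier E" for x using that by (auto simp: rconj_def)
  have rep_g: "AE \<omega> in M. rep (L0_abs M (g x)) \<omega> = cmod (Complex (q x \<omega>) (q' x \<omega>))" if "x \<in> carrier E" for x
    using rep_abs_AE(2)[OF g_in[OF that]] rep_L0_cls[OF q'(1)[OF that]] unfolding g_def by eventually_elim simp
  let ?B = "{carrier E \<inter> \<Inter>\<U> |\<U>. finite \<U> \<and> \<U> \<subseteq> weak_subbase M K E N}"
  have van: "vanishing M sequentially (\<lambda>n. rep (L0_abs M (g (u n \<ominus>\<^bsub>E\<^esub> x))))"
  proof (rule limitin_base_vanishing[OF openin_random_weak_topology _ _ _ _ _ lim x u])
    fix e l :: real assume el: "0 < e" "0 < l" "l < 1"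
    let ?S = "{v \<in> carrier E. prob {\<omega> \<in> space M. rep (L0_abs M (g v)) \<omega> < e} > 1 - l}"
    have "?S \<in> weak_subbase M K E N" unfolding weak_subbase_def using g el by blast
    then show "?S \<in> ?B" by (intro CollectI exI[of _ "{?S}"]) auto
  next
    fix x y assume x: "x \<in> carrier E" and y: "y \<in> carrier E"
    show "AE \<omega> in M. rep (L0_abs M (g (x \<oplus>\<^bsub>E\<^esub> y))) \<omega> \<le> rep (L0_abs M (g x)) \<omega> + rep (L0_abs M (g y)) \<omega>"
      using rep_g[OF x] rep_g[OF y] rep_g[OF M.a_closed[OF x y]] q'(2)[OF x y]
    proof eventually_elim
      case (elim \<omega>)
      have "Complex (q (x \<oplus>\<^bsub>E\<^esub> y) \<omega>) (q' (x \<oplus>\<^bsub>E\<^esub> y) \<omega>) = Complex (q x \<omega>) (q' x \<omega>) + Complex (q y \<omega>) (q' y \<omega>)"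
        using elim by (simp add: complex_eq_iff)
      then show ?case using elim(1-3) norm_triangle_ineq by metis
    qed
  next
    show "AE \<omega> in M. rep (L0_abs M (g \<zero>\<^bsub>E\<^esub>)) \<omega> = 0"
      using rep_g[OF M.zero_closed] q'(4)[OF M.zero_closed] nm_zero
      by eventually_elim (simp add: zero_complex.code)
  next
    fix x assume x: "x \<in> carrier E"
    show "AE \<omega> in M. 0 \<le> rep (L0_abs M (g x)) \<omega>" using rep_g[OF x] by eventually_elim simp
    show "rep (L0_abs M (g x)) \<in> borel_measurable M" by (rule rep_measurable[OF rep_abs_AE(1)[OF g_in[OF x]]])
  qed
  show "vanishing M sequentially (\<lambda>n. q (u n \<ominus>\<^bsub>E\<^esub> x))"
  proof (rule vanishing_dominated[OF _ van])
    fix n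
    have v: "u n \<ominus>\<^bsub>E\<^esub> x \<in> carrier E" using u x by simp
    show "q (u n \<ominus>\<^bsub>E\<^esub> x) \<in> borel_measurable M" by (rule dual_realD(1)[OF q v])
    show "AE \<omega> in M. \<bar>q (u n \<ominus>\<^bsub>E\<^esub> x) \<omega>\<bar> \<le> 1 * \<bar>rep (L0_abs M (g (u n \<ominus>\<^bsub>E\<^esub> x))) \<omega>\<bar>"
      using rep_g[OF v]
    proof eventually_elim
      case (elim \<omega>)
      then show ?case using abs_Re_le_cmod[of "Complex (q (u n \<ominus>\<^bsub>E\<^esub> x) \<omega>) (q' (u n \<ominus>\<^bsub>E\<^esub> x) \<omega>)"] by simp
    qed
  qed
qed

end

section \<open>Uniform convexity\<close>

context random_normed_module
begin

text \<open>Both elements are divided by the random radius \<open>r\<close> on the event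
  \<open>D\<close> where the hypotheses hold and set to zero elsewhere, so that their norms are at
  most 1 everywhere. The gap is one real number because members of \<open>delta_F\<close> have a
  positive real lower bound.\<close>

lemma random_uniformly_convex_pointwise:
  assumes UC: "random_uniformly_convex M E N" and \<epsilon>: "0 < \<epsilon>" "\<epsilon> \<le> 2"
  obtains \<eta> where "0 < \<eta>" "\<eta> \<le> 1/2"
    "\<And>u v r. u \<in> carrier E \<Longrightarrow> v \<in> carrier E \<Longrightarrow> r \<in> borel_measurable M \<Longrightarrow>
      AE \<omega> in M. 0 < r \<omega> \<longrightarrow> nm u \<omega> \<le> r \<omega> \<longrightarrow> nm v \<omega> \<le> r \<omega> \<longrightarrow> \<epsilon> * r \<omega> \<le> nm (u \<ominus>\<^bsub>E\<^esub> v) \<omega> \<longrightarrow>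
        nm (u \<oplus>\<^bsub>E\<^esub> v) \<omega> \<le> 2 * (1 - \<eta>) * r \<omega>"
proof -
  define e where "e = L0_cls M (UNIV :: real set) (\<lambda>_. \<epsilon>)"
  have ec: "(\<lambda>_. \<epsilon>) \<in> rvars M UNIV" by (simp add: rvars_iff)
  have e: "AE \<omega> in M. rep e \<omega> = \<epsilon>" unfolding e_def by (rule rep_L0_cls[OF ec])
  have "e \<in> L0_set M UNIV" unfolding e_def using ec by blast
  then have "e \<in> eps_F M"
    unfolding eps_F_def L0_pplus_def using e \<epsilon> by (auto intro!: exI[of _ \<epsilon>] elim!: eventually_mono)
  then obtain \<delta> where \<delta>: "\<delta> \<in> delta_F M" and uc: "\<And>x y D. x \<in> carrier E \<Longrightarrow> y \<in> carrier E \<Longrightarrow> D \<in> sets M \<Longrightarrow>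
      L0_le M (N x) \<one>\<^bsub>L0_real M\<^esub> \<Longrightarrow> L0_le M (N y) \<one>\<^bsub>L0_real M\<^esub> \<Longrightarrow>
      (AE \<omega> in M. \<omega> \<in> D \<longrightarrow> \<omega> \<in> supp_set2 M E N x y) \<Longrightarrow> prob D > 0 \<Longrightarrow>
      (AE \<omega> in M. \<omega> \<in> D \<longrightarrow> nm (x \<ominus>\<^bsub>E\<^esub> y) \<omega> \<ge> rep e \<omega>) \<Longrightarrow>
      (AE \<omega> in M. \<omega> \<in> D \<longrightarrow> nm (x \<oplus>\<^bsub>E\<^esub> y) \<omega> \<le> 2 * (1 - rep \<delta> \<omega>))"
    using UC unfolding random_uniformly_convex_def by blast
  obtain l where l: "0 < l" and \<delta>l: "AE \<omega> in M. l \<le> rep \<delta> \<omega>"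
    using \<delta> unfolding delta_F_def by auto
  have one_c: "(\<lambda>_. 1 :: real) \<in> rvars M UNIV" by (simp add: rvars_iff)
  have one: "AE \<omega> in M. rep \<one>\<^bsub>L0_real M\<^esub> \<omega> = 1"
    using rep_L0_cls[OF one_c] by (simp add: L0_def)
  \<comment> \<open>The cap 1/2 serves the points where \<open>u\<close> or \<open>v\<close>
    vanishes: there the triangle inequality only gives nm (u + v) \<le> r, and r \<le> 2 (1 -
    \<eta>) r requires \<eta> \<le> 1/2.\<close>
  show ?thesis
  proof (rule that[of "min l (1/2)"])
    show "0 < min l (1/2)" "min l (1/2) \<le> 1/2" using l by auto
    fix u v and r :: "'w \<Rightarrow> real"
    assume u: "u \<in> carrier E" and v: "v \<in> carrier E" and r[measurable]: "r \<in> borel_measurable M"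
    have d: "u \<ominus>\<^bsub>E\<^esub> v \<in> carrier E" and s: "u \<oplus>\<^bsub>E\<^esub> v \<in> carrier E" using u v by auto
    note [measurable] = nm_measurable[OF u] nm_measurable[OF v] nm_measurable[OF d] nm_measurable[OF s]
    \<comment> \<open>Points where \<open>u\<close> or \<open>v\<close> has norm zero lie outside
      \<open>supp_set2\<close>, so uniform convexity says nothing about them and they are left out
      of \<open>D\<close>.\<close>
    define D where "D = {\<omega> \<in> space M. 0 < r \<omega> \<and> nm u \<omega> \<le> r \<omega> \<and> nm v \<omega> \<le> r \<omega> \<and>
      \<epsilon> * r \<omega> \<le> nm (u \<ominus>\<^bsub>E\<^esub> v) \<omega> \<and> nm u \<omega> \<noteq> 0 \<and> nm v \<omega> \<noteq> 0}"
    have D[measurable]: "D \<in> sets M" unfolding D_def by measurable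
    define a where "a \<omega> = (if \<omega> \<in> D then 1 / r \<omega> else 0)" for \<omega>
    have a[measurable]: "a \<in> borel_measurable M" unfolding a_def by measurable
    have aD: "a \<omega> = 1 / r \<omega>" "0 < r \<omega>" if "\<omega> \<in> D" for \<omega> using that by (auto simp: a_def D_def)
    have a0: "a \<omega> = 0" if "\<omega> \<notin> D" for \<omega> using that by (simp add: a_def)
    have le1: "L0_le M (N (smul a w)) \<one>\<^bsub>L0_real M\<^esub>" if w: "w \<in> carrier E" and wr: "\<And>\<omega>. \<omega> \<in> D \<Longrightarrow> nm w \<omega> \<le> r \<omega>" for w
      unfolding L0_le_def using nm_smul[OF a w] one
    proof eventually_elim
      case (elim \<omega>)
      show ?case
      proof (cases "\<omega> \<in> D")
        case True
        then show ?thesis using elim aD[OF True] wr[OF True] by simp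
      qed (use elim a0 in simp)
    qed
    have scaled: "smul a u \<ominus>\<^bsub>E\<^esub> smul a v = smul a (u \<ominus>\<^bsub>E\<^esub> v)" "smul a u \<oplus>\<^bsub>E\<^esub> smul a v = smul a (u \<oplus>\<^bsub>E\<^esub> v)"
      using u v a by (simp_all add: smul_minus smul_add)
    have D_bound: "AE \<omega> in M. \<omega> \<in> D \<longrightarrow> nm (u \<oplus>\<^bsub>E\<^esub> v) \<omega> \<le> 2 * (1 - l) * r \<omega>"
    proof (cases "prob D > 0")
      case True
      have "AE \<omega> in M. \<omega> \<in> D \<longrightarrow> nm (smul a u \<oplus>\<^bsub>E\<^esub> smul a v) \<omega> \<le> 2 * (1 - rep \<delta> \<omega>)"
      proof (rule uc[OF _ _ D])
        show "AE \<omega> in M. \<omega> \<in> D \<longrightarrow> \<omega> \<in> supp_set2 M E N (smul a u) (smul a v)"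
          using nm_smul[OF a u] nm_smul[OF a v] nm_smul[OF a d] unfolding supp_set2_def supp_set_def scaled
        proof eventually_elim
          case (elim \<omega>)
          show ?case
          proof
            assume \<omega>: "\<omega> \<in> D"
            then have "0 < \<epsilon> * r \<omega>" using \<epsilon> by (simp add: D_def)
            then have "nm (u \<ominus>\<^bsub>E\<^esub> v) \<omega> \<noteq> 0" using \<omega> unfolding D_def by force
            then show "\<omega> \<in> {\<omega> \<in> space M. nm (smul a u) \<omega> \<noteq> 0} \<inter> {\<omega> \<in> space M. nm (smul a v) \<omega> \<noteq> 0} \<inter>
                {\<omega> \<in> space M. nm (smul a (u \<ominus>\<^bsub>E\<^esub> v)) \<omega> \<noteq> 0}"
              using \<omega> elim aD[OF \<omega>] by (simp add: D_def)
          qed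
        qed
        show "AE \<omega> in M. \<omega> \<in> D \<longrightarrow> nm (smul a u \<ominus>\<^bsub>E\<^esub> smul a v) \<omega> \<ge> rep e \<omega>"
          unfolding scaled using nm_smul[OF a d] e
        proof eventually_elim
          case (elim \<omega>)
          show ?case
          proof
            assume \<omega>: "\<omega> \<in> D"
            then have "\<epsilon> \<le> nm (u \<ominus>\<^bsub>E\<^esub> v) \<omega> / r \<omega>" by (simp add: D_def pos_le_divide_eq)
            then show "nm (smul a (u \<ominus>\<^bsub>E\<^esub> v)) \<omega> \<ge> rep e \<omega>"
              using elim aD[OF \<omega>] by simp
          qed
        qed
      qed (use True u v a le1 in \<open>auto simp: D_def\<close>)
      then show ?thesis
        unfolding scaled using nm_smul[OF a s] \<delta>l
      proof eventually_elim
        case (elim \<omega>)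
        show ?case
        proof
          assume \<omega>: "\<omega> \<in> D"
          then have "nm (u \<oplus>\<^bsub>E\<^esub> v) \<omega> / r \<omega> \<le> 2 * (1 - l)"
            using elim aD[OF \<omega>] by simp
          then show "nm (u \<oplus>\<^bsub>E\<^esub> v) \<omega> \<le> 2 * (1 - l) * r \<omega>"
            using aD(2)[OF \<omega>] by (simp add: pos_divide_le_eq)
        qed
      qed
    next
      case False
      then have "prob D = 0" using measure_nonneg[of M D] by linarith
      then have "AE \<omega> in M. \<omega> \<notin> D" using prob_eq_0[of D] D by simp
      then show ?thesis by eventually_elim simp
    qed
    show "AE \<omega> in M. 0 < r \<omega> \<longrightarrow> nm u \<omega> \<le> r \<omega> \<longrightarrow> nm v \<omega> \<le> r \<omega> \<longrightarrow> \<epsilon> * r \<omega> \<le> nm (u \<ominus>\<^bsub>E\<^esub> v) \<omega> \<longrightarrow>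
        nm (u \<oplus>\<^bsub>E\<^esub> v) \<omega> \<le> 2 * (1 - min l (1/2)) * r \<omega>"
      using D_bound nm_add[OF u v] AE_space
    proof eventually_elim
      case (elim \<omega>)
      show ?case
      proof (intro impI)
        assume h: "0 < r \<omega>" "nm u \<omega> \<le> r \<omega>" "nm v \<omega> \<le> r \<omega>" "\<epsilon> * r \<omega> \<le> nm (u \<ominus>\<^bsub>E\<^esub> v) \<omega>"
        have half: "r \<omega> \<le> 2 * (1 - min l (1/2)) * r \<omega>" using h(1) by simp
        have "(1 - l) * r \<omega> \<le> (1 - min l (1/2)) * r \<omega>" using h(1) by (intro mult_right_mono) auto
        then have mono: "2 * (1 - l) * r \<omega> \<le> 2 * (1 - min l (1/2)) * r \<omega>" by linarith
        show "nm (u \<oplus>\<^bsub>E\<^esub> v) \<omega> \<le> 2 * (1 - min l (1/2)) * r \<omega>"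
        proof (cases "\<omega> \<in> D")
          case True
          then show ?thesis using elim(1) mono by linarith
        next
          case False
          then have "nm u \<omega> = 0 \<or> nm v \<omega> = 0" using h elim(3) by (auto simp: D_def)
          then show ?thesis using elim(2) h half by linarith
        qed
      qed
    qed
  qed
qed

text \<open>One inequality read twice. With a - c and b - c, separated end points pull the midpoint
  towards \<open>c\<close>. With a - c and c - b, sum and difference change roles: if
  \<open>c\<close> is far from the midpoint, then \<open>a\<close> and \<open>b\<close> are closer
  together than 2r. The first form serves the contraction towards the weak limit, the second the
  almost fixed midpoints.\<close>

lemma uniformly_convex_mid:
  assumes UC: "random_uniformly_convex M E N" and \<epsilon>: "0 < \<epsilon>" "\<epsilon> \<le> 2"
  obtains \<eta> where "0 < \<eta>" "\<eta> \<le> 1/2"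
    "\<And>a b c r. a \<in> carrier E \<Longrightarrow> b \<in> carrier E \<Longrightarrow> c \<in> carrier E \<Longrightarrow> r \<in> borel_measurable M \<Longrightarrow>
      AE \<omega> in M. 0 < r \<omega> \<longrightarrow> dst a c \<omega> \<le> r \<omega> \<longrightarrow> dst b c \<omega> \<le> r \<omega> \<longrightarrow> \<epsilon> * r \<omega> \<le> dst a b \<omega> \<longrightarrow>
        dst (mid a b) c \<omega> \<le> (1 - \<eta>) * r \<omega>"
    "\<And>a b c r. a \<in> carrier E \<Longrightarrow> b \<in> carrier E \<Longrightarrow> c \<in> carrier E \<Longrightarrow> r \<in> borel_measurable M \<Longrightarrow>
      AE \<omega> in M. 0 < r \<omega> \<longrightarrow> dst a c \<omega> \<le> r \<omega> \<longrightarrow> dst b c \<omega> \<le> r \<omega> \<longrightarrow> \<epsilon> * r \<omega> \<le> 2 * dst (mid a b) c \<omega> \<longrightarrow>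
        dst a b \<omega> \<le> 2 * (1 - \<eta>) * r \<omega>"
proof -
  obtain \<eta> where \<eta>: "0 < \<eta>" "\<eta> \<le> 1/2" and uc: "\<And>u v r. u \<in> carrier E \<Longrightarrow> v \<in> carrier E \<Longrightarrow> r \<in> borel_measurable M \<Longrightarrow>
      AE \<omega> in M. 0 < r \<omega> \<longrightarrow> nm u \<omega> \<le> r \<omega> \<longrightarrow> nm v \<omega> \<le> r \<omega> \<longrightarrow> \<epsilon> * r \<omega> \<le> nm (u \<ominus>\<^bsub>E\<^esub> v) \<omega> \<longrightarrow>
        nm (u \<oplus>\<^bsub>E\<^esub> v) \<omega> \<le> 2 * (1 - \<eta>) * r \<omega>"
    by (rule random_uniformly_convex_pointwise[OF UC \<epsilon>]) blast
  show ?thesis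
  proof (rule that[OF \<eta>])
    fix a b c and r :: "'w \<Rightarrow> real"
    assume abc: "a \<in> carrier E" "b \<in> carrier E" "c \<in> carrier E" and r: "r \<in> borel_measurable M"
    have ac: "a \<ominus>\<^bsub>E\<^esub> c \<in> carrier E" and bc: "b \<ominus>\<^bsub>E\<^esub> c \<in> carrier E" and cb: "c \<ominus>\<^bsub>E\<^esub> b \<in> carrier E"
      using abc by auto
    have "(a \<ominus>\<^bsub>E\<^esub> c) \<ominus>\<^bsub>E\<^esub> (b \<ominus>\<^bsub>E\<^esub> c) = (a \<ominus>\<^bsub>E\<^esub> c) \<oplus>\<^bsub>E\<^esub> (c \<ominus>\<^bsub>E\<^esub> b)"
      using minus_swap[OF abc(2,3)] by (simp add: a_minus_def)
    then have diff: "(a \<ominus>\<^bsub>E\<^esub> c) \<ominus>\<^bsub>E\<^esub> (b \<ominus>\<^bsub>E\<^esub> c) = a \<ominus>\<^bsub>E\<^esub> b"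
      using minus_split[OF abc(1,3,2)] by simp
    show "AE \<omega> in M. 0 < r \<omega> \<longrightarrow> dst a c \<omega> \<le> r \<omega> \<longrightarrow> dst b c \<omega> \<le> r \<omega> \<longrightarrow> \<epsilon> * r \<omega> \<le> dst a b \<omega> \<longrightarrow>
        dst (mid a b) c \<omega> \<le> (1 - \<eta>) * r \<omega>"
      using uc[OF ac bc r] dst_mid[OF abc] unfolding diff dst_def[of a c] dst_def[of b c] dst_def[of a b]
      by eventually_elim (auto simp: algebra_simps)
    have diff': "(a \<ominus>\<^bsub>E\<^esub> c) \<ominus>\<^bsub>E\<^esub> (c \<ominus>\<^bsub>E\<^esub> b) = (a \<ominus>\<^bsub>E\<^esub> c) \<oplus>\<^bsub>E\<^esub> (b \<ominus>\<^bsub>E\<^esub> c)"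
      using minus_swap[OF abc(3,2)] by (simp add: a_minus_def)
    show "AE \<omega> in M. 0 < r \<omega> \<longrightarrow> dst a c \<omega> \<le> r \<omega> \<longrightarrow> dst b c \<omega> \<le> r \<omega> \<longrightarrow> \<epsilon> * r \<omega> \<le> 2 * dst (mid a b) c \<omega> \<longrightarrow>
        dst a b \<omega> \<le> 2 * (1 - \<eta>) * r \<omega>"
      using uc[OF ac cb r] dst_mid[OF abc] dst_commute[OF abc(2,3)]
      unfolding diff' minus_split[OF abc(1,3,2)] dst_def[of a c] dst_def[of b c] dst_def[of a b] dst_def[of c b]
      by eventually_elim auto
  qed
qed

section \<open>Midpoint sequences approaching the weak limit\<close>

lemma weakly_vanishing_mid:
  assumes y: "\<And>n. y n \<in> carrier E" and y': "\<And>n. y' n \<in> carrier E" and x: "x \<in> carrier E"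
    and w: "weakly_vanishing y x" "weakly_vanishing y' x"
  shows "weakly_vanishing (\<lambda>n. mid (y n) (y' n)) x"
  unfolding weakly_vanishing_def
proof (intro allI impI)
  fix q assume q: "dual_real q"
  have van: "vanishing M sequentially (\<lambda>n \<omega>. q (y n \<ominus>\<^bsub>E\<^esub> x) \<omega> + q (y' n \<ominus>\<^bsub>E\<^esub> x) \<omega>)"
    using w q unfolding weakly_vanishing_def by (intro vanishing_add) auto
  show "vanishing M sequentially (\<lambda>n. q (mid (y n) (y' n) \<ominus>\<^bsub>E\<^esub> x))"
  proof (rule vanishing_dominated[OF _ van, where C = "1/2"])
    fix n
    have v: "y n \<ominus>\<^bsub>E\<^esub> x \<in> carrier E" "y' n \<ominus>\<^bsub>E\<^esub> x \<in> carrier E" using y y' x by auto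
    show "q (mid (y n) (y' n) \<ominus>\<^bsub>E\<^esub> x) \<in> borel_measurable M"
      using y y' x by (intro dual_realD(1)[OF q]) simp
    show "AE \<omega> in M. \<bar>q (mid (y n) (y' n) \<ominus>\<^bsub>E\<^esub> x) \<omega>\<bar> \<le> 1/2 * \<bar>q (y n \<ominus>\<^bsub>E\<^esub> x) \<omega> + q (y' n \<ominus>\<^bsub>E\<^esub> x) \<omega>\<bar>"
      unfolding mid_minus[OF y y' x]
      using dual_realD(3)[where a = "\<lambda>_. 1/2", OF q borel_measurable_const M.a_closed[OF v]] dual_realD(2)[OF q v]
      by eventually_elim (simp add: abs_mult)
  qed
qed

lemma weakly_vanishing_reindex:
  "weakly_vanishing y x \<Longrightarrow> filterlim j sequentially sequentially \<Longrightarrow> weakly_vanishing (\<lambda>n. y (j n)) x"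
  unfolding weakly_vanishing_def by (auto intro: vanishing_compose[where X = "\<lambda>n. _ (y n \<ominus>\<^bsub>E\<^esub> x)"])

text \<open>Kakutani's step: a functional norming \<open>y n - x\<close> nearly vanishes at a later \<open>y (j n) - x\<close>, so the two
  points are far apart unless \<open>y n\<close> is close to \<open>x\<close>, and uniform convexity brings the midpoint closer to \<open>x\<close>.\<close>

lemma midpoint_contraction:
  assumes UC: "random_uniformly_convex M E N"
  obtains \<theta> where "0 \<le> \<theta>" "\<theta> < 1"
    "\<And>y x S. (\<And>n. y n \<in> carrier E) \<Longrightarrow> x \<in> carrier E \<Longrightarrow> weakly_vanishing y x \<Longrightarrow> S \<in> borel_measurable M \<Longrightarrow>
      (\<And>\<omega>. 0 \<le> S \<omega>) \<Longrightarrow> vanishing M sequentially (\<lambda>n \<omega>. max 0 (dst (y n) x \<omega> - S \<omega>)) \<Longrightarrow>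
      \<exists>j. filterlim j sequentially sequentially \<and>
        vanishing M sequentially (\<lambda>n \<omega>. max 0 (dst (mid (y n) (y (j n))) x \<omega> - \<theta> * S \<omega>))"
proof -
  \<comment> \<open>If dst a x > r/2 and the norming functional is at most r/4 at b - x, then
    \<open>a\<close> and \<open>b\<close> are at least r/4 apart.\<close>
  have quarter: "0 < (1/4 :: real)" "1/4 \<le> (2 :: real)" by simp_all
  obtain \<eta> where \<eta>: "0 < \<eta>" "\<eta> \<le> 1/2" and
    uc: "\<And>a b c r. a \<in> carrier E \<Longrightarrow> b \<in> carrier E \<Longrightarrow> c \<in> carrier E \<Longrightarrow> r \<in> borel_measurable M \<Longrightarrow>
      AE \<omega> in M. 0 < r \<omega> \<longrightarrow> dst a c \<omega> \<le> r \<omega> \<longrightarrow> dst b c \<omega> \<le> r \<omega> \<longrightarrow> 1/4 * r \<omega> \<le> dst a b \<omega> \<longrightarrow>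
        dst (mid a b) c \<omega> \<le> (1 - \<eta>) * r \<omega>"
    by (rule uniformly_convex_mid[OF UC quarter]) blast
  \<comment> \<open>The value 3/4 covers dst a x \<le> r/2, where the mean of the two distances is
    at most (r/2 + r)/2; 1 - \<eta> covers separated points.\<close>
  define \<theta> where "\<theta> = max (3/4) (1 - \<eta>)"
  have \<theta>: "3/4 \<le> \<theta>" "1 - \<eta> \<le> \<theta>" "0 \<le> \<theta>" "\<theta> < 1" using \<eta> by (auto simp: \<theta>_def)
  show ?thesis
  proof (rule that[OF \<theta>(3,4)])
    fix y :: "nat \<Rightarrow> 'e" and x and S :: "'w \<Rightarrow> real"
    assume y: "\<And>n. y n \<in> carrier E" and x: "x \<in> carrier E" and w: "weakly_vanishing y x"
      and S[measurable]: "S \<in> borel_measurable M" and S0: "\<And>\<omega>. 0 \<le> S \<omega>"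
      and van: "vanishing M sequentially (\<lambda>n \<omega>. max 0 (dst (y n) x \<omega> - S \<omega>))"
    have yx: "y n \<ominus>\<^bsub>E\<^esub> x \<in> carrier E" for n using y x by simp
    note [measurable] = dst_measurable[OF y x]
    have "\<exists>q. dual_real q \<and> (AE \<omega> in M. q (y n \<ominus>\<^bsub>E\<^esub> x) \<omega> = dst (y n) x \<omega>)" for n
      unfolding dst_def by (rule norming_functional_exists[OF yx[of n]]) blast
    then obtain q where q: "\<And>n. dual_real (q n)" and qn: "\<And>n. AE \<omega> in M. q n (y n \<ominus>\<^bsub>E\<^esub> x) \<omega> = dst (y n) x \<omega>"
      by metis
    \<comment> \<open>The functional changes with \<open>n\<close>, so weak convergence cannot be
      used along the diagonal directly. Instead \<open>j n\<close> is taken so late that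
      \<open>q n\<close> meets a tolerance which itself tends to zero.\<close>
    have "\<exists>j\<ge>n. prob {\<omega> \<in> space M. 1 / Suc n \<le> \<bar>q n (y j \<ominus>\<^bsub>E\<^esub> x) \<omega>\<bar>} < 1 / Suc n" for n
    proof -
      have "vanishing M sequentially (\<lambda>j. q n (y j \<ominus>\<^bsub>E\<^esub> x))"
        using w q unfolding weakly_vanishing_def by blast
      from vanishingD[OF this, of "1 / Suc n"]
      have "\<forall>\<^sub>F j in sequentially. prob {\<omega> \<in> space M. 1 / Suc n \<le> \<bar>q n (y j \<ominus>\<^bsub>E\<^esub> x) \<omega>\<bar>} < 1 / Suc n" by simp
      then have "\<forall>\<^sub>F j in sequentially. n \<le> j \<and> prob {\<omega> \<in> space M. 1 / Suc n \<le> \<bar>q n (y j \<ominus>\<^bsub>E\<^esub> x) \<omega>\<bar>} < 1 / Suc n"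
        using eventually_ge_at_top[of n] by eventually_elim simp
      then show ?thesis using eventually_happens'[OF sequentially_bot] by blast
    qed
    then obtain j where jn: "\<And>n. n \<le> j n"
      and j: "\<And>n. prob {\<omega> \<in> space M. 1 / Suc n \<le> \<bar>q n (y (j n) \<ominus>\<^bsub>E\<^esub> x) \<omega>\<bar>} < 1 / Suc n" by metis
    have jlim: "filterlim j sequentially sequentially"
      by (rule filterlim_at_top_mono[OF filterlim_ident]) (simp add: jn)
    have q_meas[measurable]: "q n (y i \<ominus>\<^bsub>E\<^esub> x) \<in> borel_measurable M" for n i by (rule dual_realD(1)[OF q yx])
    have van_q: "vanishing M sequentially (\<lambda>n. q n (y (j n) \<ominus>\<^bsub>E\<^esub> x))"
      unfolding vanishing_def
    proof (intro conjI allI impI q_meas)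
      fix e :: real assume e: "0 < e"
      have "\<forall>\<^sub>F n in sequentially. 1 / Suc n < e"
        using LIMSEQ_inverse_real_of_nat e by (auto simp: inverse_eq_divide dest: order_tendstoD)
      then show "\<forall>\<^sub>F n in sequentially. prob {\<omega> \<in> space M. e \<le> \<bar>q n (y (j n) \<ominus>\<^bsub>E\<^esub> x) \<omega>\<bar>} < e"
      proof eventually_elim
        case (elim n)
        have "prob {\<omega> \<in> space M. e \<le> \<bar>q n (y (j n) \<ominus>\<^bsub>E\<^esub> x) \<omega>\<bar>} \<le> prob {\<omega> \<in> space M. 1 / Suc n \<le> \<bar>q n (y (j n) \<ominus>\<^bsub>E\<^esub> x) \<omega>\<bar>}"
          using elim by (intro finite_measure_mono) auto
        then show ?case using j[of n] elim by linarith
      qed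
    qed
    define X where "X n \<omega> = max 0 (dst (y n) x \<omega> - S \<omega>)" for n \<omega>
    have X_meas[measurable]: "X n \<in> borel_measurable M" for n unfolding X_def by measurable
    have vX: "vanishing M sequentially X" using van unfolding X_def[abs_def] .
    define Y where "Y n \<omega> = \<bar>q n (y (j n) \<ominus>\<^bsub>E\<^esub> x) \<omega>\<bar> + (X n \<omega> + X (j n) \<omega>)" for n \<omega>
    have vY: "vanishing M sequentially Y"
      unfolding Y_def[abs_def] by (intro vanishing_add vanishing_abs van_q vX vanishing_compose[OF vX jlim])
    have "vanishing M sequentially (\<lambda>n \<omega>. max 0 (dst (mid (y n) (y (j n))) x \<omega> - \<theta> * S \<omega>))"
    \<comment> \<open>One \<open>Y\<close> pays for replacing \<theta> r by \<theta> S. Four more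
      pay for the points with r < 4Y, where the error exceeds r/4 and the trivial bound
      \<open>r\<close> on the distance is used.\<close>
    proof (rule vanishing_dominated[OF _ vY, where C = 5])
      fix n
      let ?a = "y n" and ?b = "y (j n)"
      have m: "mid ?a ?b \<in> carrier E" using y by simp
      note [measurable] = dst_measurable[OF m x]
      show "(\<lambda>\<omega>. max 0 (dst (mid ?a ?b) x \<omega> - \<theta> * S \<omega>)) \<in> borel_measurable M" by measurable
      \<comment> \<open>Adding the error to \<open>S\<close> makes \<open>r\<close> bound both
        distances at every \<open>n\<close>, not only asymptotically.\<close>
      define r where "r \<omega> = S \<omega> + Y n \<omega>" for \<omega>
      have r: "r \<in> borel_measurable M" unfolding r_def Y_def by measurable
      have neg: "\<ominus>\<^bsub>E\<^esub> (?b \<ominus>\<^bsub>E\<^esub> x) = x \<ominus>\<^bsub>E\<^esub> ?b" by (rule minus_swap[OF y x])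
      have ab: "?a \<ominus>\<^bsub>E\<^esub> ?b = (?a \<ominus>\<^bsub>E\<^esub> x) \<oplus>\<^bsub>E\<^esub> (x \<ominus>\<^bsub>E\<^esub> ?b)" by (rule minus_split[OF y x y, symmetric])
      have q1: "AE \<omega> in M. q n (?a \<ominus>\<^bsub>E\<^esub> ?b) \<omega> = q n (?a \<ominus>\<^bsub>E\<^esub> x) \<omega> + q n (x \<ominus>\<^bsub>E\<^esub> ?b) \<omega>"
        unfolding ab by (rule dual_realD(2)[OF q yx]) (use x y in simp)
      have q2: "AE \<omega> in M. q n (x \<ominus>\<^bsub>E\<^esub> ?b) \<omega> = - q n (?b \<ominus>\<^bsub>E\<^esub> x) \<omega>"
        using dual_realD(3)[OF q _ yx, of "\<lambda>_. - 1" n "j n"] smul_const_minus[OF yx, of "j n"] neg by simp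
      have q3: "AE \<omega> in M. \<bar>q n (?a \<ominus>\<^bsub>E\<^esub> ?b) \<omega>\<bar> \<le> dst ?a ?b \<omega>"
        unfolding dst_def by (rule dual_realD(4)[OF q]) (use y in simp)
      show "AE \<omega> in M. \<bar>max 0 (dst (mid ?a ?b) x \<omega> - \<theta> * S \<omega>)\<bar> \<le> 5 * \<bar>Y n \<omega>\<bar>"
        using uc[OF y y x r, of n "j n"] q1 q2 q3 qn[of n] dst_mid_le[OF y y x, of n "j n"]
      proof eventually_elim
        case (elim \<omega>)
        define A B D Z Q where "A = dst ?a x \<omega>" and "B = dst ?b x \<omega>" and "D = dst ?a ?b \<omega>"
          and "Z = dst (mid ?a ?b) x \<omega>" and "Q = \<bar>q n (?b \<ominus>\<^bsub>E\<^esub> x) \<omega>\<bar>"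
        have X: "A \<le> S \<omega> + X n \<omega>" "B \<le> S \<omega> + X (j n) \<omega>" "0 \<le> X n \<omega>" "0 \<le> X (j n) \<omega>" "0 \<le> Q"
          by (auto simp: A_def B_def X_def Q_def)
        have Y: "Y n \<omega> = Q + (X n \<omega> + X (j n) \<omega>)" by (simp add: Y_def Q_def)
        have le: "A \<le> r \<omega>" "B \<le> r \<omega>" "0 \<le> Y n \<omega>" "Q \<le> Y n \<omega>" using X by (auto simp: r_def Y)
        have AD: "A - Q \<le> D" using elim(2-5) by (simp add: A_def Q_def D_def)
        have Zle: "Z \<le> (A + B) / 2" using elim(6) by (simp add: Z_def A_def B_def)
        have r0: "0 \<le> r \<omega>" using S0[of \<omega>] le(3) by (simp add: r_def)
        have "\<theta> * r \<omega> \<le> \<theta> * S \<omega> + Y n \<omega>"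
          using mult_right_mono[of \<theta> 1 "Y n \<omega>"] le(3) \<theta> by (simp add: r_def distrib_left)
        moreover have "Z \<le> \<theta> * r \<omega> + 4 * Y n \<omega>"
        proof (cases "A \<le> r \<omega> / 2")
          case True
          then have "Z \<le> 3/4 * r \<omega>" using Zle le by simp
          also have "\<dots> \<le> \<theta> * r \<omega>" using \<theta>(1) r0 by (rule mult_right_mono)
          finally show ?thesis using le(3) by simp
        next
          case A: False
          show ?thesis
          proof (cases "Y n \<omega> \<le> r \<omega> / 4")
            case True
            then have "1/4 * r \<omega> \<le> D" using A AD le by linarith
            moreover have "0 < r \<omega>" using A le r0 by (cases "r \<omega> = 0") auto
            ultimately have "Z \<le> (1 - \<eta>) * r \<omega>"
              using elim(1) le unfolding A_def B_def D_def Z_def by blast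
            also have "\<dots> \<le> \<theta> * r \<omega>" using \<theta>(2) r0 by (rule mult_right_mono)
            finally show ?thesis using le(3) by simp
          next
            case False
            then have "r \<omega> < 4 * Y n \<omega>" by simp
            moreover have "Z \<le> r \<omega>" using Zle le(1,2) by simp
            moreover have "0 \<le> \<theta> * r \<omega>" using \<theta>(3) r0 by simp
            ultimately show ?thesis by linarith
          qed
        qed
        ultimately show ?case using le(3) by (simp add: Z_def)
      qed
    qed
    with jlim show "\<exists>j. filterlim j sequentially sequentially \<and>
        vanishing M sequentially (\<lambda>n \<omega>. max 0 (dst (mid (y n) (y (j n))) x \<omega> - \<theta> * S \<omega>))" by blast
  qed
qed

end

section \<open>Asymptotically nonexpansive mappings\<close>

locale asymptotically_nonexpansive = random_normed_module M K E N
  for M :: "'w measure" and K :: "complex set"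
    and E :: "(('w \<Rightarrow> complex) set, 'e) module" and N :: "'e \<Rightarrow> ('w \<Rightarrow> real) set" +
  fixes G :: "'e set" and f :: "'e \<Rightarrow> 'e" and R :: "'w \<Rightarrow> real" and lip :: "nat \<Rightarrow> 'w \<Rightarrow> real"
  assumes UC: "random_uniformly_convex M E N"
    and G_sub: "G \<subseteq> carrier E"
    and G_closed: "closedin (el_topology M E N) G"
    and G_mid: "x \<in> G \<Longrightarrow> y \<in> G \<Longrightarrow> mid x y \<in> G"
    and R_measurable [measurable]: "R \<in> borel_measurable M"
    and G_bounded: "x \<in> G \<Longrightarrow> AE \<omega> in M. nm x \<omega> \<le> R \<omega>"
    and f_in: "x \<in> G \<Longrightarrow> f x \<in> G"
    and lip_measurable [measurable]: "lip m \<in> borel_measurable M"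
    and lip_tendsto: "AE \<omega> in M. (\<lambda>m. lip m \<omega>) \<longlonglongrightarrow> 1"
    and lipschitz: "x \<in> G \<Longrightarrow> y \<in> G \<Longrightarrow> AE \<omega> in M. dst ((f ^^ m) x) ((f ^^ m) y) \<omega> \<le> lip m \<omega> * dst x y \<omega>"
begin

lemma G_in [simp]: "x \<in> G \<Longrightarrow> x \<in> carrier E"
  using G_sub by blast

lemma pow_in [simp]: "x \<in> G \<Longrightarrow> (f ^^ m) x \<in> G"
  by (induction m) (auto intro: f_in)

lemma G_diameter:
  assumes x: "x \<in> G" and y: "y \<in> G"
  shows "AE \<omega> in M. dst x y \<omega> \<le> 2 * \<bar>R \<omega>\<bar>"
proof -
  have "AE \<omega> in M. dst x y \<omega> \<le> nm x \<omega> + nm (\<ominus>\<^bsub>E\<^esub> y) \<omega>"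
    unfolding dst_def a_minus_def using x y by (intro nm_add) auto
  with G_bounded[OF x] G_bounded[OF y] nm_uminus[OF G_in[OF y]] show ?thesis
    by eventually_elim linarith
qed

definition almost_fixed :: "(nat \<Rightarrow> 'e) \<Rightarrow> bool" where
  "almost_fixed y \<longleftrightarrow> vanishing M iterated (\<lambda>p. dst ((f ^^ fst p) (y (snd p))) (y (snd p)))"

text \<open>For fixed \<open>m\<close>, induction with |f^(m+1) y - y| \<le> |f^m (f y) - f^m y| +
  |f^m y - y|. The factor \<open>lip m\<close> is random but does not depend on \<open>n\<close>, so
  it does no harm to the inner limit.\<close>

lemma almost_fixedI:
  assumes y: "\<And>n. y n \<in> G" and van: "vanishing M sequentially (\<lambda>n. dst (f (y n)) (y n))"
  shows "almost_fixed y"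
  unfolding almost_fixed_def
proof (rule vanishing_iteratedI, simp only: fst_conv snd_conv)
  fix m show "vanishing M sequentially (\<lambda>n. dst ((f ^^ m) (y n)) (y n))"
  proof (induction m)
    case 0
    show ?case
    proof (rule vanishing_dominated[OF _ van, where C = 0])
      show "AE \<omega> in M. \<bar>dst ((f ^^ 0) (y n)) (y n) \<omega>\<bar> \<le> 0 * \<bar>dst (f (y n)) (y n) \<omega>\<bar>" for n
        using dst_self[OF G_in[OF y[of n]]] by simp
    qed (use y in simp)
  next
    case (Suc m)
    have sum: "vanishing M sequentially (\<lambda>n \<omega>. lip m \<omega> * dst (f (y n)) (y n) \<omega> + dst ((f ^^ m) (y n)) (y n) \<omega>)"
      by (intro vanishing_add vanishing_mult van Suc lip_measurable)
    show ?case
    proof (rule vanishing_dominated[OF _ sum, where C = 1])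
      fix n
      have in_G: "y n \<in> G" "f (y n) \<in> G" "(f ^^ m) (y n) \<in> G" "(f ^^ Suc m) (y n) \<in> G"
        using y[of n] f_in by (auto simp del: funpow.simps)
      note c = in_G[THEN G_in]
      show "dst ((f ^^ Suc m) (y n)) (y n) \<in> borel_measurable M" by (rule dst_measurable[OF c(4,1)])
      have "AE \<omega> in M. dst ((f ^^ Suc m) (y n)) ((f ^^ m) (y n)) \<omega> \<le> lip m \<omega> * dst (f (y n)) (y n) \<omega>"
        using lipschitz[OF in_G(2,1), of m] by (simp add: funpow_swap1)
      with dst_triangle[OF c(4,3,1)] dst_nonneg[OF c(4,1)]
      show "AE \<omega> in M. \<bar>dst ((f ^^ Suc m) (y n)) (y n) \<omega>\<bar> \<le>
          1 * \<bar>lip m \<omega> * dst (f (y n)) (y n) \<omega> + dst ((f ^^ m) (y n)) (y n) \<omega>\<bar>"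
      proof eventually_elim
        case (elim \<omega>)
        have "dst ((f ^^ Suc m) (y n)) (y n) \<omega> \<le> lip m \<omega> * dst (f (y n)) (y n) \<omega> + dst ((f ^^ m) (y n)) (y n) \<omega>"
          by (rule order_trans[OF elim(1) add_right_mono[OF elim(3)]])
        then show ?case unfolding mult_1 abs_of_nonneg[OF elim(2)] by (rule order_trans[OF _ abs_ge_self])
      qed
    qed
  qed
qed

lemma almost_fixed_reindex:
  assumes y: "almost_fixed y" and j: "filterlim j sequentially sequentially"
  shows "almost_fixed (\<lambda>n. y (j n))"
  using vanishing_compose[OF y[unfolded almost_fixed_def] filterlim_iterated_reindex[OF j]]
  by (simp add: almost_fixed_def case_prod_unfold)

text \<open>The price of treating \<open>f ^^ m\<close> as nonexpansive on \<open>G\<close>: a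
  diameter bound times the excess of the Lipschitz constant over 1. It depends on the outer index
  only.\<close>

lemma vanishing_lip: "vanishing M iterated (\<lambda>p \<omega>. 2 * \<bar>R \<omega>\<bar> * (lip (fst p) \<omega> - 1))"
proof (rule vanishing_mult)
  have "vanishing M sequentially (\<lambda>m \<omega>. lip m \<omega> - 1)"
  proof (rule vanishing_AE_tendsto)
    show "AE \<omega> in M. (\<lambda>m. lip m \<omega> - 1) \<longlonglongrightarrow> 0"
      using lip_tendsto by eventually_elim (simp add: LIM_zero)
  qed measurable
  from vanishing_compose[OF this filterlim_fst_iterated]
  show "vanishing M iterated (\<lambda>p \<omega>. lip (fst p) \<omega> - 1)" .
qed measurable

lemma lipschitz_near_one:
  assumes x: "x \<in> G" and y: "y \<in> G"
  shows "AE \<omega> in M. dst ((f ^^ m) x) ((f ^^ m) y) \<omega> \<le> dst x y \<omega> + \<bar>2 * \<bar>R \<omega>\<bar> * (lip m \<omega> - 1)\<bar>"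
  using lipschitz[OF x y, of m] G_diameter[OF x y] dst_nonneg[OF G_in[OF x] G_in[OF y]]
proof eventually_elim
  case (elim \<omega>)
  have "(lip m \<omega> - 1) * dst x y \<omega> \<le> \<bar>lip m \<omega> - 1\<bar> * dst x y \<omega>"
    using elim(3) by (intro mult_right_mono) auto
  also have "\<dots> \<le> \<bar>lip m \<omega> - 1\<bar> * (2 * \<bar>R \<omega>\<bar>)"
    using elim(2) by (intro mult_left_mono) auto
  also have "\<dots> = \<bar>2 * \<bar>R \<omega>\<bar> * (lip m \<omega> - 1)\<bar>" by (simp add: abs_mult)
  finally show ?case using elim(1) by (simp add: algebra_simps)
qed

text \<open>Let D be the distance of the end points, z their midpoint and r = D/2 + Y. Then f^m z is
  within r of both end points. If it is farther than \<epsilon> r from z, uniform convexity gives D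
  \<le> 2 (1 - \<eta>) r, that is \<eta> r \<le> Y, so the whole configuration is of the size of the
  error.\<close>

lemma almost_fixed_mid:
  assumes y: "\<And>n. y n \<in> G" and y': "\<And>n. y' n \<in> G" and af: "almost_fixed y" "almost_fixed y'"
  shows "almost_fixed (\<lambda>n. mid (y n) (y' n))"
proof -
  define Y where "Y p \<omega> = \<bar>2 * \<bar>R \<omega>\<bar> * (lip (fst p) \<omega> - 1)\<bar> +
    (\<bar>dst ((f ^^ fst p) (y (snd p))) (y (snd p)) \<omega>\<bar> + \<bar>dst ((f ^^ fst p) (y' (snd p))) (y' (snd p)) \<omega>\<bar>)" for p \<omega>
  have Y: "vanishing M iterated Y"
    unfolding Y_def[abs_def] using af vanishing_lip unfolding almost_fixed_def by (intro vanishing_add vanishing_abs)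
  have [measurable]: "Y p \<in> borel_measurable M" for p using Y unfolding vanishing_def by blast
  show ?thesis
    unfolding almost_fixed_def
  proof (rule vanishing_dominated_eps[OF _ R_measurable])
    have z: "mid (y n) (y' n) \<in> G" for n using y y' G_mid by blast
    show "dst ((f ^^ fst p) (mid (y (snd p)) (y' (snd p)))) (mid (y (snd p)) (y' (snd p))) \<in> borel_measurable M" for p
      using z by (intro dst_measurable G_in pow_in)
    fix \<epsilon> :: real assume \<epsilon>: "0 < \<epsilon>"
    \<comment> \<open>The separation passed to uniform convexity is 2\<epsilon>', since the distance
      to the midpoint enters doubled; it must not exceed 2.\<close>
    define \<epsilon>' where "\<epsilon>' = min \<epsilon> 1"
    have \<epsilon>': "0 < 2 * \<epsilon>'" "2 * \<epsilon>' \<le> 2" "\<epsilon>' \<le> \<epsilon>" using \<epsilon> by (auto simp: \<epsilon>'_def)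
    obtain \<eta> where \<eta>: "0 < \<eta>" and uc: "\<And>a b c r. a \<in> carrier E \<Longrightarrow> b \<in> carrier E \<Longrightarrow> c \<in> carrier E \<Longrightarrow> r \<in> borel_measurable M \<Longrightarrow>
      AE \<omega> in M. 0 < r \<omega> \<longrightarrow> dst a c \<omega> \<le> r \<omega> \<longrightarrow> dst b c \<omega> \<le> r \<omega> \<longrightarrow> 2 * \<epsilon>' * r \<omega> \<le> 2 * dst (mid a b) c \<omega> \<longrightarrow>
        dst a b \<omega> \<le> 2 * (1 - \<eta>) * r \<omega>"
      by (rule uniformly_convex_mid[OF UC \<epsilon>'(1,2)]) blast
    show "\<exists>W. vanishing M iterated W \<and> (\<forall>p. AE \<omega> in M.
        \<bar>dst ((f ^^ fst p) (mid (y (snd p)) (y' (snd p)))) (mid (y (snd p)) (y' (snd p))) \<omega>\<bar> \<le> \<epsilon> * \<bar>R \<omega>\<bar> + \<bar>W p \<omega>\<bar>)"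
    \<comment> \<open>The summand 1 covers the error contained in \<epsilon>' r; 2 / \<eta> covers
      the other case, where the distance is at most 2r and r \<le> Y / \<eta>.\<close>
    proof (intro exI[of _ "\<lambda>p \<omega>. (1 + 2 / \<eta>) * Y p \<omega>"] conjI allI)
      show "vanishing M iterated (\<lambda>p \<omega>. (1 + 2 / \<eta>) * Y p \<omega>)" by (rule vanishing_mult[OF Y]) simp
      fix p :: "nat \<times> nat"
      obtain m n where p: "p = (m, n)" by force
      let ?a = "y n" and ?b = "y' n" and ?z = "mid (y n) (y' n)"
      let ?c = "(f ^^ m) ?z" and ?a' = "(f ^^ m) ?a" and ?b' = "(f ^^ m) ?b"
      have c: "?a \<in> carrier E" "?b \<in> carrier E" "?z \<in> carrier E" "?c \<in> carrier E" "?a' \<in> carrier E" "?b' \<in> carrier E"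
        using y[of n] y'[of n] z[of n] by simp_all
      note [measurable] = dst_measurable[OF c(1,2)]
      define r where "r \<omega> = dst ?a ?b \<omega> / 2 + Y p \<omega>" for \<omega>
      have r: "r \<in> borel_measurable M" unfolding r_def by measurable
      have near: "AE \<omega> in M. dst ?a ?c \<omega> \<le> r \<omega> \<and> dst ?b ?c \<omega> \<le> r \<omega>"
        using lipschitz_near_one[OF z[of n] y[of n], of m] lipschitz_near_one[OF z[of n] y'[of n], of m]
          dst_triangle[OF c(4,5,1)] dst_triangle[OF c(4,6,2)] dst_mid_left[OF c(1,2)]
          dst_commute[OF c(1,4)] dst_commute[OF c(2,4)]
        by eventually_elim (simp add: r_def Y_def p, linarith)
      show "AE \<omega> in M. \<bar>dst ((f ^^ fst p) (mid (y (snd p)) (y' (snd p)))) (mid (y (snd p)) (y' (snd p))) \<omega>\<bar> \<le>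
          \<epsilon> * \<bar>R \<omega>\<bar> + \<bar>(1 + 2 / \<eta>) * Y p \<omega>\<bar>"
        using near uc[OF c(1,2,4) r] dst_nonneg[OF c(1,2)] dst_nonneg[OF c(4,3)] dst_commute[OF c(4,3)]
          dst_triangle[OF c(4,1,3)] dst_mid_left(1)[OF c(1,2)] dst_commute[OF c(1,3)] dst_commute[OF c(1,4)]
          G_diameter[OF y[of n] y'[of n]]
      proof eventually_elim
        case (elim \<omega>)
        define D X where "D = dst ?a ?b \<omega>" and "X = dst ?c ?z \<omega>"
        have Y0: "0 \<le> Y p \<omega>" by (simp add: Y_def)
        have r0: "0 \<le> r \<omega>" using elim(3) Y0 by (simp add: r_def)
        have rD: "r \<omega> = D / 2 + Y p \<omega>" by (simp add: r_def D_def)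
        have Xr: "X \<le> r \<omega> + D / 2" using elim unfolding X_def D_def by linarith
        have Y\<eta>: "0 \<le> 2 / \<eta> * Y p \<omega>" using Y0 \<eta> by simp
        have \<epsilon>R: "0 \<le> \<epsilon> * \<bar>R \<omega>\<bar>" using \<epsilon> by simp
        have "X \<le> \<epsilon> * \<bar>R \<omega>\<bar> + (1 + 2 / \<eta>) * Y p \<omega>"
        proof (cases "X < \<epsilon>' * r \<omega>")
          case True
          have "D / 2 \<le> \<bar>R \<omega>\<bar>" using elim by (simp add: D_def)
          then have "\<epsilon>' * (D / 2) \<le> \<epsilon> * \<bar>R \<omega>\<bar>" using \<epsilon>' elim(3) by (intro mult_mono) (auto simp: D_def)
          moreover have "\<epsilon>' * Y p \<omega> \<le> 1 * Y p \<omega>" using \<epsilon>' Y0 by (intro mult_right_mono) auto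
          ultimately show ?thesis using True Y\<eta> unfolding rD by (simp add: distrib_left distrib_right)
        next
          case False
          show ?thesis
          \<comment> \<open>Uniform convexity asks for a positive radius; for r = 0 everything
            collapses.\<close>
          proof (cases "r \<omega> = 0")
            case True
            then show ?thesis using Xr Y0 Y\<eta> \<epsilon>R rD by (simp add: distrib_right)
          next
            case r: False
            have "2 * \<epsilon>' * r \<omega> \<le> 2 * dst ?z ?c \<omega>" using False elim(5) by (simp add: X_def)
            then have "D \<le> 2 * (1 - \<eta>) * r \<omega>" using elim(1,2) r r0 unfolding D_def by auto
            then have "\<eta> * r \<omega> \<le> Y p \<omega>" using rD by (simp add: algebra_simps)
            then have "r \<omega> \<le> Y p \<omega> / \<eta>" using \<eta> by (simp add: pos_le_divide_eq mult.commute)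
            moreover have "X \<le> 2 * r \<omega>" using Xr rD Y0 by simp
            ultimately show ?thesis using Y0 \<epsilon>R by (simp add: distrib_right)
          qed
        qed
        then show ?case using elim(4) by (simp add: X_def p)
      qed
    qed
  qed
qed

text \<open>The number \<open>k\<close> of rounds is used in two ways: it tends to infinity to show
  \<open>x \<in> G\<close>, and it is held fixed, depending on the tolerance, while \<open>n\<close>
  and then \<open>m\<close> tend to infinity to show that \<open>(f ^^ m) x\<close> approaches
  \<open>x\<close>.\<close>

lemma weak_limit_fixed:
  assumes u: "\<And>n. u n \<in> G" and x: "x \<in> carrier E"
    and weak: "weakly_vanishing u x" and af: "almost_fixed u"
  shows "x \<in> G" "f x = x"
proof -
  obtain \<theta> where \<theta>: "0 \<le> \<theta>" "\<theta> < 1" and contr: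
    "\<And>y x S. (\<And>n. y n \<in> carrier E) \<Longrightarrow> x \<in> carrier E \<Longrightarrow> weakly_vanishing y x \<Longrightarrow> S \<in> borel_measurable M \<Longrightarrow>
      (\<And>\<omega>. 0 \<le> S \<omega>) \<Longrightarrow> vanishing M sequentially (\<lambda>n \<omega>. max 0 (dst (y n) x \<omega> - S \<omega>)) \<Longrightarrow>
      \<exists>j. filterlim j sequentially sequentially \<and>
        vanishing M sequentially (\<lambda>n \<omega>. max 0 (dst (mid (y n) (y (j n))) x \<omega> - \<theta> * S \<omega>))"
    by (rule midpoint_contraction[OF UC]) blast
  \<comment> \<open>Initial radius: by the triangle inequality no point of \<open>G\<close> is
    farther than \<open>S\<close> from \<open>x\<close>.\<close>
  define S where "S \<omega> = \<bar>R \<omega>\<bar> + \<bar>nm x \<omega>\<bar>" for \<omega>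
  note [measurable] = nm_measurable[OF x]
  have S[measurable]: "S \<in> borel_measurable M" unfolding S_def by measurable
  have S0: "0 \<le> S \<omega>" for \<omega> by (simp add: S_def)
  define X where "X k y n \<omega> = max 0 (dst (y n) x \<omega> - \<theta> ^ k * S \<omega>)" for k :: nat and y :: "nat \<Rightarrow> 'e" and n \<omega>
  have "\<exists>y. (\<forall>n. y n \<in> G) \<and> weakly_vanishing y x \<and> almost_fixed y \<and> vanishing M sequentially (X k y)" for k
  proof (induction k)
    case 0
    have zero: "vanishing M sequentially (\<lambda>n \<omega>. 0)" by (simp add: vanishing_def)
    have "vanishing M sequentially (X 0 u)"
    proof (rule vanishing_dominated[OF _ zero, where C = 1])
      fix n
      have un: "u n \<in> carrier E" using u by simp
      note [measurable] = dst_measurable[OF un x]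
      show "X 0 u n \<in> borel_measurable M" unfolding X_def by measurable
      have "AE \<omega> in M. dst (u n) x \<omega> \<le> nm (u n) \<omega> + nm (\<ominus>\<^bsub>E\<^esub> x) \<omega>"
        unfolding dst_def a_minus_def using un x by (intro nm_add) auto
      with G_bounded[OF u[of n]] nm_uminus[OF x] show "AE \<omega> in M. \<bar>X 0 u n \<omega>\<bar> \<le> 1 * \<bar>0\<bar>"
        by eventually_elim (auto simp: X_def S_def)
    qed
    then show ?case using u weak af by blast
  next
    case (Suc k)
    then obtain y where y: "\<And>n. y n \<in> G" and w: "weakly_vanishing y x" and af: "almost_fixed y"
      and van: "vanishing M sequentially (X k y)" by blast
    have yE: "y n \<in> carrier E" for n using y by simp
    obtain j where j: "filterlim j sequentially sequentially"
      and van': "vanishing M sequentially (\<lambda>n \<omega>. max 0 (dst (mid (y n) (y (j n))) x \<omega> - \<theta> * (\<theta> ^ k * S \<omega>)))"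
      using contr[OF yE x w, of "\<lambda>\<omega>. \<theta> ^ k * S \<omega>"] van \<theta>(1) S0 unfolding X_def[abs_def] by auto
    show ?case
    proof (intro exI[of _ "\<lambda>n. mid (y n) (y (j n))"] conjI allI)
      show "mid (y n) (y (j n)) \<in> G" for n using y by (intro G_mid)
      show "weakly_vanishing (\<lambda>n. mid (y n) (y (j n))) x"
        by (rule weakly_vanishing_mid[OF yE yE x w weakly_vanishing_reindex[OF w j]])
      show "almost_fixed (\<lambda>n. mid (y n) (y (j n)))"
        by (rule almost_fixed_mid[OF y y af almost_fixed_reindex[OF af j]])
      show "vanishing M sequentially (X (Suc k) (\<lambda>n. mid (y n) (y (j n))))"
        using van' unfolding X_def[abs_def] by (simp add: mult.assoc)
    qed
  qed
  then obtain y where y: "\<And>k n. y k n \<in> G" and afy: "\<And>k. almost_fixed (y k)"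
    and vX: "\<And>k. vanishing M sequentially (X k (y k))" by metis
  have yE: "y k n \<in> carrier E" for k n using y by simp
  have "vanishing M sequentially (\<lambda>k \<omega>. \<theta> ^ k * S \<omega>)"
  proof (rule vanishing_AE_tendsto)
    have "(\<lambda>k. \<theta> ^ k * S \<omega>) \<longlonglongrightarrow> 0" for \<omega>
      using tendsto_mult_left_zero[OF LIMSEQ_power_zero[of \<theta>]] \<theta> by simp
    then show "AE \<omega> in M. (\<lambda>k. \<theta> ^ k * S \<omega>) \<longlonglongrightarrow> 0" by simp
  qed measurable
  from vanishing_compose[OF this filterlim_fst_iterated]
  have van1: "vanishing M iterated (\<lambda>p \<omega>. \<theta> ^ fst p * S \<omega>)" .
  \<comment> \<open>The filter \<open>iterated\<close> is reused with the number of rounds as outer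
    index; no diagonal sequence has to be selected.\<close>
  have van2: "vanishing M iterated (\<lambda>p. X (fst p) (y (fst p)) (snd p))"
    by (rule vanishing_iteratedI) (simp add: vX)
  have van_y: "vanishing M iterated (\<lambda>p. dst (y (fst p) (snd p)) x)"
  proof (rule vanishing_dominated[OF _ vanishing_add[OF van1 van2], where C = 1])
    fix p
    show "dst (y (fst p) (snd p)) x \<in> borel_measurable M" by (rule dst_measurable[OF yE x])
    show "AE \<omega> in M. \<bar>dst (y (fst p) (snd p)) x \<omega>\<bar> \<le> 1 * \<bar>\<theta> ^ fst p * S \<omega> + X (fst p) (y (fst p)) (snd p) \<omega>\<bar>"
      using dst_nonneg[OF yE[of "fst p" "snd p"] x] by eventually_elim (simp add: X_def)
  qed
  show xG: "x \<in> G"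
  proof (rule closedin_el_approx[OF G_closed x])
    fix e l :: real assume "0 < e" "0 < l"
    from vanishing_prob_gt[OF van_y this] iterated_neq_bot
    obtain p where "prob {\<omega> \<in> space M. dst (y (fst p) (snd p)) x \<omega> < e} > 1 - l"
      using eventually_happens' by blast
    then show "\<exists>z\<in>G. prob {\<omega> \<in> space M. dst z x \<omega> < e} > 1 - l" using y by blast
  qed
  have van_pow: "vanishing M iterated (\<lambda>p. dst ((f ^^ fst p) x) x)"
  proof (rule vanishing_dominated_eps[OF _ S])
    show "dst ((f ^^ fst p) x) x \<in> borel_measurable M" for p :: "nat \<times> nat"
      using xG by (intro dst_measurable G_in pow_in)
    fix \<epsilon> :: real assume \<epsilon>: "0 < \<epsilon>"
    \<comment> \<open>The distance from \<open>x\<close> to the approximating point enters twice,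
      once through \<open>f ^^ m\<close> and once directly, hence half of \<epsilon>.\<close>
    obtain k where k: "\<theta> ^ k < \<epsilon> / 2" using real_arch_pow_inv[of "\<epsilon> / 2" \<theta>] \<epsilon> \<theta> by auto
    define A where "A p = dst ((f ^^ fst p) (y k (snd p))) (y k (snd p))" for p :: "nat \<times> nat"
    define L where "L p \<omega> = 2 * \<bar>R \<omega>\<bar> * (lip (fst p) \<omega> - 1)" for p :: "nat \<times> nat" and \<omega>
    have vA: "vanishing M iterated A" using afy[of k] unfolding almost_fixed_def A_def[abs_def] .
    have vL: "vanishing M iterated L" unfolding L_def[abs_def] by (rule vanishing_lip)
    have vXk: "vanishing M iterated (\<lambda>p. X k (y k) (snd p))"
      by (rule vanishing_compose[OF vX filterlim_snd_iterated])
    have "vanishing M iterated (\<lambda>p \<omega>. 2 * X k (y k) (snd p) \<omega> + (\<bar>L p \<omega>\<bar> + \<bar>A p \<omega>\<bar>))"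
      by (intro vanishing_add vanishing_mult vanishing_abs vA vL vXk borel_measurable_const)
    moreover have "AE \<omega> in M. \<bar>dst ((f ^^ fst p) x) x \<omega>\<bar> \<le>
        \<epsilon> * \<bar>S \<omega>\<bar> + \<bar>2 * X k (y k) (snd p) \<omega> + (\<bar>L p \<omega>\<bar> + \<bar>A p \<omega>\<bar>)\<bar>" for p
    proof -
      let ?y = "y k (snd p)" and ?fx = "(f ^^ fst p) x"
      let ?fy = "(f ^^ fst p) ?y"
      have c: "?y \<in> carrier E" "?fx \<in> carrier E" "?fy \<in> carrier E" using y xG by simp_all
      show ?thesis
        using lipschitz_near_one[OF xG y, of "fst p" k "snd p"] dst_triangle[OF c(2,3) x] dst_triangle[OF c(3,1) x]
          dst_nonneg[OF c(2) x] dst_commute[OF x c(1)]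
      proof eventually_elim
        case (elim \<omega>)
        have "dst ?y x \<omega> \<le> \<theta> ^ k * S \<omega> + X k (y k) (snd p) \<omega>" by (simp add: X_def)
        moreover have "\<theta> ^ k * S \<omega> \<le> \<epsilon> / 2 * S \<omega>" using k S0[of \<omega>] by (intro mult_right_mono) auto
        moreover have "0 \<le> X k (y k) (snd p) \<omega>" by (simp add: X_def)
        moreover have "\<bar>S \<omega>\<bar> = S \<omega>" using S0[of \<omega>] by simp
        ultimately show ?case
          using elim unfolding L_def A_def by (simp only: abs_of_nonneg)
      qed
    qed
    ultimately show "\<exists>W. vanishing M iterated W \<and> (\<forall>p. AE \<omega> in M. \<bar>dst ((f ^^ fst p) x) x \<omega>\<bar> \<le> \<epsilon> * \<bar>S \<omega>\<bar> + \<bar>W p \<omega>\<bar>)"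
      by blast
  qed
  \<comment> \<open>Nothing depends on the inner index any more, so the iterated limit is an
    ordinary one.\<close>
  have "vanishing M sequentially (\<lambda>m. dst ((f ^^ m) x) x)"
    unfolding vanishing_def
  proof (intro conjI allI impI)
    show "dst ((f ^^ m) x) x \<in> borel_measurable M" for m using xG by (intro dst_measurable G_in pow_in)
    show "\<forall>\<^sub>F m in sequentially. prob {\<omega> \<in> space M. e \<le> \<bar>dst ((f ^^ m) x) x \<omega>\<bar>} < e" if "0 < e" for e
      using vanishingD[OF van_pow that] by (simp add: eventually_iterated)
  qed
  note vpow = this
  \<comment> \<open>The point \<open>(f ^^ Suc m) x\<close> is close to \<open>x\<close> and, by the
    random Lipschitz constant \<open>lip 1\<close>, also close to \<open>f x\<close>.\<close>
  have "vanishing M sequentially (\<lambda>m. dst ((f ^^ Suc m) x) x)"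
    using vanishing_compose[OF vpow filterlim_Suc] .
  from vanishing_add[OF vanishing_mult[OF vpow lip_measurable[of 1]] this]
  have sum: "vanishing M sequentially (\<lambda>m \<omega>. lip 1 \<omega> * dst ((f ^^ m) x) x \<omega> + dst ((f ^^ Suc m) x) x \<omega>)" .
  have fx: "f x \<in> carrier E" using f_in[OF xG] by simp
  have "vanishing M sequentially (\<lambda>_::nat. dst (f x) x)"
  proof (rule vanishing_dominated[OF _ sum, where C = 1])
    show "dst (f x) x \<in> borel_measurable M" by (rule dst_measurable[OF fx x])
    fix m
    have m: "(f ^^ m) x \<in> G" "(f ^^ Suc m) x \<in> carrier E" using xG pow_in[OF xG, of "Suc m"] by (simp_all del: funpow.simps)
    have "AE \<omega> in M. dst ((f ^^ Suc m) x) (f x) \<omega> \<le> lip 1 \<omega> * dst ((f ^^ m) x) x \<omega>"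
      using lipschitz[OF m(1) xG, of 1] by simp
    with dst_triangle[OF fx m(2) x] dst_commute[OF fx m(2)] dst_nonneg[OF fx x]
    show "AE \<omega> in M. \<bar>dst (f x) x \<omega>\<bar> \<le> 1 * \<bar>lip 1 \<omega> * dst ((f ^^ m) x) x \<omega> + dst ((f ^^ Suc m) x) x \<omega>\<bar>"
    proof eventually_elim
      case (elim \<omega>)
      have "dst (f x) x \<omega> \<le> lip 1 \<omega> * dst ((f ^^ m) x) x \<omega> + dst ((f ^^ Suc m) x) x \<omega>"
        by (rule order_trans[OF elim(1) add_right_mono]) (use elim(2,4) in simp)
      then show ?case unfolding mult_1 abs_of_nonneg[OF elim(3)] by (rule order_trans[OF _ abs_ge_self])
    qed
  qed
  then have "AE \<omega> in M. dst (f x) x \<omega> = 0" by (rule vanishing_const) simp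
  then show "f x = x" by (rule dst_eq_zero[OF fx x])
qed

end

section \<open>From the stated hypotheses to their pointwise form\<close>

lemma (in random_normed_module) as_bounded_bound:
  assumes G: "as_bounded M N G" "G \<subseteq> carrier E"
  obtains R where "R \<in> borel_measurable M" "\<And>x. x \<in> G \<Longrightarrow> AE \<omega> in M. nm x \<omega> \<le> R \<omega>"
proof -
  obtain \<xi> where \<xi>: "\<xi> \<in> L0_plus M" and lub: "is_lub (L0_bar M) (L0_ext M \<xi>) {L0_ext M (N x) |x. x \<in> G}"
    using G(1) unfolding as_bounded_def by blast
  have \<xi>c: "\<xi> \<in> L0_set M UNIV" using \<xi> by (simp add: L0_plus_def)
  have ext: "(\<lambda>\<omega>. ereal (rep \<zeta> \<omega>)) \<in> rvars M UNIV" if "\<zeta> \<in> L0_set M UNIV" for \<zeta> :: "('w \<Rightarrow> real) set"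
    using rep_measurable[OF that] by (simp add: rvars_iff)
  show ?thesis
  proof (rule that[of "rep \<xi>"])
    show "rep \<xi> \<in> borel_measurable M" by (rule rep_measurable[OF \<xi>c])
    fix x assume x: "x \<in> G"
    have xc: "N x \<in> L0_set M UNIV" using x G(2) by (intro N_in) blast
    have "L0_ext M (N x) \<in> carrier (L0_bar M)"
      unfolding L0_ext_def L0_bar_def using L0_cls_in[OF ext[OF xc]] by simp
    moreover have "L0_ext M \<xi> \<in> Upper (L0_bar M) {L0_ext M (N x) |x. x \<in> G}"
      using lub by (auto simp: least_def)
    ultimately have "L0_le M (L0_ext M (N x)) (L0_ext M \<xi>)"
      using x unfolding Upper_def L0_bar_def by auto
    then show "AE \<omega> in M. nm x \<omega> \<le> rep \<xi> \<omega>"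
      using rep_L0_cls[OF ext[OF xc]] rep_L0_cls[OF ext[OF \<xi>c]]
      unfolding L0_le_def L0_ext_def by eventually_elim simp
  qed
qed

theorem theorem2p4:
  fixes M :: "'w measure"
    and K :: "complex set"
    and E :: "(('w \<Rightarrow> complex) set, 'e) module"
    and N :: "'e \<Rightarrow> ('w \<Rightarrow> real) set"
    and G :: "'e set"
    and f :: "'e \<Rightarrow> 'e"
  assumes "prob_space M"
    and "K = \<real> \<or> K = UNIV"
    and "RN_module M K E N"
    and "RN_complete M E N"
    and "random_uniformly_convex M E N"
    and "full_support M E N"
    and "G \<noteq> {}" and "G \<subseteq> carrier E"
    and "as_bounded M N G"
    and "closedin (el_topology M E N) G"
    and "L0_convex M K E G"
    and "random_asymp_nonexpansive M E N G f"
  shows "random_demiclosed_at M K E N G (\<lambda>x. x \<ominus>\<^bsub>E\<^esub> f x) \<zero>\<^bsub>E\<^esub>"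
proof -
  interpret prob_space M by fact
  interpret RN_module M K E N by fact
  interpret random_normed_module M K E N
    by unfold_locales (fact assms(2))
  obtain R where R: "R \<in> borel_measurable M" "\<And>x. x \<in> G \<Longrightarrow> AE \<omega> in M. nm x \<omega> \<le> R \<omega>"
    using as_bounded_bound[OF assms(9,8)] by blast
  obtain \<eta> :: "nat \<Rightarrow> ('w \<Rightarrow> real) set" where f: "f \<in> G \<rightarrow> G" and \<eta>: "\<And>m. m \<ge> 1 \<Longrightarrow> \<eta> m \<in> L0_plus M"
    and lim: "AE \<omega> in M. (\<lambda>m. rep (\<eta> m) \<omega>) \<longlonglongrightarrow> 1"
    and lip: "\<And>m x y. m \<ge> 1 \<Longrightarrow> x \<in> G \<Longrightarrow> y \<in> G \<Longrightarrow>
      L0_le M (N ((f ^^ m) x \<ominus>\<^bsub>E\<^esub> (f ^^ m) y)) (\<eta> m \<otimes>\<^bsub>L0_real M\<^esub> N (x \<ominus>\<^bsub>E\<^esub> y))"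
    using assms(12) unfolding random_asymp_nonexpansive_def by blast
  \<comment> \<open>The given bounds start at \<open>m = 1\<close>. The zeroth iterate is the
    identity with constant 1, and changing one term does not affect the limit.\<close>
  define lc where "lc m = (if m = 0 then (\<lambda>_. 1) else rep (\<eta> m))" for m
  interpret asymptotically_nonexpansive M K E N G f R lc
  proof unfold_locales
    have \<eta>c: "\<eta> m \<in> L0_set M UNIV" if "m \<ge> 1" for m using \<eta>[OF that] by (simp add: L0_plus_def)
    show "lc m \<in> borel_measurable M" for m using rep_measurable[OF \<eta>c] by (simp add: lc_def)
    show "AE \<omega> in M. (\<lambda>m. lc m \<omega>) \<longlonglongrightarrow> 1"
      using lim
    proof eventually_elim
      case (elim \<omega>)
      have "\<forall>\<^sub>F m in sequentially. rep (\<eta> m) \<omega> = lc m \<omega>"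
        using eventually_gt_at_top[of 0] by eventually_elim (simp add: lc_def)
      with elim show ?case by (rule Lim_transform_eventually)
    qed
    fix x y m assume x: "x \<in> G" and y: "y \<in> G"
    show "AE \<omega> in M. dst ((f ^^ m) x) ((f ^^ m) y) \<omega> \<le> lc m \<omega> * dst x y \<omega>"
    proof (cases "m = 0")
      case False
      then have m: "m \<ge> 1" by simp
      have "x \<ominus>\<^bsub>E\<^esub> y \<in> carrier E" using x y assms(8) by blast
      from lip[OF m x y, unfolded L0_le_def] rep_real_mult_AE[OF \<eta>c[OF m] N_in[OF this]]
      have "AE \<omega> in M. nm ((f ^^ m) x \<ominus>\<^bsub>E\<^esub> (f ^^ m) y) \<omega> \<le> rep (\<eta> m) \<omega> * nm (x \<ominus>\<^bsub>E\<^esub> y) \<omega>"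
        by eventually_elim simp
      then show ?thesis using False by (simp add: lc_def dst_def)
    qed (simp add: lc_def)
  qed (use assms f R L0_convex_mid[OF assms(11)] in auto)
  show ?thesis
    unfolding random_demiclosed_at_def
  proof (intro allI impI)
    fix u :: "nat \<Rightarrow> 'e" and x
    assume u: "range u \<subseteq> G" and x: "x \<in> carrier E"
      and weak: "limitin (random_weak_topology M K E N) u x sequentially"
      and strong: "limitin (el_topology M E N) (\<lambda>n. u n \<ominus>\<^bsub>E\<^esub> f (u n)) \<zero>\<^bsub>E\<^esub> sequentially"
    have uG: "u n \<in> G" for n using u by blast
    have fu: "f (u n) \<in> carrier E" for n using f_in[OF uG] by simp
    have d: "u n \<ominus>\<^bsub>E\<^esub> f (u n) \<in> carrier E" for n using uG fu by simp
    have "vanishing M sequentially (\<lambda>n. dst (u n \<ominus>\<^bsub>E\<^esub> f (u n)) \<zero>\<^bsub>E\<^esub>)"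
      by (rule limitin_el_vanishing[OF strong d])
    moreover have "dst (u n \<ominus>\<^bsub>E\<^esub> f (u n)) \<zero>\<^bsub>E\<^esub> = dst (u n) (f (u n))" for n
      using d[of n] unfolding dst_def by (simp add: a_minus_def[of _ _ "\<zero>\<^bsub>E\<^esub>"] M.minus_equality[OF M.r_zero[OF M.zero_closed] M.zero_closed M.zero_closed])
    ultimately have v: "vanishing M sequentially (\<lambda>n. dst (u n) (f (u n)))" by simp
    have "vanishing M sequentially (\<lambda>n. dst (f (u n)) (u n))"
    proof (rule vanishing_dominated[OF _ v, where C = 1])
      show "dst (f (u n)) (u n) \<in> borel_measurable M" for n using fu uG by (intro dst_measurable) simp_all
      show "AE \<omega> in M. \<bar>dst (f (u n)) (u n) \<omega>\<bar> \<le> 1 * \<bar>dst (u n) (f (u n)) \<omega>\<bar>" for n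
        using dst_commute[OF fu G_in[OF uG], of n n] by eventually_elim simp
    qed
    then have af: "almost_fixed u" using uG by (intro almost_fixedI)
    have wv: "weakly_vanishing u x"
      by (rule limitin_random_weak_vanishing[OF weak G_in[OF uG] x])
    have "x \<in> G" "f x = x" using weak_limit_fixed[OF uG x wv af] by auto
    then show "x \<in> G \<and> x \<ominus>\<^bsub>E\<^esub> f x = \<zero>\<^bsub>E\<^esub>" using x by (simp add: a_minus_def M.r_neg)
  qed
qed

end
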